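(* The infinite word $\mathbf{s}=\mathbf{z}\,\varphi(\mathbf{z})\,\varphi^2(\mathbf{z})\cdots$ is pre-$5/4$-power-free.
   Context: Let $\Sigma_8=\{n_j : n\in\mathbb{Z},\ 0\le j\le 7\}$ be the infinite alphabet of distinct formal symbols $n_j$. Let $\varphi$ be the $6$-uniform morphism on $\Sigma_8$ (extended to finite and infinite words by concatenation) defined for all $n\in\mathbb{Z}$ by $\varphi(n_0)=0_0 1_1 0_2 0_3 1_4 (n+3)_5$, $\varphi(n_1)=1_6 1_7 0_0 0_1 0_2 (n+2)_3$, $\varphi(n_2)=1_4 1_5 1_6 0_7 0_0 (n+3)_1$, $\varphi(n_3)=0_2 1_3 1_4 0_5 1_6 (n+2)_7$, $\varphi(n_4)=0_0 1_1 0_2 0_3 1_4 (n+1)_5$, $\varphi(n_5)=1_6 1_7 0_0 0_1 0_2 (n+2)_3$, $\varphi(n_6)=1_4 1_5 1_6 0_7 0_0 (n+1)_1$, $\varphi(n_7)=0_2 1_3 1_4 0_5 1_6 (n+2)_7$. Let $\tau$ be the coding $\tau(n_j)=n$. A word over $\Sigma_8$ is subscript-increasing if the subscripts of consecutive letters increase by $1$ modulo $8$. A $5/4$-power is a word $xyx$ with $|x|\ge1$ and $|y|=3|x|$; a word is $5/4$-power-free if no factor is a $5/4$-power. Let $\mathbf{w}_{5/4}=w(0)w(1)\cdots$ be the lexicographically least infinite $5/4$-power-free word over $\mathbb{N}=\{0,1,2,\dots\}$. Let $\mathbf{z}$ be the length-$20226$ subscript-increasing word over $\Sigma_8$ starting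 with the letter $0_2$ and satisfying $\tau(\varphi(\mathbf{z}))=w(6764)w(6765)\cdots w(6764+6\cdot 20226-1)$ (it begins $0_2 0_3 3_4 0_5 1_6 1_7 (-1)_0 2_1 0_2 2_3 2_4 0_5\cdots$ and ends $\cdots 0_0 0_1 0_2 3_3$). A word $w$ over $\Sigma_8$ is a pre-$5/4$-power if $\varphi(w)$ is a $5/4$-power; a word is pre-$5/4$-power-free if none of its factors is a pre-$5/4$-power. *)

theory Defs
  imports
    "HOL-Library.Stream"
    "HOL-Library.Sublist"
    "HOL-Library.Fun_Lexorder"
    "HOL-Library.Numeral_Type"
begin

text \<open>
  Finite words are lists and infinite words are streams.
\<close>

definition factor_of :: "'a list \<Rightarrow> 'a stream \<Rightarrow> bool" where
  "factor_of u s \<longleftrightarrow> (\<exists>p t. s = p @- (u @- t))"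

definition power54 :: "'a list \<Rightarrow> bool" where
  "power54 u \<longleftrightarrow> (\<exists>x y. u = x @ y @ x \<and> 1 \<le> length x \<and> length y = 3 * length x)"

definition power54_free :: "'a stream \<Rightarrow> bool" where
  "power54_free s \<longleftrightarrow> (\<forall>u. factor_of u s \<longrightarrow> \<not> power54 u)"

definition lex_least_power54_free :: "nat stream \<Rightarrow> bool" where
  "lex_least_power54_free w \<longleftrightarrow>
     power54_free w \<and>
     (\<forall>v. power54_free v \<longrightarrow> v = w \<or> less_fun (snth w) (snth v))"

definition w54 :: "nat stream" where
  "w54 = (THE w. lex_least_power54_free w)"

text \<open>
  The letter \<open>n\<^sub>j\<close> is the pair \<open>(n, j)\<close>. The numeral type \<open>8\<close> is the ring of integers
  modulo 8, so it has exactly the eight subscripts, and addition in it is addition modulo 8.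
\<close>

type_synonym letter = "int \<times> 8"

definition phi_letter :: "letter \<Rightarrow> letter list" where
  "phi_letter = (\<lambda>(n, j).
     if j = 0 then [(0,0), (1,1), (0,2), (0,3), (1,4), (n + 3, 5)]
     else if j = 1 then [(1,6), (1,7), (0,0), (0,1), (0,2), (n + 2, 3)]
     else if j = 2 then [(1,4), (1,5), (1,6), (0,7), (0,0), (n + 3, 1)]
     else if j = 3 then [(0,2), (1,3), (1,4), (0,5), (1,6), (n + 2, 7)]
     else if j = 4 then [(0,0), (1,1), (0,2), (0,3), (1,4), (n + 1, 5)]
     else if j = 5 then [(1,6), (1,7), (0,0), (0,1), (0,2), (n + 2, 3)]
     else if j = 6 then [(1,4), (1,5), (1,6), (0,7), (0,0), (n + 1, 1)]
     else [(0,2), (1,3), (1,4), (0,5), (1,6), (n + 2, 7)])"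

lemma phi_letter_simps:
  "phi_letter (n, 0) = [(0,0), (1,1), (0,2), (0,3), (1,4), (n + 3, 5)]"
  "phi_letter (n, 1) = [(1,6), (1,7), (0,0), (0,1), (0,2), (n + 2, 3)]"
  "phi_letter (n, 2) = [(1,4), (1,5), (1,6), (0,7), (0,0), (n + 3, 1)]"
  "phi_letter (n, 3) = [(0,2), (1,3), (1,4), (0,5), (1,6), (n + 2, 7)]"
  "phi_letter (n, 4) = [(0,0), (1,1), (0,2), (0,3), (1,4), (n + 1, 5)]"
  "phi_letter (n, 5) = [(1,6), (1,7), (0,0), (0,1), (0,2), (n + 2, 3)]"
  "phi_letter (n, 6) = [(1,4), (1,5), (1,6), (0,7), (0,0), (n + 1, 1)]"
  "phi_letter (n, 7) = [(0,2), (1,3), (1,4), (0,5), (1,6), (n + 2, 7)]"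
  by (simp_all add: phi_letter_def)

definition phi :: "letter list \<Rightarrow> letter list" where
  "phi u = concat (map phi_letter u)"

definition tau :: "letter \<Rightarrow> int" where
  "tau = fst"

definition subscript_increasing :: "letter list \<Rightarrow> bool" where
  "subscript_increasing u \<longleftrightarrow> successively (\<lambda>a b. snd b = snd a + 1) u"

definition is_z :: "letter list \<Rightarrow> bool" where
  "is_z z \<longleftrightarrow>
     length z = 20226 \<and>
     subscript_increasing z \<and>
     hd z = (0, 2) \<and>
     map tau (phi z) = map int (stake (6 * 20226) (sdrop 6764 w54))"

definition pre_power54 :: "letter list \<Rightarrow> bool" where
  "pre_power54 u \<longleftrightarrow> power54 (phi u)"

definition pre_power54_free :: "letter stream \<Rightarrow> bool" where
  "pre_power54_free s \<longleftrightarrow> (\<forall>u. factor_of u s \<longrightarrow> \<not> pre_power54 u)"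

text \<open>
  The infinite concatenation \<open>z \<phi>(z) \<phi>\<^sup>2(z) \<dots>\<close>. The library function \<open>flat\<close> concatenates a
  stream of words provided all of them are nonempty, so this definition is meaningful for \<open>z \<noteq> []\<close>.
\<close>

definition s_word :: "letter list \<Rightarrow> letter stream" where
  "s_word z = flat (siterate phi z)"

lemma phi_letter_length: "length (phi_letter a) = 6"
  by (cases a) (simp add: phi_letter_def)

lemma phi_length: "length (phi u) = 6 * length u"
  by (induction u) (simp_all add: phi_def phi_letter_length)

lemma phi_funpow_length: "length ((phi ^^ k) u) = 6 ^ k * length u"
  by (induction k) (simp_all add: phi_length)

lemma s_word_unfold:
  assumes "z \<noteq> []"
  shows "s_word z = z @- s_word (phi z)"
  using assms unfolding s_word_def by (subst flat_unfold) simp_all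

lemma s_word_prefix:
  assumes "z \<noteq> []"
  shows "s_word z = concat (map (\<lambda>k. (phi ^^ k) z) [0..<n]) @- s_word ((phi ^^ n) z)"
proof (induction n)
  case (Suc n)
  have "length ((phi ^^ n) z) > 0" using assms by (simp add: phi_funpow_length)
  then have "(phi ^^ n) z \<noteq> []" by blast
  from s_word_unfold[OF this] Suc show ?case by simp
qed simp

text \<open>
  Existence and uniqueness of the lexicographically least word: the greedy choice of letters
  never gets stuck, because a letter that has not occurred before completes no power.
\<close>

lemma lex_least_unique:
  assumes "lex_least_power54_free w" and "lex_least_power54_free v"
  shows "v = w"
  using assms less_fun_asym unfolding lex_least_power54_free_def by blast

definition ok54 :: "'a list \<Rightarrow> bool" where
  "ok54 u \<longleftrightarrow> (\<forall>v. sublist v u \<longrightarrow> \<not> power54 v)"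

lemma power54_free_iff: "power54_free s \<longleftrightarrow> (\<forall>n. ok54 (stake n s))"
proof
  assume L: "power54_free s"
  show "\<forall>n. ok54 (stake n s)"
    unfolding ok54_def
  proof (intro allI impI)
    fix n v assume "sublist v (stake n s)"
    then obtain p q where "stake n s = p @ v @ q" by (auto simp: sublist_def)
    then have "s = p @- (v @- (q @- sdrop n s))"
      using stake_sdrop[of n s] by simp
    then show "\<not> power54 v" using L unfolding power54_free_def factor_of_def by blast
  qed
next
  assume R: "\<forall>n. ok54 (stake n s)"
  show "power54_free s"
    unfolding power54_free_def
  proof (intro allI impI)
    fix u assume "factor_of u s"
    then obtain p t where "s = p @- (u @- t)" unfolding factor_of_def by blast
    then have "stake (length p + length u) s = p @ u @ []" by (simp add: stake_shift)
    then have "sublist u (stake (length p + length u) s)" unfolding sublist_def by blast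
    then show "\<not> power54 u" using R unfolding ok54_def by blast
  qed
qed

lemma ok54_fresh:
  assumes ok: "ok54 u" and k: "k \<notin> set u"
  shows "ok54 (u @ [k])"
  unfolding ok54_def
proof (intro allI impI notI)
  fix v assume sub: "sublist v (u @ [k])" and "power54 v"
  then obtain x y where v: "v = x @ y @ x" "1 \<le> length x" unfolding power54_def by blast
  from sub obtain p q where pq: "u @ [k] = p @ v @ q" by (auto simp: sublist_def)
  show False
  proof (cases q rule: rev_cases)
    case Nil
    obtain x' a where x: "x = x' @ [a]" using v(2) by (cases x rule: rev_cases) auto
    with pq v Nil have "u @ [k] = (p @ x' @ [a] @ y @ x') @ [a]" by simp
    then have "k = a" "u = p @ x' @ [a] @ y @ x'" by blast+
    with k show False by simp
  next
    case (snoc q' b)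
    with pq have "u @ [k] = (p @ v @ q') @ [b]" by simp
    then have "u = p @ v @ q'" by blast
    then have "sublist v u" by (auto simp: sublist_def)
    with ok \<open>power54 v\<close> show False by (auto simp: ok54_def)
  qed
qed

primrec greedy :: "nat \<Rightarrow> nat list" where
  "greedy 0 = []"
| "greedy (Suc n) = greedy n @ [LEAST k. ok54 (greedy n @ [k])]"

lemma ok54_greedy: "ok54 (greedy n)"
proof (induction n)
  case 0
  show ?case by (auto simp: ok54_def power54_def)
next
  case (Suc n)
  obtain k where "k \<notin> set (greedy n)" using ex_new_if_finite[of "set (greedy n)"] by auto
  then have "ok54 (greedy n @ [k])" by (rule ok54_fresh[OF Suc])
  then show ?case using LeastI[of "\<lambda>k. ok54 (greedy n @ [k])"] by simp
qed

lemma lex_least_exists: "\<exists>w. lex_least_power54_free w"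
proof -
  define w where "w = smap (\<lambda>n. LEAST k. ok54 (greedy n @ [k])) nats"
  have nth: "w !! n = (LEAST k. ok54 (greedy n @ [k]))" for n
    by (simp add: w_def)
  have stake_w: "stake n w = greedy n" for n
    by (induction n) (simp_all only: stake_Suc nth greedy.simps stake.simps)
  have free: "power54_free w"
    by (simp add: power54_free_iff stake_w ok54_greedy)
  have "less_fun (snth w) (snth v)" if v: "power54_free v" "v \<noteq> w" for v
  proof -
    have ex: "\<exists>n. v !! n \<noteq> w !! n"
      using smap_alt[of id v w] v(2) by (simp add: stream.map_id) 
    define n where "n = (LEAST n. v !! n \<noteq> w !! n)"
    have ne: "v !! n \<noteq> w !! n" unfolding n_def by (rule LeastI_ex[OF ex])
    have eq: "v !! i = w !! i" if "i < n" for i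
      using that not_less_Least unfolding n_def by blast
    have "stake n v = stake n w" by (rule nth_equalityI) (simp_all add: eq)
    then have "stake (Suc n) v = greedy n @ [v !! n]" by (simp only: stake_Suc stake_w)
    moreover have "ok54 (stake (Suc n) v)" using v(1) by (simp only: power54_free_iff)
    ultimately have "w !! n \<le> v !! n" unfolding nth by (simp add: Least_le)
    with ne eq show ?thesis unfolding less_fun_def by (metis le_neq_implies_less)
  qed
  with free show ?thesis unfolding lex_least_power54_free_def by blast
qed

lemma w54_lex_least: "lex_least_power54_free w54"
  unfolding w54_def using lex_least_exists lex_least_unique by (rule_tac theI') blast

lemma w54_unique: "lex_least_power54_free w \<longleftrightarrow> w = w54"
  using w54_lex_least lex_least_unique by blast

lemma subscript_increasing_nth:
  assumes "subscript_increasing u" and "u \<noteq> []" and "i < length u"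
  shows "snd (u ! i) = snd (hd u) + of_nat i"
  using assms(3)
proof (induction i)
  case 0
  show ?case using assms(2) by (simp add: hd_conv_nth)
next
  case (Suc i)
  then show ?case
    using assms(1) by (simp add: subscript_increasing_def successively_conv_nth algebra_simps)
qed

lemma tau_phi_letter_inj:
  assumes "map tau (phi_letter a) = map tau (phi_letter b)" and "snd a = snd b"
  shows "a = b"
  using assms by (cases a; cases b) (auto simp: phi_letter_def tau_def split: if_splits)

lemma tau_phi_inj:
  assumes "map tau (phi u) = map tau (phi v)" and "map snd u = map snd v"
  shows "u = v"
  using assms
proof (induction u arbitrary: v)
  case (Cons a u)
  then obtain b v' where v: "v = b # v'" by (cases v) auto
  with Cons.prems(1) have "map tau (phi_letter a) = map tau (phi_letter b)"
    and "map tau (phi u) = map tau (phi v')"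
    by (simp_all add: phi_def phi_letter_length)
  with Cons v tau_phi_letter_inj show ?case by auto
qed simp

lemma is_z_unique:
  assumes "is_z u" and "is_z v"
  shows "u = v"
proof (rule tau_phi_inj)
  show "map tau (phi u) = map tau (phi v)" using assms by (simp add: is_z_def)
  have "u \<noteq> []" "v \<noteq> []" using assms by (auto simp: is_z_def)
  then show "map snd u = map snd v"
    using assms by (intro nth_equalityI) (auto simp: is_z_def subscript_increasing_nth)
qed

end

theory Submission
  imports Defs
begin

text \<open>
  Write \<open>h(k)\<close> for the last entry of \<open>\<tau>(\<phi>(a))\<close>, where \<open>a\<close> is the letter of \<open>s\<close> at position \<open>k\<close>. Two
  letters whose subscripts agree modulo \<open>4\<close> have the same image iff these entries agree, so it suffices
  that \<open>h\<close> contains no \<open>5/4\<close>-power. Beyond its first \<open>20226\<close> letters, \<open>h\<close> consists of blocks of length \<open>6\<close>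
  whose first five letters only depend on the position modulo \<open>24\<close> and whose last letter is \<open>h(q) + 2\<close> in
  block \<open>q\<close>. The constant columns force \<open>6\<close> to divide the length of a repeated word in this tail, and the
  last column then contains a power with a repeated word six times shorter. So only powers that
  start before the tail remain, and for each length these are excluded by a chain of mismatches whose
  gaps do not exceed that length.

  To know the beginning of \<open>h\<close> one has to identify the first \<open>128120\<close> letters of the lexicographically
  least word. They are certified to be power-free in the same way, as this word too is a finite
  word followed by blocks that end in the letters of \<open>h\<close>. Their minimality is certified by exhibiting,
  for every smaller letter, a power that it would complete. Short periods suffice for this.
\<close>

section \<open>The initial letters\<close>

text \<open>The shape of the proof is dictated by the even indices. Where the letters at even
  indices repeat with period 8 and change under a shift by 4, an odd period above 1 is impossible
  and an even period is decided by the odd indices alone. In \<open>h\<close> this holds only from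
  index 98 on, which forces a separate treatment of the starts below it.

  The infinite word \<open>wword\<close> serves as a competitor: being power-free, it bounds the
  least word from above, so only its initial letters have to be shown minimal, and nothing is
  claimed about the least word beyond them. In the part governed by \<open>z\<close>, the equation
  in \<open>is_z\<close> already fixes five letters of every block, and only the last one has to be
  shown minimal.

  The offsets 10 and 12 align the blocks: \<open>6764 + 10 = 6 * 1129\<close> and
  \<open>20226 + 12 = 6 * 3373\<close>. Index 12 is the first genuine letter of \<open>h\<close>,
  whence the shifts \<open>1117 = 1129 - 12\<close> and \<open>3361 = 3373 - 12\<close>. With these
  offsets the subscript belonging to index \<open>x\<close> is \<open>x + 6\<close> modulo 8 in both
  words.\<close>

text \<open>
  Both words are cut into blocks of length \<open>6\<close>. In the least word the letter \<open>n\<close> gets the index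
  \<open>x = n + 10\<close>, in \<open>h\<close> the letter \<open>k\<close> gets the index \<open>x = k + 12\<close>, and \<open>x = 6 q + r\<close> lies in column \<open>r\<close> of
  block \<open>q\<close>. The index \<open>11\<close> of \<open>h\<close> holds a virtual letter, which makes the last block before the tail
  fit the pattern of the tail. The letters in even columns follow simple rules, those in column \<open>r\<close> of
  block \<open>q\<close> are tabulated in the functions \<open>w1, w3, w5\<close> and \<open>g1, g3, g5\<close>. The symbol \<open>U\<close> stands for an unspecified letter.
  Tables are split into many constants since the cost of a rewrite step grows with the size of the term.
\<close>

datatype symb = V0 | V1 | V2 | V3 | V4 | V5 | V6 | V7 | V8 | U

datatype trie = F symb | N symb trie trie

fun lookup :: "trie \<Rightarrow> num \<Rightarrow> symb" where
  "lookup (N a l r) num.One = a"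
| "lookup (N a l r) (num.Bit0 n) = lookup l n"
| "lookup (N a l r) (num.Bit1 n) = lookup r n"
| "lookup (F a) num.One = a"
| "lookup (F a) n = U"

text \<open>\<open>f\<close>, \<open>g\<close>, \<open>h\<close>, \<open>k\<close> serve the keys
  congruent to 0, 1, 2, 3 modulo 4 and receive the quotient; \<open>a\<close>, \<open>b\<close>,
  \<open>c\<close> are the values at the keys 1, 2, 3, whose quotient 0 is not a
  \<open>num\<close>.\<close>

fun branch :: "(num \<Rightarrow> symb) \<Rightarrow> (num \<Rightarrow> symb) \<Rightarrow> (num \<Rightarrow> symb) \<Rightarrow> (num \<Rightarrow> symb) \<Rightarrow>
    symb \<Rightarrow> symb \<Rightarrow> symb \<Rightarrow> num \<Rightarrow> symb" where
  "branch f g h k a b c (num.Bit0 (num.Bit0 n)) = f n"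
| "branch f g h k a b c (num.Bit1 (num.Bit0 n)) = g n"
| "branch f g h k a b c (num.Bit0 (num.Bit1 n)) = h n"
| "branch f g h k a b c (num.Bit1 (num.Bit1 n)) = k n"
| "branch f g h k a b c num.One = a"
| "branch f g h k a b c (num.Bit0 num.One) = b"
| "branch f g h k a b c (num.Bit1 num.One) = c"

definition "row3 a1 a2 a3 = N a1 (F a2) (F a3)"
definition "row31 a1 a2 a3 a4 a5 a6 a7 a8 a9 a10 a11 a12 a13 a14 a15 a16 a17 a18 a19 a20 a21 a22 a23 a24 a25
   a26 a27 a28 a29 a30 a31 = N a1 (N a2 (N a4 (N a8 (F a16) (F a24)) (N a12 (F a20) (F a28))) (N a6 (N a10
   (F a18) (F a26)) (N a14 (F a22) (F a30)))) (N a3 (N a5 (N a9 (F a17) (F a25)) (N a13 (F a21) (F a29))) (N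
   a7 (N a11 (F a19) (F a27)) (N a15 (F a23) (F a31))))"
definition "row63 a1 a2 a3 a4 a5 a6 a7 a8 a9 a10 a11 a12 a13 a14 a15 a16 a17 a18 a19 a20 a21 a22 a23 a24 a25
   a26 a27 a28 a29 a30 a31 a32 a33 a34 a35 a36 a37 a38 a39 a40 a41 a42 a43 a44 a45 a46 a47 a48 a49 a50 a51
   a52 a53 a54 a55 a56 a57 a58 a59 a60 a61 a62 a63 = N a1 (N a2 (N a4 (N a8 (N a16 (F a32) (F a48)) (N a24
   (F a40) (F a56))) (N a12 (N a20 (F a36) (F a52)) (N a28 (F a44) (F a60)))) (N a6 (N a10 (N a18 (F a34) (F
   a50)) (N a26 (F a42) (F a58))) (N a14 (N a22 (F a38) (F a54)) (N a30 (F a46) (F a62))))) (N a3 (N a5 (N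
   a9 (N a17 (F a33) (F a49)) (N a25 (F a41) (F a57))) (N a13 (N a21 (F a37) (F a53)) (N a29 (F a45) (F
   a61)))) (N a7 (N a11 (N a19 (F a35) (F a51)) (N a27 (F a43) (F a59))) (N a15 (N a23 (F a39) (F a55)) (N
   a31 (F a47) (F a63)))))"

text \<open>The digits after the underscore are base 4 digits of the block number, lowest first, and
  the k-th entry of a row belongs to the remaining quotient k. Rows are filled up to full length
  with the constant of the tail or with \<open>U\<close>.\<close>

definition "w1_000 n = lookup (row31 V2 V1 V2 V2 V1 V1 V1 V1 V1 V2 V1 V3 V1 V1 V2 V1 V1 V1 V1 V1 V1 V1 V1 V1
   V1 V1 V1 V1 V1 V1 V1) n"
definition "w1_001 n = lookup (row31 V1 V1 V3 V2 V2 V1 V1 V2 V1 V1 V1 V2 V1 V1 V1 V1 V1 V1 V1 V1 V1 V1 V1 V1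
   V1 V1 V1 V1 V1 V1 V1) n"
definition "w1_002 n = lookup (row31 V3 V1 V3 V3 V1 V1 V1 V2 V1 V1 V1 V3 V1 V1 V1 V1 V1 V1 V1 V1 V1 V1 V1 V1
   V1 V1 V1 V1 V1 V1 V1) n"
definition "w1_003 n = lookup (row31 V2 V3 V3 V3 V1 V1 V1 V2 V1 V1 V1 V1 V1 V2 V1 V1 V1 V1 V1 V1 V1 V1 V1 V1
   V1 V1 V1 V1 V1 V1 V1) n"
definition "w1_00 n = branch w1_000 w1_001 w1_002 w1_003 V3 V1 V1 n"
definition "w1_010 n = lookup (row31 V3 V1 V3 V3 V1 V1 V2 V1 V1 V1 V1 V1 V1 V1 V1 V1 V1 V1 V1 V1 V1 V1 V1 V1
   V1 V1 V1 V1 V1 V1 V1) n"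
definition "w1_011 n = lookup (row31 V2 V1 V4 V1 V1 V1 V1 V1 V2 V1 V1 V3 V2 V2 V1 V2 V1 V1 V1 V1 V1 V1 V1 V1
   V1 V1 V1 V1 V1 V1 V1) n"
definition "w1_012 n = lookup (row31 V3 V2 V2 V1 V1 V1 V1 V1 V1 V1 V1 V3 V2 V2 V1 V1 V2 V1 V1 V1 V1 V1 V1 V1
   V1 V1 V1 V1 V1 V1 V1) n"
definition "w1_013 n = lookup (row31 V3 V2 V2 V2 V1 V1 V1 V1 V1 V1 V1 V1 V1 V1 V1 V1 V1 V1 V1 V1 V1 V1 V1 V1
   V1 V1 V1 V1 V1 V1 V1) n"
definition "w1_01 n = branch w1_010 w1_011 w1_012 w1_013 V2 V3 V3 n"
definition "w1_020 n = lookup (row31 V2 V2 V4 V2 V1 V2 V1 V1 V1 V1 V2 V3 V1 V1 V1 V1 V1 V1 V1 V1 V1 V1 V1 V1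
   V1 V1 V1 V1 V1 V1 V1) n"
definition "w1_021 n = lookup (row31 V3 V2 V2 V3 V1 V2 V1 V1 V2 V1 V2 V2 V2 V2 V2 V2 V1 V1 V1 V1 V1 V1 V1 V1
   V1 V1 V1 V1 V1 V1 V1) n"
definition "w1_022 n = lookup (row31 V2 V3 V3 V3 V1 V1 V1 V1 V1 V2 V1 V1 V2 V1 V1 V1 V2 V1 V1 V1 V1 V1 V1 V1
   V1 V1 V1 V1 V1 V1 V1) n"
definition "w1_023 n = lookup (row31 V2 V1 V1 V2 V2 V2 V1 V3 V1 V1 V1 V1 V2 V1 V1 V2 V1 V1 V1 V1 V1 V1 V1 V1
   V1 V1 V1 V1 V1 V1 V1) n"
definition "w1_02 n = branch w1_020 w1_021 w1_022 w1_023 V3 V2 V2 n"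
definition "w1_030 n = lookup (row31 V3 V2 V2 V3 V1 V2 V1 V1 V1 V1 V2 V4 V1 V1 V1 V1 V1 V1 V1 V1 V1 V1 V1 V1
   V1 V1 V1 V1 V1 V1 V1) n"
definition "w1_031 n = lookup (row31 V1 V1 V1 V2 V1 V2 V1 V2 V1 V2 V2 V2 V1 V1 V2 V1 V1 V1 V1 V1 V1 V1 V1 V1
   V1 V1 V1 V1 V1 V1 V1) n"
definition "w1_032 n = lookup (row31 V3 V1 V2 V2 V2 V1 V1 V2 V1 V2 V1 V1 V1 V2 V1 V1 V1 V1 V1 V1 V1 V1 V1 V1
   V1 V1 V1 V1 V1 V1 V1) n"
definition "w1_033 n = lookup (row31 V3 V4 V3 V3 V2 V1 V1 V2 V3 V1 V2 V1 V2 V2 V1 V2 V1 V1 V1 V1 V1 V1 V1 V1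
   V1 V1 V1 V1 V1 V1 V1) n"
definition "w1_03 n = branch w1_030 w1_031 w1_032 w1_033 V2 V3 V3 n"
definition "w1_0 n = branch w1_00 w1_01 w1_02 w1_03 V0 V3 V2 n"
definition "w1_100 n = lookup (row31 V3 V1 V2 V3 V2 V3 V1 V1 V1 V3 V2 V3 V1 V2 V2 V1 V1 V1 V1 V1 V1 V1 V1 V1
   V1 V1 V1 V1 V1 V1 V1) n"
definition "w1_101 n = lookup (row31 V2 V1 V2 V3 V2 V1 V1 V1 V1 V2 V1 V3 V2 V2 V2 V2 V1 V1 V1 V1 V1 V1 V1 V1
   V1 V1 V1 V1 V1 V1 V1) n"
definition "w1_102 n = lookup (row31 V2 V2 V1 V3 V1 V2 V1 V1 V1 V1 V2 V1 V1 V1 V2 V1 V2 V1 V1 V1 V1 V1 V1 V1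
   V1 V1 V1 V1 V1 V1 V1) n"
definition "w1_103 n = lookup (row31 V3 V1 V3 V2 V1 V2 V1 V1 V1 V2 V2 V1 V1 V1 V1 V1 V1 V1 V1 V1 V1 V1 V1 V1
   V1 V1 V1 V1 V1 V1 V1) n"
definition "w1_10 n = branch w1_100 w1_101 w1_102 w1_103 V2 V2 V2 n"
definition "w1_110 n = lookup (row31 V1 V1 V3 V2 V1 V2 V1 V1 V1 V2 V2 V2 V1 V1 V1 V1 V1 V1 V1 V1 V1 V1 V1 V1
   V1 V1 V1 V1 V1 V1 V1) n"
definition "w1_111 n = lookup (row31 V3 V1 V3 V2 V3 V1 V2 V1 V1 V2 V1 V2 V1 V1 V1 V1 V1 V1 V1 V1 V1 V1 V1 V1
   V1 V1 V1 V1 V1 V1 V1) n"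
definition "w1_112 n = lookup (row31 V1 V3 V2 V2 V2 V1 V2 V3 V2 V1 V1 V1 V1 V2 V1 V1 V1 V1 V1 V1 V1 V1 V1 V1
   V1 V1 V1 V1 V1 V1 V1) n"
definition "w1_113 n = lookup (row31 V1 V1 V3 V3 V1 V1 V1 V1 V2 V2 V4 V1 V1 V1 V1 V1 V1 V1 V1 V1 V1 V1 V1 V1
   V1 V1 V1 V1 V1 V1 V1) n"
definition "w1_11 n = branch w1_110 w1_111 w1_112 w1_113 V3 V3 V3 n"
definition "w1_120 n = lookup (row31 V3 V1 V2 V3 V1 V1 V2 V3 V2 V1 V1 V3 V1 V1 V1 V1 V1 V1 V1 V1 V1 V1 V1 V1
   V1 V1 V1 V1 V1 V1 V1) n"
definition "w1_121 n = lookup (row31 V2 V1 V2 V3 V2 V1 V2 V1 V2 V1 V1 V1 V1 V1 V1 V1 V1 V1 V1 V1 V1 V1 V1 V1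
   V1 V1 V1 V1 V1 V1 V1) n"
definition "w1_122 n = lookup (row31 V3 V2 V3 V3 V3 V1 V2 V2 V2 V1 V1 V2 V1 V1 V1 V1 V1 V1 V1 V1 V1 V1 V1 V1
   V1 V1 V1 V1 V1 V1 V1) n"
definition "w1_123 n = lookup (row31 V3 V2 V2 V1 V1 V1 V1 V1 V2 V1 V3 V1 V1 V1 V1 V1 V1 V1 V1 V1 V1 V1 V1 V1
   V1 V1 V1 V1 V1 V1 V1) n"
definition "w1_12 n = branch w1_120 w1_121 w1_122 w1_123 V1 V2 V1 n"
definition "w1_130 n = lookup (row31 V3 V1 V3 V1 V2 V1 V1 V2 V2 V1 V1 V2 V3 V2 V2 V3 V1 V1 V1 V1 V1 V1 V1 V1
   V1 V1 V1 V1 V1 V1 V1) n"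
definition "w1_131 n = lookup (row31 V3 V3 V3 V2 V1 V1 V1 V1 V1 V1 V1 V1 V1 V1 V2 V1 V3 V1 V1 V1 V1 V1 V1 V1
   V1 V1 V1 V1 V1 V1 V1) n"
definition "w1_132 n = lookup (row31 V2 V3 V1 V1 V1 V2 V1 V1 V1 V1 V2 V2 V2 V1 V2 V1 V1 V1 V1 V1 V1 V1 V1 V1
   V1 V1 V1 V1 V1 V1 V1) n"
definition "w1_133 n = lookup (row31 V1 V3 V1 V3 V1 V1 V1 V2 V1 V1 V2 V1 V2 V1 V1 V2 V1 V1 V1 V1 V1 V1 V1 V1
   V1 V1 V1 V1 V1 V1 V1) n"
definition "w1_13 n = branch w1_130 w1_131 w1_132 w1_133 V3 V3 V2 n"
definition "w1_1 n = branch w1_10 w1_11 w1_12 w1_13 V2 V1 V3 n"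
definition "w1_200 n = lookup (row31 V2 V1 V3 V3 V1 V1 V1 V1 V1 V2 V1 V3 V1 V1 V1 V1 V1 V1 V1 V1 V1 V1 V1 V1
   V1 V1 V1 V1 V1 V1 V1) n"
definition "w1_201 n = lookup (row31 V3 V1 V4 V3 V2 V1 V1 V2 V3 V1 V1 V3 V3 V1 V1 V3 V1 V1 V1 V1 V1 V1 V1 V1
   V1 V1 V1 V1 V1 V1 V1) n"
definition "w1_202 n = lookup (row31 V3 V3 V2 V1 V1 V1 V1 V2 V1 V1 V1 V3 V2 V2 V1 V1 V3 V1 V1 V1 V1 V1 V1 V1
   V1 V1 V1 V1 V1 V1 V1) n"
definition "w1_203 n = lookup (row31 V3 V2 V2 V3 V1 V1 V1 V1 V1 V1 V1 V1 V1 V1 V1 V1 V1 V1 V1 V1 V1 V1 V1 V1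
   V1 V1 V1 V1 V1 V1 V1) n"
definition "w1_20 n = branch w1_200 w1_201 w1_202 w1_203 V2 V1 V3 n"
definition "w1_210 n = lookup (row31 V3 V1 V4 V2 V1 V3 V2 V1 V1 V1 V1 V1 V1 V1 V1 V1 V1 V1 V1 V1 V1 V1 V1 V1
   V1 V1 V1 V1 V1 V1 V1) n"
definition "w1_211 n = lookup (row31 V2 V1 V2 V1 V1 V2 V1 V1 V2 V1 V2 V4 V2 V2 V3 V2 V1 V1 V1 V1 V1 V1 V1 V1
   V1 V1 V1 V1 V1 V1 V1) n"
definition "w1_212 n = lookup (row31 V2 V2 V3 V3 V1 V1 V1 V1 V1 V1 V1 V1 V2 V2 V1 V1 V2 V1 V1 V1 V1 V1 V1 V1
   V1 V1 V1 V1 V1 V1 V1) n"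
definition "w1_213 n = lookup (row31 V2 V1 V1 V2 V1 V2 V1 V3 V1 V1 V1 V1 V3 V1 V1 V3 V1 V1 V1 V1 V1 V1 V1 V1
   V1 V1 V1 V1 V1 V1 V1) n"
definition "w1_21 n = branch w1_210 w1_211 w1_212 w1_213 V3 V2 V3 n"
definition "w1_220 n = lookup (row31 V2 V2 V2 V3 V1 V2 V1 V1 V1 V1 V2 V3 V1 V1 V1 V1 V1 V1 V1 V1 V1 V1 V1 V1
   V1 V1 V1 V1 V1 V1 V1) n"
definition "w1_221 n = lookup (row31 V3 V1 V1 V2 V2 V2 V1 V1 V1 V2 V2 V2 V1 V1 V2 V1 V1 V1 V1 V1 V1 V1 V1 V1
   V1 V1 V1 V1 V1 V1 V1) n"
definition "w1_222 n = lookup (row31 V3 V3 V2 V3 V2 V1 V1 V3 V1 V2 V1 V1 V1 V3 V1 V1 V1 V1 V1 V1 V1 V1 V1 V1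
   V1 V1 V1 V1 V1 V1 V1) n"
definition "w1_223 n = lookup (row31 V3 V1 V1 V2 V2 V2 V1 V2 V1 V1 V3 V1 V2 V2 V1 V2 V1 V1 V1 V1 V1 V1 V1 V1
   V1 V1 V1 V1 V1 V1 V1) n"
definition "w1_22 n = branch w1_220 w1_221 w1_222 w1_223 V2 V3 V2 n"
definition "w1_230 n = lookup (row31 V1 V2 V3 V2 V2 V1 V1 V2 V1 V1 V1 V2 V1 V1 V1 V1 V1 V1 V1 V1 V1 V1 V1 V1
   V1 V1 V1 V1 V1 V1 V1) n"
definition "w1_231 n = lookup (row31 V1 V1 V1 V3 V1 V1 V1 V2 V1 V2 V1 V1 V1 V1 V1 V1 V1 V1 V1 V1 V1 V1 V1 V1
   V1 V1 V1 V1 V1 V1 V1) n"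
definition "w1_232 n = lookup (row31 V2 V1 V3 V2 V2 V1 V1 V2 V1 V2 V1 V1 V1 V2 V1 V1 V1 V1 V1 V1 V1 V1 V1 V1
   V1 V1 V1 V1 V1 V1 V1) n"
definition "w1_233 n = lookup (row31 V2 V2 V2 V2 V2 V1 V1 V2 V2 V1 V2 V1 V1 V3 V1 V1 V1 V1 V1 V1 V1 V1 V1 V1
   V1 V1 V1 V1 V1 V1 V1) n"
definition "w1_23 n = branch w1_230 w1_231 w1_232 w1_233 V3 V1 V3 n"
definition "w1_2 n = branch w1_20 w1_21 w1_22 w1_23 V0 V2 V3 n"
definition "w1_300 n = lookup (row31 V3 V1 V2 V2 V2 V2 V1 V1 V1 V2 V2 V2 V1 V1 V2 V1 V1 V1 V1 V1 V1 V1 V1 V1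
   V1 V1 V1 V1 V1 V1 V1) n"
definition "w1_301 n = lookup (row31 V3 V1 V2 V3 V1 V1 V1 V1 V1 V2 V1 V2 V2 V1 V2 V2 V1 V1 V1 V1 V1 V1 V1 V1
   V1 V1 V1 V1 V1 V1 V1) n"
definition "w1_302 n = lookup (row31 V3 V3 V3 V3 V1 V2 V1 V1 V1 V1 V2 V1 V1 V2 V1 V1 V2 V1 V1 V1 V1 V1 V1 V1
   V1 V1 V1 V1 V1 V1 V1) n"
definition "w1_303 n = lookup (row31 V1 V1 V3 V2 V1 V2 V1 V1 V2 V2 V2 V1 V1 V1 V1 V1 V1 V1 V1 V1 V1 V1 V1 V1
   V1 V1 V1 V1 V1 V1 V1) n"
definition "w1_30 n = branch w1_300 w1_301 w1_302 w1_303 V3 V2 V2 n"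
definition "w1_310 n = lookup (row31 V1 V1 V3 V3 V1 V2 V2 V1 V1 V2 V1 V3 V1 V1 V1 V1 V1 V1 V1 V1 V1 V1 V1 V1
   V1 V1 V1 V1 V1 V1 V1) n"
definition "w1_311 n = lookup (row31 V2 V1 V3 V2 V2 V1 V2 V1 V2 V2 V1 V2 V1 V1 V1 V1 V1 V1 V1 V1 V1 V1 V1 V1
   V1 V1 V1 V1 V1 V1 V1) n"
definition "w1_312 n = lookup (row31 V1 V2 V2 V2 V2 V1 V2 V2 V2 V1 V1 V1 V1 V2 V1 V1 V1 V1 V1 V1 V1 V1 V1 V1
   V1 V1 V1 V1 V1 V1 V1) n"
definition "w1_313 n = lookup (row31 V3 V3 V2 V3 V1 V1 V1 V1 V2 V1 V3 V1 V1 V1 V1 V1 V1 V1 V1 V1 V1 V1 V1 V1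
   V1 V1 V1 V1 V1 V1 V1) n"
definition "w1_31 n = branch w1_310 w1_311 w1_312 w1_313 V1 V3 V1 n"
definition "w1_320 n = lookup (row31 V3 V1 V2 V1 V1 V1 V2 V2 V2 V1 V1 V2 V1 V2 V1 V1 V1 V1 V1 V1 V1 V1 V1 V1
   V1 V1 V1 V1 V1 V1 V1) n"
definition "w1_321 n = lookup (row31 V3 V1 V2 V3 V2 V1 V2 V1 V2 V1 V1 V1 V1 V1 V3 V1 V1 V1 V1 V1 V1 V1 V1 V1
   V1 V1 V1 V1 V1 V1 V1) n"
definition "w1_322 n = lookup (row31 V2 V3 V3 V1 V2 V1 V2 V2 V1 V1 V1 V2 V2 V1 V2 V1 V1 V1 V1 V1 V1 V1 V1 V1
   V1 V1 V1 V1 V1 V1 V1) n"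
definition "w1_323 n = lookup (row31 V1 V2 V1 V1 V1 V1 V1 V2 V1 V1 V2 V1 V3 V1 V1 V2 V1 V1 V1 V1 V1 V1 V1 V1
   V1 V1 V1 V1 V1 V1 V1) n"
definition "w1_32 n = branch w1_320 w1_321 w1_322 w1_323 V3 V2 V3 n"
definition "w1_330 n = lookup (row31 V2 V1 V3 V3 V2 V1 V1 V2 V2 V1 V1 V3 V2 V2 V2 V2 V1 V1 V1 V1 V1 V1 V1 V1
   V1 V1 V1 V1 V1 V1 V1) n"
definition "w1_331 n = lookup (row31 V2 V2 V1 V2 V1 V2 V1 V1 V1 V1 V2 V1 V1 V1 V2 V1 V2 V1 V1 V1 V1 V1 V1 V1
   V1 V1 V1 V1 V1 V1 V1) n"
definition "w1_332 n = lookup (row31 V3 V2 V1 V3 V1 V2 V1 V1 V1 V1 V2 V2 V2 V2 V2 V1 V1 V1 V1 V1 V1 V1 V1 V1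
   V1 V1 V1 V1 V1 V1 V1) n"
definition "w1_333 n = lookup (row31 V1 V3 V1 V2 V1 V1 V1 V2 V1 V2 V3 V1 V2 V2 V1 V2 V1 V1 V1 V1 V1 V1 V1 V1
   V1 V1 V1 V1 V1 V1 V1) n"
definition "w1_33 n = branch w1_330 w1_331 w1_332 w1_333 V3 V3 V2 n"
definition "w1_3 n = branch w1_30 w1_31 w1_32 w1_33 V1 V1 V2 n"
definition "w1 n = branch w1_0 w1_1 w1_2 w1_3 U V0 V2 n"
definition "w3_00 n = lookup (row31 V1 V1 V1 V1 V1 V1 V1 V2 V2 V1 V3 V1 V1 V2 V2 V2 V2 V1 V1 V0 V0 V0 V0 V0
   V0 V0 V0 V0 V0 V0 V0) n"
definition "w3_01 n = lookup (row31 V1 V1 V1 V2 V1 V2 V2 V3 V3 V1 V2 V1 V1 V1 V1 V1 V1 V1 V1 V0 V0 V0 V0 V0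
   V0 V0 V0 V0 V0 V0 V0) n"
definition "w3_02 n = lookup (row31 V2 V1 V2 V2 V1 V2 V2 V2 V2 V1 V1 V1 V1 V1 V1 V1 V1 V1 V0 V0 V0 V0 V0 V0
   V0 V0 V0 V0 V0 V0 V0) n"
definition "w3_03 n = lookup (row31 V2 V1 V1 V1 V1 V1 V3 V3 V2 V1 V1 V1 V1 V2 V2 V2 V1 V2 V0 V0 V0 V0 V0 V0
   V0 V0 V0 V0 V0 V0 V0) n"
definition "w3_0 n = branch w3_00 w3_01 w3_02 w3_03 V1 V2 V2 n"
definition "w3_10 n = lookup (row31 V1 V2 V2 V1 V2 V2 V1 V2 V4 V2 V1 V1 V1 V1 V1 V1 V1 V2 V1 V0 V0 V0 V0 V0
   V0 V0 V0 V0 V0 V0 V0) n"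
definition "w3_11 n = lookup (row31 V1 V1 V1 V1 V1 V1 V1 V3 V2 V1 V3 V1 V1 V1 V3 V1 V2 V2 V1 V0 V0 V0 V0 V0
   V0 V0 V0 V0 V0 V0 V0) n"
definition "w3_12 n = lookup (row31 V1 V1 V1 V1 V1 V1 V1 V1 V3 V1 V2 V1 V3 V1 V2 V1 V1 V1 V1 V0 V0 V0 V0 V0
   V0 V0 V0 V0 V0 V0 V0) n"
definition "w3_13 n = lookup (row31 V1 V2 V1 V2 V2 V1 V1 V3 V2 V2 V1 V1 V2 V1 V1 V1 V1 V1 V1 V0 V0 V0 V0 V0
   V0 V0 V0 V0 V0 V0 V0) n"
definition "w3_1 n = branch w3_10 w3_11 w3_12 w3_13 V2 V1 V1 n"
definition "w3_20 n = lookup (row31 V1 V1 V1 V1 V1 V1 V2 V2 V2 V1 V2 V1 V1 V2 V2 V1 V1 V1 V1 V0 V0 V0 V0 V0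
   V0 V0 V0 V0 V0 V0 V0) n"
definition "w3_21 n = lookup (row31 V2 V1 V2 V2 V1 V2 V2 V3 V3 V1 V2 V1 V1 V1 V1 V1 V1 V1 V1 V0 V0 V0 V0 V0
   V0 V0 V0 V0 V0 V0 V0) n"
definition "w3_22 n = lookup (row31 V2 V1 V2 V2 V1 V1 V4 V2 V2 V1 V1 V1 V1 V1 V3 V2 V1 V2 V0 V0 V0 V0 V0 V0
   V0 V0 V0 V0 V0 V0 V0) n"
definition "w3_23 n = lookup (row31 V1 V1 V1 V1 V1 V1 V3 V3 V1 V1 V1 V1 V2 V2 V2 V2 V1 V2 V0 V0 V0 V0 V0 V0
   V0 V0 V0 V0 V0 V0 V0) n"
definition "w3_2 n = branch w3_20 w3_21 w3_22 w3_23 V3 V2 V1 n"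
definition "w3_30 n = lookup (row31 V1 V2 V2 V1 V1 V1 V1 V2 V2 V1 V1 V1 V1 V1 V1 V1 V2 V2 V1 V0 V0 V0 V0 V0
   V0 V0 V0 V0 V0 V0 V0) n"
definition "w3_31 n = lookup (row31 V1 V1 V1 V1 V1 V1 V1 V3 V3 V1 V2 V1 V1 V1 V2 V1 V2 V2 V1 V0 V0 V0 V0 V0
   V0 V0 V0 V0 V0 V0 V0) n"
definition "w3_32 n = lookup (row31 V1 V1 V1 V1 V2 V1 V1 V1 V4 V2 V2 V1 V2 V1 V2 V1 V1 V1 V1 V0 V0 V0 V0 V0
   V0 V0 V0 V0 V0 V0 V0) n"
definition "w3_33 n = lookup (row31 V2 V2 V1 V2 V2 V1 V3 V3 V2 V2 V1 V1 V2 V1 V1 V1 V1 V1 V0 V0 V0 V0 V0 V0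
   V0 V0 V0 V0 V0 V0 V0) n"
definition "w3_3 n = branch w3_30 w3_31 w3_32 w3_33 V2 V1 V1 n"
definition "w3 n = branch w3_0 w3_1 w3_2 w3_3 U V1 V2 n"
definition "w5_000 n = lookup (row31 V0 V0 V0 V0 V2 V3 V3 V3 V2 V1 V3 V1 V3 V2 V3 V2 V2 V2 V2 V3 V5 V2 V3 V4
   V2 V4 U U U U U) n"
definition "w5_001 n = lookup (row31 V0 V0 V0 V0 V1 V2 V2 V1 V2 V3 V2 V1 V2 V2 V3 V2 V2 V3 V4 V5 V2 V3 V4 V2
   V3 V5 U U U U U) n"
definition "w5_002 n = lookup (row31 V0 V0 V0 V0 V3 V2 V3 V3 V3 V2 V2 V1 V3 V3 V2 V4 V2 V2 V5 V2 V5 V4 V2 V4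
   V5 U U U U U U) n"
definition "w5_003 n = lookup (row31 V0 V0 V0 V0 V2 V2 V2 V3 V3 V3 V2 V2 V3 V3 V2 V3 V4 V2 V2 V3 V3 V2 V3 V5
   V2 U U U U U U) n"
definition "w5_00 n = branch w5_000 w5_001 w5_002 w5_003 V0 V0 V0 n"
definition "w5_010 n = lookup (row31 V0 V0 V0 V0 V3 V2 V1 V4 V3 V2 V2 V2 V4 V3 V2 V3 V3 V3 V4 V5 V2 V4 V4 V2
   V3 V5 U U U U U) n"
definition "w5_011 n = lookup (row31 V0 V0 V0 V0 V2 V3 V3 V2 V1 V2 V3 V1 V1 V1 V2 V1 V3 V2 V3 V2 V3 V4 V2 V4
   V5 V2 U U U U U) n"
definition "w5_012 n = lookup (row31 V0 V0 V0 V0 V2 V3 V2 V3 V2 V3 V3 V2 V1 V1 V3 V3 V1 V4 V2 V3 V3 V2 V3 V3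
   V2 U U U U U U) n"
definition "w5_013 n = lookup (row31 V0 V0 V0 V0 V3 V3 V3 V2 V2 V2 V3 V3 V2 V2 V3 V2 V2 V3 V3 V5 V2 V3 V4 V2
   V4 U U U U U U) n"
definition "w5_01 n = branch w5_010 w5_011 w5_012 w5_013 V0 V0 V0 n"
definition "w5_020 n = lookup (row31 V0 V0 V0 V0 V2 V1 V2 V2 V2 V3 V1 V2 V2 V2 V3 V2 V2 V2 V3 V2 V3 V5 V2 V3
   V4 V2 U U U U U) n"
definition "w5_021 n = lookup (row31 V0 V0 V0 V0 V3 V1 V4 V3 V3 V3 V1 V1 V3 V3 V1 V3 V2 V4 V2 V3 V4 V2 V3 V3
   V2 U U U U U U) n"
definition "w5_022 n = lookup (row31 V0 V0 V0 V0 V3 V2 V3 V2 V3 V1 V2 V2 V3 V2 V2 V2 V3 V2 V3 V4 V2 V3 V5 V2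
   V4 U U U U U U) n"
definition "w5_023 n = lookup (row31 V0 V0 V0 V0 V1 V1 V4 V1 V3 V3 V2 V4 V1 V3 V2 V1 V3 V2 V4 V2 V4 V5 V2 V3
   V3 U U U U U U) n"
definition "w5_02 n = branch w5_020 w5_021 w5_022 w5_023 V0 V0 V0 n"
definition "w5_030 n = lookup (row31 V0 V0 V0 V0 V3 V3 V3 V3 V3 V2 V3 V1 V3 V3 V2 V3 V3 V4 V2 V3 V4 V2 V3 V5
   V2 V4 U U U U U) n"
definition "w5_031 n = lookup (row31 V0 V0 V0 V0 V2 V3 V2 V1 V2 V1 V3 V3 V2 V2 V3 V2 V3 V3 V4 V4 V2 V3 V5 V2
   V3 U U U U U U) n"
definition "w5_032 n = lookup (row31 V0 V0 V0 V0 V1 V3 V4 V1 V2 V3 V3 V3 V2 V1 V3 V4 V2 V3 V4 V2 V4 V5 V2 V4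
   V3 U U U U U U) n"
definition "w5_033 n = lookup (row31 V0 V0 V0 V0 V3 V2 V2 V1 V1 V2 V1 V2 V3 V1 V3 V3 V4 V3 V2 V3 V3 V2 V3 V4
   V2 U U U U U U) n"
definition "w5_03 n = branch w5_030 w5_031 w5_032 w5_033 V0 V0 V0 n"
definition "w5_0 n = branch w5_00 w5_01 w5_02 w5_03 V1 V0 V0 n"
definition "w5_100 n = lookup (row31 V0 V0 V0 V0 V1 V1 V2 V3 V2 V1 V1 V1 V2 V3 V1 V3 V2 V4 V3 V3 V3 V3 V3 V3
   V3 V3 U U U U U) n"
definition "w5_101 n = lookup (row31 V0 V0 V0 V0 V3 V2 V3 V2 V2 V1 V2 V1 V1 V3 V3 V1 V3 V2 V3 V3 V3 V3 V3 V3
   V3 V3 U U U U U) n"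
definition "w5_102 n = lookup (row31 V0 V0 V0 V0 V3 V1 V3 V2 V2 V3 V1 V2 V3 V3 V3 V3 V1 V2 V3 V3 V3 V3 V3 V3
   V3 U U U U U U) n"
definition "w5_103 n = lookup (row31 V0 V0 V0 V0 V3 V3 V3 V3 V3 V1 V3 V2 V2 V2 V2 V3 V3 V4 V3 V3 V3 V3 V3 V3
   V3 U U U U U U) n"
definition "w5_10 n = branch w5_100 w5_101 w5_102 w5_103 V0 V0 V0 n"
definition "w5_110 n = lookup (row31 V0 V0 V0 V0 V2 V1 V3 V2 V3 V1 V3 V1 V3 V2 V2 V4 V3 V3 V2 V2 V2 V2 V2 V2
   V2 V2 U U U U U) n"
definition "w5_111 n = lookup (row31 V0 V0 V0 V0 V1 V3 V1 V3 V3 V3 V3 V1 V2 V2 V3 V2 V4 V3 V2 V2 V2 V2 V2 V2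
   V2 V2 U U U U U) n"
definition "w5_112 n = lookup (row31 V0 V0 V0 V0 V1 V2 V1 V1 V1 V2 V2 V3 V2 V1 V2 V2 V2 V4 V2 V2 V2 V2 V2 V2
   V2 U U U U U U) n"
definition "w5_113 n = lookup (row31 V0 V0 V0 V0 V2 V3 V2 V2 V1 V3 V1 V3 V3 V3 V3 V2 V4 V3 V2 V2 V2 V2 V2 V2
   V2 U U U U U U) n"
definition "w5_11 n = branch w5_110 w5_111 w5_112 w5_113 V0 V0 V0 n"
definition "w5_120 n = lookup (row31 V0 V0 V0 V0 V3 V2 V1 V1 V1 V2 V2 V1 V2 V3 V3 V2 V4 V2 V3 V3 V3 V3 V3 V3
   V3 V3 U U U U U) n"
definition "w5_121 n = lookup (row31 V0 V0 V0 V0 V1 V2 V3 V2 V1 V3 V2 V2 V3 V3 V2 V3 V2 V2 V3 V3 V3 V3 V3 V3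
   V3 U U U U U U) n"
definition "w5_122 n = lookup (row31 V0 V0 V0 V0 V1 V3 V3 V1 V3 V3 V3 V1 V3 V2 V3 V3 V3 V3 V3 V3 V3 V3 V3 V3
   V3 U U U U U U) n"
definition "w5_123 n = lookup (row31 V0 V0 V0 V2 V3 V2 V3 V3 V3 V2 V1 V2 V2 V2 V4 V3 V2 V2 V3 V3 V3 V3 V3 V3
   V3 U U U U U U) n"
definition "w5_12 n = branch w5_120 w5_121 w5_122 w5_123 V0 V0 V0 n"
definition "w5_130 n = lookup (row31 V0 V0 V0 V0 V1 V3 V2 V1 V3 V3 V3 V1 V1 V1 V1 V1 V2 V3 V2 V2 V2 V2 V2 V2
   V2 V2 U U U U U) n"
definition "w5_131 n = lookup (row31 V0 V0 V0 V0 V2 V3 V2 V3 V3 V2 V3 V3 V2 V2 V1 V2 V1 V3 V2 V2 V2 V2 V2 V2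
   V2 U U U U U U) n"
definition "w5_132 n = lookup (row31 V0 V0 V0 V0 V2 V1 V2 V2 V2 V2 V1 V3 V1 V3 V1 V2 V2 V2 V2 V2 V2 V2 V2 V2
   V2 U U U U U U) n"
definition "w5_133 n = lookup (row31 V0 V0 V0 V1 V2 V3 V2 V1 V2 V3 V1 V3 V1 V3 V2 V1 V3 V4 V2 V2 V2 V2 V2 V2
   V2 U U U U U U) n"
definition "w5_13 n = branch w5_130 w5_131 w5_132 w5_133 V0 V0 V0 n"
definition "w5_1 n = branch w5_10 w5_11 w5_12 w5_13 V0 V0 V0 n"
definition "w5_200 n = lookup (row31 V0 V0 V0 V0 V2 V2 V3 V4 V2 V3 V2 V2 V3 V3 V2 V3 V3 V3 V4 V2 V4 V3 V2 V4
   V5 V2 U U U U U) n"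
definition "w5_201 n = lookup (row31 V0 V0 V0 V0 V3 V3 V2 V3 V1 V3 V3 V2 V1 V3 V2 V1 V3 V4 V2 V3 V5 V2 V3 V5
   V2 V3 U U U U U) n"
definition "w5_202 n = lookup (row31 V0 V0 V0 V0 V3 V2 V2 V3 V2 V2 V2 V1 V1 V1 V3 V4 V1 V2 V4 V5 V2 V4 V3 V2
   V3 U U U U U U) n"
definition "w5_203 n = lookup (row31 V0 V0 V0 V0 V2 V2 V2 V2 V2 V2 V2 V2 V3 V2 V3 V2 V4 V2 V5 V2 V3 V4 V2 V3
   V5 U U U U U U) n"
definition "w5_20 n = branch w5_200 w5_201 w5_202 w5_203 V0 V0 V0 n"
definition "w5_210 n = lookup (row31 V0 V0 V0 V0 V3 V1 V3 V3 V3 V2 V3 V2 V4 V2 V3 V2 V2 V4 V2 V3 V5 V2 V3 V5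
   V2 V3 U U U U U) n"
definition "w5_211 n = lookup (row31 V0 V0 V0 V0 V2 V1 V3 V2 V1 V2 V1 V1 V1 V1 V1 V1 V2 V2 V4 V5 V2 V4 V5 V2
   V3 V5 U U U U U) n"
definition "w5_212 n = lookup (row31 V0 V0 V0 V0 V2 V3 V3 V2 V3 V3 V3 V3 V3 V3 V2 V2 V1 V3 V3 V2 V3 V5 V2 V3
   V5 U U U U U U) n"
definition "w5_213 n = lookup (row31 V0 V0 V0 V0 V3 V1 V4 V1 V3 V3 V3 V3 V1 V3 V2 V1 V2 V3 V2 V4 V4 V2 V4 V5
   V2 U U U U U U) n"
definition "w5_21 n = branch w5_210 w5_211 w5_212 w5_213 V0 V0 V0 n"
definition "w5_220 n = lookup (row31 V0 V0 V0 V0 V2 V1 V2 V2 V2 V3 V1 V1 V2 V3 V2 V3 V3 V2 V5 V4 V2 V4 V5 V2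
   V3 V4 U U U U U) n"
definition "w5_221 n = lookup (row31 V0 V0 V0 V0 V3 V3 V2 V3 V2 V1 V3 V1 V2 V2 V1 V2 V3 V3 V3 V2 V3 V3 V2 V3
   V4 U U U U U U) n"
definition "w5_222 n = lookup (row31 V0 V0 V0 V0 V1 V2 V2 V1 V2 V1 V2 V2 V3 V1 V3 V3 V2 V2 V2 V4 V4 V2 V4 V4
   V2 U U U U U U) n"
definition "w5_223 n = lookup (row31 V0 V0 V0 V0 V1 V3 V3 V1 V2 V2 V1 V4 V1 V1 V3 V1 V3 V2 V3 V3 V2 V3 V5 V2
   V3 U U U U U U) n"
definition "w5_22 n = branch w5_220 w5_221 w5_222 w5_223 V0 V0 V0 n"
definition "w5_230 n = lookup (row31 V0 V0 V0 V0 V1 V2 V4 V1 V3 V2 V2 V1 V3 V2 V3 V2 V2 V3 V3 V2 V4 V3 V2 V3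
   V4 V2 U U U U U) n"
definition "w5_231 n = lookup (row31 V0 V0 V0 V0 V2 V3 V3 V1 V3 V3 V3 V2 V3 V3 V2 V3 V2 V4 V2 V3 V5 V2 V4 V4
   V2 U U U U U U) n"
definition "w5_232 n = lookup (row31 V0 V0 V0 V0 V3 V3 V3 V1 V3 V3 V3 V3 V2 V1 V2 V4 V3 V3 V4 V3 V2 V3 V3 V2
   V3 U U U U U U) n"
definition "w5_233 n = lookup (row31 V0 V0 V0 V3 V3 V2 V2 V3 V1 V3 V1 V2 V2 V1 V2 V2 V2 V3 V4 V2 V5 V4 V2 V3
   V4 U U U U U U) n"
definition "w5_23 n = branch w5_230 w5_231 w5_232 w5_233 V0 V0 V0 n"
definition "w5_2 n = branch w5_20 w5_21 w5_22 w5_23 V1 V0 V0 n"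
definition "w5_300 n = lookup (row31 V0 V0 V0 V0 V3 V1 V3 V3 V2 V1 V3 V1 V2 V2 V3 V3 V2 V2 V2 V2 V2 V2 V2 V2
   V2 V2 U U U U U) n"
definition "w5_301 n = lookup (row31 V0 V0 V0 V0 V2 V2 V3 V2 V2 V1 V2 V1 V3 V3 V3 V3 V4 V2 V2 V2 V2 V2 V2 V2
   V2 V2 U U U U U) n"
definition "w5_302 n = lookup (row31 V0 V0 V0 V0 V3 V3 V3 V2 V3 V2 V3 V2 V3 V1 V2 V3 V3 V2 V2 V2 V2 V2 V2 V2
   V2 U U U U U U) n"
definition "w5_303 n = lookup (row31 V0 V0 V0 V0 V3 V3 V3 V3 V1 V1 V3 V2 V2 V2 V2 V3 V3 V3 V2 V2 V2 V2 V2 V2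
   V2 U U U U U U) n"
definition "w5_30 n = branch w5_300 w5_301 w5_302 w5_303 V0 V0 V0 n"
definition "w5_310 n = lookup (row31 V0 V0 V0 V0 V2 V3 V1 V2 V3 V3 V3 V1 V3 V3 V2 V4 V4 V3 V3 V3 V3 V3 V3 V3
   V3 V3 U U U U U) n"
definition "w5_311 n = lookup (row31 V0 V0 V0 V0 V1 V3 V1 V3 V1 V3 V3 V3 V2 V2 V2 V2 V3 V3 V3 V3 V3 V3 V3 V3
   V3 U U U U U U) n"
definition "w5_312 n = lookup (row31 V0 V0 V0 V0 V1 V2 V1 V1 V1 V3 V2 V3 V2 V3 V3 V2 V2 V3 V3 V3 V3 V3 V3 V3
   V3 U U U U U U) n"
definition "w5_313 n = lookup (row31 V0 V0 V0 V2 V2 V2 V2 V2 V3 V2 V1 V3 V3 V3 V3 V2 V2 V4 V3 V3 V3 V3 V3 V3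
   V3 U U U U U U) n"
definition "w5_31 n = branch w5_310 w5_311 w5_312 w5_313 V0 V0 V0 n"
definition "w5_320 n = lookup (row31 V0 V0 V0 V0 V3 V2 V3 V1 V1 V2 V2 V1 V2 V1 V3 V2 V3 V2 V2 V2 V2 V2 V2 V2
   V2 V2 U U U U U) n"
definition "w5_321 n = lookup (row31 V0 V0 V0 V0 V3 V2 V3 V2 V3 V2 V2 V2 V3 V3 V1 V3 V2 V2 V2 V2 V2 V2 V2 V2
   V2 U U U U U U) n"
definition "w5_322 n = lookup (row31 V0 V0 V0 V0 V3 V3 V3 V3 V2 V2 V3 V1 V1 V2 V1 V3 V4 V4 V2 V2 V2 V2 V2 V2
   V2 U U U U U U) n"
definition "w5_323 n = lookup (row31 V0 V0 V0 V2 V3 V3 V3 V1 V3 V3 V1 V2 V1 V2 V4 V1 V3 V2 V2 V2 V2 V2 V2 V2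
   V2 U U U U U U) n"
definition "w5_32 n = branch w5_320 w5_321 w5_322 w5_323 V0 V0 V0 n"
definition "w5_330 n = lookup (row31 V0 V0 V0 V0 V1 V3 V2 V3 V3 V3 V3 V1 V1 V3 V1 V1 V2 V3 V3 V3 V3 V3 V3 V3
   V3 V3 U U U U U) n"
definition "w5_331 n = lookup (row31 V0 V0 V0 V0 V2 V1 V2 V3 V2 V3 V1 V3 V2 V2 V1 V2 V1 V4 V3 V3 V3 V3 V3 V3
   V3 U U U U U U) n"
definition "w5_332 n = lookup (row31 V0 V0 V0 V0 V2 V1 V2 V2 V3 V3 V1 V3 V3 V3 V4 V2 V2 V2 V3 V3 V3 V3 V3 V3
   V3 U U U U U U) n"
definition "w5_333 n = lookup (row31 V0 V0 V0 V1 V2 V2 V2 V3 V2 V1 V1 V3 V1 V1 V2 V3 V4 V3 V3 V3 V3 V3 V3 V3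
   V3 U U U U U U) n"
definition "w5_33 n = branch w5_330 w5_331 w5_332 w5_333 V0 V0 V0 n"
definition "w5_3 n = branch w5_30 w5_31 w5_32 w5_33 V0 V0 V0 n"
definition "w5 n = branch w5_0 w5_1 w5_2 w5_3 V0 V1 V0 n"
definition "g1_000 n = lookup (row63 V4 V3 V5 V3 V3 V3 V3 V3 V4 V4 V4 V3 V3 V3 V3 V3 V3 V3 V3 V3 V3 V3 V3 V4
   V4 V3 V3 V3 V3 V3 V3 V3 V3 V4 V3 V4 V4 V4 V4 V3 V4 V3 V5 V4 V5 V3 V4 V3 V3 V3 V3 V4 V3 V3 V3 V3 V3 V3 V3
   V3 V3 V3 V3) n"
definition "g1_001 n = lookup (row63 V3 V4 V3 V3 V3 V4 V4 V3 V4 V3 V4 V3 V5 V3 V3 V3 V5 V3 V3 V4 V6 V4 V3 V3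
   V4 V4 V3 V4 V3 V4 V3 V3 V5 V3 V3 V4 V3 V4 V4 V3 V3 V3 V3 V3 V3 V4 V6 V3 V4 V3 V3 V3 V3 V3 V3 V3 V3 V3 V3
   V3 V3 V3 V3) n"
definition "g1_002 n = lookup (row63 V4 V4 V4 V3 V3 V3 V3 V3 V3 V4 V3 V3 V5 V3 V3 V3 V3 V4 V3 V3 V4 V3 V3 V3
   V3 V4 V4 V3 V4 V4 V3 V4 V3 V4 V5 V3 V3 V4 V3 V3 V3 V3 V3 V3 V4 V4 V3 V3 V3 V3 V3 V3 V3 V3 V3 V3 V3 V3 V3
   V3 V3 V3 V3) n"
definition "g1_003 n = lookup (row63 V4 V5 V3 V3 V3 V3 V3 V3 V3 V4 V3 V3 V3 V3 V3 V4 V3 V3 V3 V3 V4 V4 V3 V4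
   V4 V3 V3 V3 V4 V3 V3 V3 V4 V3 V4 V4 V4 V3 V4 V4 V3 V3 V4 V3 V4 V3 V4 V3 V4 V3 V3 V3 V3 V3 V3 V3 V3 V3 V3
   V3 V3 V3 V3) n"
definition "g1_00 n = branch g1_000 g1_001 g1_002 g1_003 V3 V3 V5 n"
definition "g1_010 n = lookup (row63 V4 V3 V4 V3 V4 V3 V3 V3 V4 V3 V3 V3 V4 V3 V3 V3 V3 V3 V3 V4 V5 V3 V3 V4
   V4 V3 V3 V3 V3 V3 V3 V4 V3 V3 V5 V4 V3 V4 V3 V5 V3 V4 V4 V3 V4 V3 V5 V3 V3 V3 V3 V3 V3 V3 V3 V3 V3 V3 V3
   V3 V3 V3 V3) n"
definition "g1_011 n = lookup (row63 V3 V3 V3 V3 V4 V4 V3 V3 V4 V4 V3 V3 V4 V5 V3 V4 V4 V3 V4 V4 V4 V4 V5 V3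
   V4 V3 V3 V4 V3 V3 V3 V3 V4 V3 V4 V4 V4 V3 V3 V4 V3 V3 V4 V3 V3 V3 V4 V3 V5 V3 V3 V3 V3 V3 V3 V3 V3 V3 V3
   V3 V3 V3 V3) n"
definition "g1_012 n = lookup (row63 V4 V6 V3 V5 V3 V3 V3 V3 V3 V4 V3 V3 V4 V4 V3 V3 V3 V3 V4 V3 V4 V3 V3 V4
   V3 V3 V3 V3 V3 V3 V3 V4 V3 V3 V4 V3 V4 V3 V3 V3 V4 V3 V3 V3 V3 V3 V3 V3 V3 V3 V3 V3 V3 V3 V3 V3 V3 V3 V3
   V3 V3 V3 V3) n"
definition "g1_013 n = lookup (row63 V4 V4 V3 V4 V4 V3 V3 V3 V3 V3 V3 V3 V3 V3 V3 V3 V3 V3 V3 V5 V3 V3 V4 V4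
   V3 V3 V3 V4 V3 V3 V3 V4 V3 V3 V4 V3 V4 V3 V3 V3 V4 V5 V4 V3 V3 V3 V4 V4 V3 V3 V3 V3 V3 V3 V3 V3 V3 V3 V3
   V3 V3 V3 V3) n"
definition "g1_01 n = branch g1_010 g1_011 g1_012 g1_013 V4 V4 V4 n"
definition "g1_020 n = lookup (row63 V3 V3 V3 V4 V4 V3 V3 V4 V3 V3 V3 V4 V4 V3 V4 V4 V3 V3 V3 V3 V4 V3 V3 V3
   V3 V3 V4 V3 V3 V3 V3 V4 V3 V3 V4 V3 V4 V3 V3 V4 V4 V4 V4 V3 V3 V3 V3 V5 V3 V3 V3 V3 V3 V3 V3 V3 V3 V3 V3
   V3 V3 V3 V3) n"
definition "g1_021 n = lookup (row63 V3 V3 V3 V4 V4 V3 V3 V4 V3 V3 V5 V4 V5 V4 V3 V5 V3 V3 V4 V3 V3 V3 V4 V4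
   V3 V3 V3 V3 V3 V3 V3 V3 V3 V3 V4 V3 V4 V3 V3 V4 V4 V3 V4 V4 V3 V3 V4 V3 V3 V4 V4 V3 V3 V3 V3 V3 V3 V3 V3
   V3 V3 V3 V3) n"
definition "g1_022 n = lookup (row63 V3 V5 V3 V4 V3 V4 V3 V3 V3 V3 V4 V3 V5 V4 V6 V3 V3 V3 V4 V3 V3 V3 V3 V3
   V3 V3 V3 V3 V3 V3 V4 V3 V3 V4 V3 V3 V3 V3 V3 V3 V4 V4 V3 V3 V3 V3 V3 V3 V3 V3 V3 V4 V3 V3 V3 V3 V3 V3 V3
   V3 V3 V3 V3) n"
definition "g1_023 n = lookup (row63 V3 V5 V3 V4 V3 V3 V5 V3 V3 V3 V3 V4 V3 V5 V3 V3 V3 V4 V3 V4 V3 V3 V3 V3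
   V3 V4 V3 V4 V3 V3 V3 V5 V3 V4 V3 V3 V3 V3 V3 V3 V4 V6 V3 V3 V3 V3 V3 V4 V3 V3 V3 V3 V3 V3 V3 V3 V3 V3 V3
   V3 V3 V3 V3) n"
definition "g1_02 n = branch g1_020 g1_021 g1_022 g1_023 V4 V4 V3 n"
definition "g1_030 n = lookup (row63 V3 V3 V3 V4 V3 V3 V5 V4 V3 V3 V4 V4 V6 V3 V4 V3 V3 V3 V3 V3 V5 V3 V3 V3
   V3 V4 V4 V3 V3 V4 V3 V3 V3 V3 V3 V3 V3 V5 V4 V3 V4 V3 V3 V3 V3 V4 V5 V4 V3 V4 V3 V3 V3 V3 V3 V3 V3 V3 V3
   V3 V3 V3 V3) n"
definition "g1_031 n = lookup (row63 V3 V4 V4 V4 V3 V3 V3 V4 V3 V3 V4 V4 V4 V3 V3 V3 V3 V4 V3 V3 V3 V3 V3 V4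
   V3 V4 V3 V3 V3 V4 V3 V3 V3 V4 V3 V3 V3 V4 V3 V3 V3 V3 V3 V4 V3 V4 V3 V3 V3 V4 V4 V3 V3 V3 V3 V3 V3 V3 V3
   V3 V3 V3 V3) n"
definition "g1_032 n = lookup (row63 V3 V4 V3 V3 V3 V4 V3 V3 V3 V3 V4 V3 V4 V3 V4 V4 V3 V3 V3 V3 V4 V4 V3 V3
   V3 V3 V3 V3 V4 V3 V4 V3 V3 V4 V3 V3 V3 V3 V4 V4 V3 V5 V3 V3 V4 V3 V3 V3 V5 V3 V3 V4 V3 V3 V3 V3 V3 V3 V3
   V3 V3 V3 V3) n"
definition "g1_033 n = lookup (row63 V3 V4 V3 V3 V3 V3 V4 V3 V5 V4 V3 V3 V3 V4 V3 V3 V3 V4 V3 V5 V3 V3 V3 V3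
   V3 V4 V3 V3 V3 V3 V3 V3 V4 V4 V3 V4 V3 V4 V3 V4 V3 V4 V5 V3 V3 V3 V3 V3 V3 V3 V4 V3 V3 V3 V3 V3 V3 V3 V3
   V3 V3 V3 V3) n"
definition "g1_03 n = branch g1_030 g1_031 g1_032 g1_033 V3 V3 V3 n"
definition "g1_0 n = branch g1_00 g1_01 g1_02 g1_03 V2 V3 V3 n"
definition "g1_100 n = lookup (row63 V3 V3 V5 V3 V4 V3 V3 V3 V3 V5 V3 V4 V3 V4 V3 V4 V3 V3 V4 V3 V5 V3 V4 V3
   V3 V3 V3 V3 V3 V3 V3 V3 V3 V3 V4 V3 V3 V3 V3 V4 V3 V3 V4 V4 V3 V3 V4 V4 V3 V4 V3 V4 V3 V3 V3 V3 V3 V3 V3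
   V3 V3 V3 V3) n"
definition "g1_101 n = lookup (row63 V3 V3 V3 V3 V3 V3 V4 V3 V3 V4 V3 V3 V5 V4 V4 V3 V3 V5 V4 V3 V4 V3 V3 V3
   V3 V3 V4 V4 V3 V3 V3 V3 V3 V3 V3 V3 V3 V3 V3 V3 V3 V3 V3 V4 V3 V3 V5 V4 V3 V3 V5 V3 V3 V3 V3 V3 V3 V3 V3
   V3 V3 V3 V3) n"
definition "g1_102 n = lookup (row63 V3 V3 V4 V4 V3 V4 V3 V4 V3 V3 V3 V4 V5 V3 V4 V3 V3 V4 V3 V3 V3 V4 V3 V5
   V3 V4 V3 V3 V3 V3 V5 V3 V3 V4 V5 V3 V4 V3 V4 V4 V3 V6 V3 V3 V3 V3 V3 V3 V3 V4 V3 V5 V3 V3 V3 V3 V3 V3 V3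
   V3 V3 V3 V3) n"
definition "g1_103 n = lookup (row63 V3 V5 V3 V3 V3 V3 V3 V4 V3 V3 V4 V4 V4 V3 V4 V3 V3 V4 V3 V5 V3 V4 V3 V3
   V3 V4 V3 V3 V3 V4 V3 V4 V3 V3 V3 V3 V3 V3 V4 V3 V4 V4 V3 V3 V3 V4 V4 V3 V5 V4 V3 V3 V3 V3 V3 V3 V3 V3 V3
   V3 V3 V3 V3) n"
definition "g1_10 n = branch g1_100 g1_101 g1_102 g1_103 V4 V3 V4 n"
definition "g1_110 n = lookup (row63 V3 V4 V6 V4 V3 V3 V3 V3 V3 V4 V3 V4 V3 V3 V3 V3 V3 V3 V3 V3 V4 V3 V4 V3
   V3 V4 V3 V3 V3 V4 V3 V3 V3 V4 V4 V3 V4 V3 V3 V4 V4 V3 V3 V3 V5 V4 V5 V4 V3 V4 V3 V3 V3 V3 V3 V3 V3 V3 V3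
   V3 V3 V3 V3) n"
definition "g1_111 n = lookup (row63 V3 V3 V4 V3 V3 V3 V4 V3 V3 V4 V4 V3 V4 V3 V4 V3 V5 V5 V3 V3 V3 V4 V3 V3
   V3 V3 V3 V3 V4 V3 V4 V3 V5 V4 V3 V3 V3 V3 V4 V3 V3 V3 V3 V3 V4 V3 V3 V3 V4 V3 V4 V3 V3 V3 V3 V3 V3 V3 V3
   V3 V3 V3 V3) n"
definition "g1_112 n = lookup (row63 V3 V3 V4 V4 V3 V3 V3 V3 V4 V3 V3 V3 V4 V3 V4 V5 V4 V3 V3 V3 V5 V4 V3 V3
   V4 V4 V3 V3 V3 V4 V3 V3 V4 V3 V3 V4 V3 V4 V4 V3 V3 V5 V3 V3 V3 V4 V3 V3 V4 V4 V3 V4 V3 V3 V3 V3 V3 V3 V3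
   V3 V3 V3 V3) n"
definition "g1_113 n = lookup (row63 V3 V3 V3 V3 V3 V3 V4 V3 V4 V3 V4 V3 V3 V4 V3 V3 V3 V3 V3 V4 V3 V4 V3 V3
   V4 V4 V3 V3 V4 V4 V3 V3 V3 V3 V3 V3 V3 V4 V4 V3 V3 V5 V3 V3 V4 V4 V4 V3 V4 V3 V3 V3 V3 V3 V3 V3 V3 V3 V3
   V3 V3 V3 V3) n"
definition "g1_11 n = branch g1_110 g1_111 g1_112 g1_113 V4 V3 V3 n"
definition "g1_120 n = lookup (row63 V4 V4 V4 V4 V3 V4 V3 V3 V3 V3 V3 V3 V3 V3 V3 V3 V3 V4 V3 V3 V5 V3 V3 V4
   V3 V4 V3 V3 V4 V4 V3 V4 V4 V4 V3 V3 V4 V4 V3 V3 V4 V3 V3 V3 V4 V4 V4 V3 V4 V3 V3 V3 V3 V3 V3 V3 V3 V3 V3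
   V3 V3 V3 V3) n"
definition "g1_121 n = lookup (row63 V4 V3 V4 V3 V3 V3 V3 V3 V4 V3 V4 V3 V5 V5 V3 V5 V4 V3 V3 V4 V3 V3 V5 V3
   V4 V3 V3 V3 V4 V3 V4 V4 V4 V4 V3 V4 V3 V3 V3 V3 V3 V4 V4 V3 V4 V3 V4 V3 V4 V3 V3 V3 V3 V3 V3 V3 V3 V3 V3
   V3 V3 V3 V3) n"
definition "g1_122 n = lookup (row63 V3 V5 V3 V3 V4 V3 V3 V3 V4 V5 V3 V3 V5 V3 V3 V3 V4 V3 V3 V4 V4 V3 V4 V3
   V4 V3 V4 V3 V3 V3 V3 V3 V4 V3 V3 V4 V3 V4 V3 V5 V3 V4 V4 V4 V3 V3 V4 V4 V4 V3 V3 V3 V3 V3 V3 V3 V3 V3 V3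
   V3 V3 V3 V3) n"
definition "g1_123 n = lookup (row63 V4 V5 V3 V3 V4 V3 V4 V3 V4 V3 V3 V3 V3 V4 V3 V3 V3 V3 V4 V5 V3 V3 V3 V5
   V4 V3 V3 V4 V4 V3 V4 V5 V3 V3 V5 V3 V3 V4 V3 V3 V3 V4 V3 V4 V4 V6 V3 V4 V3 V3 V3 V3 V3 V3 V3 V3 V3 V3 V3
   V3 V3 V3 V3) n"
definition "g1_12 n = branch g1_120 g1_121 g1_122 g1_123 V3 V3 V3 n"
definition "g1_130 n = lookup (row63 V4 V3 V3 V3 V3 V4 V3 V3 V3 V5 V3 V3 V3 V4 V3 V3 V3 V4 V4 V3 V4 V3 V3 V4
   V3 V3 V3 V4 V3 V3 V3 V4 V4 V3 V3 V3 V3 V4 V3 V3 V3 V4 V3 V4 V3 V3 V5 V4 V4 V3 V3 V3 V3 V3 V3 V3 V3 V3 V3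
   V3 V3 V3 V3) n"
definition "g1_131 n = lookup (row63 V4 V3 V3 V3 V4 V3 V3 V3 V3 V3 V3 V3 V3 V4 V3 V4 V3 V3 V3 V4 V3 V3 V4 V4
   V3 V3 V4 V3 V3 V3 V5 V4 V3 V3 V4 V3 V5 V3 V3 V4 V3 V4 V4 V4 V3 V3 V4 V4 V3 V3 V3 V3 V3 V3 V3 V3 V3 V3 V3
   V3 V3 V3 V3) n"
definition "g1_132 n = lookup (row63 V3 V4 V3 V3 V4 V3 V3 V4 V3 V4 V3 V4 V6 V3 V5 V3 V3 V4 V4 V4 V3 V3 V4 V3
   V3 V3 V4 V3 V3 V3 V4 V5 V3 V3 V3 V3 V3 V3 V3 V4 V5 V5 V4 V4 V3 V3 V4 V4 V3 V3 V3 V3 V3 V3 V3 V3 V3 V3 V3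
   V3 V3 V3 V3) n"
definition "g1_133 n = lookup (row63 V3 V4 V3 V4 V4 V3 V3 V4 V3 V3 V3 V3 V4 V3 V4 V3 V3 V4 V4 V4 V3 V3 V3 V4
   V3 V3 V3 V4 V3 V3 V4 V4 V3 V3 V4 V3 V3 V3 V3 V3 V3 V5 V3 V4 V3 V5 V3 V4 V3 V3 V3 V3 V3 V3 V3 V3 V3 V3 V3
   V3 V3 V3 V3) n"
definition "g1_13 n = branch g1_130 g1_131 g1_132 g1_133 V3 V4 V3 n"
definition "g1_1 n = branch g1_10 g1_11 g1_12 g1_13 V4 V2 V3 n"
definition "g1_200 n = lookup (row63 V4 V3 V4 V3 V3 V3 V3 V3 V4 V4 V3 V3 V3 V3 V3 V3 V3 V3 V3 V4 V5 V3 V3 V4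
   V4 V3 V3 V3 V3 V3 V3 V5 V3 V4 V3 V4 V4 V4 V3 V3 V3 V4 V6 V4 V4 V3 V4 V3 V3 V3 V3 V3 V3 V3 V3 V3 V3 V3 V3
   V3 V3 V3 V3) n"
definition "g1_201 n = lookup (row63 V3 V4 V3 V3 V4 V4 V4 V3 V4 V4 V3 V3 V4 V3 V3 V3 V4 V3 V3 V4 V4 V4 V3 V3
   V4 V3 V3 V4 V3 V3 V3 V3 V4 V3 V3 V4 V3 V4 V3 V3 V3 V3 V4 V3 V3 V3 V4 V3 V4 V3 V3 V3 V3 V3 V3 V3 V3 V3 V3
   V3 V3 V3 V3) n"
definition "g1_202 n = lookup (row63 V4 V4 V3 V3 V3 V3 V3 V3 V3 V4 V3 V3 V4 V3 V3 V3 V3 V3 V4 V3 V4 V3 V3 V5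
   V3 V3 V4 V3 V4 V3 V3 V4 V3 V3 V4 V3 V4 V4 V3 V3 V3 V3 V3 V3 V4 V3 V3 V3 V3 V3 V3 V3 V3 V3 V3 V3 V3 V3 V3
   V3 V3 V3 V3) n"
definition "g1_203 n = lookup (row63 V4 V4 V3 V3 V4 V3 V3 V3 V3 V4 V3 V3 V3 V3 V3 V4 V3 V3 V3 V3 V3 V3 V4 V4
   V4 V3 V3 V5 V4 V3 V3 V5 V4 V3 V4 V4 V4 V3 V3 V3 V5 V3 V4 V3 V4 V3 V4 V5 V4 V3 V3 V3 V3 V3 V3 V3 V3 V3 V3
   V3 V3 V3 V3) n"
definition "g1_20 n = branch g1_200 g1_201 g1_202 g1_203 V5 V4 V4 n"
definition "g1_210 n = lookup (row63 V4 V3 V4 V3 V4 V3 V3 V3 V3 V3 V3 V3 V4 V3 V3 V4 V3 V3 V3 V4 V6 V3 V3 V4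
   V3 V3 V4 V3 V3 V3 V3 V4 V3 V3 V4 V3 V4 V3 V3 V4 V3 V4 V4 V3 V4 V3 V5 V3 V3 V3 V3 V3 V3 V3 V3 V3 V3 V3 V3
   V3 V3 V3 V3) n"
definition "g1_211 n = lookup (row63 V3 V3 V3 V4 V4 V3 V3 V4 V3 V4 V3 V4 V5 V4 V3 V4 V4 V3 V4 V4 V4 V3 V4 V5
   V3 V3 V3 V3 V3 V3 V3 V3 V4 V3 V4 V3 V4 V3 V3 V4 V4 V3 V5 V5 V3 V3 V5 V3 V4 V3 V5 V3 V3 V3 V3 V3 V3 V3 V3
   V3 V3 V3 V3) n"
definition "g1_212 n = lookup (row63 V3 V5 V3 V4 V3 V3 V3 V3 V3 V4 V3 V3 V5 V4 V3 V3 V3 V3 V4 V3 V3 V3 V3 V4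
   V3 V3 V3 V3 V3 V3 V5 V3 V3 V3 V4 V3 V4 V3 V3 V3 V4 V5 V3 V3 V3 V3 V3 V3 V3 V3 V3 V5 V3 V3 V3 V3 V3 V3 V3
   V3 V3 V3 V3) n"
definition "g1_213 n = lookup (row63 V3 V5 V3 V4 V4 V3 V3 V4 V3 V3 V3 V4 V3 V3 V3 V3 V3 V5 V3 V4 V3 V3 V4 V4
   V3 V3 V3 V4 V3 V3 V3 V4 V3 V4 V4 V3 V3 V3 V3 V3 V4 V5 V3 V3 V3 V3 V3 V4 V3 V3 V3 V3 V3 V3 V3 V3 V3 V3 V3
   V3 V3 V3 V3) n"
definition "g1_21 n = branch g1_210 g1_211 g1_212 g1_213 V4 V4 V4 n"
definition "g1_220 n = lookup (row63 V3 V3 V3 V4 V3 V3 V3 V4 V3 V3 V4 V4 V4 V3 V4 V4 V3 V3 V3 V3 V4 V3 V3 V3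
   V3 V3 V4 V3 V3 V3 V3 V3 V3 V3 V4 V3 V4 V3 V4 V4 V4 V3 V3 V3 V3 V3 V3 V4 V3 V4 V3 V3 V3 V3 V3 V3 V3 V3 V3
   V3 V3 V3 V3) n"
definition "g1_221 n = lookup (row63 V3 V3 V5 V4 V3 V3 V3 V4 V3 V3 V4 V4 V4 V4 V3 V4 V3 V5 V3 V3 V3 V3 V4 V4
   V3 V4 V3 V3 V3 V4 V3 V3 V3 V5 V4 V3 V4 V3 V3 V4 V4 V3 V3 V4 V3 V4 V3 V3 V3 V4 V4 V3 V3 V3 V3 V3 V3 V3 V3
   V3 V3 V3 V3) n"
definition "g1_222 n = lookup (row63 V3 V4 V3 V4 V3 V4 V3 V3 V3 V3 V4 V3 V4 V4 V4 V3 V3 V3 V3 V3 V5 V5 V3 V3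
   V3 V3 V3 V3 V3 V3 V4 V3 V3 V4 V3 V3 V3 V3 V6 V3 V4 V4 V3 V3 V3 V3 V3 V3 V3 V3 V3 V4 V3 V3 V3 V3 V3 V3 V3
   V3 V3 V3 V3) n"
definition "g1_223 n = lookup (row63 V3 V4 V3 V4 V3 V3 V4 V3 V3 V3 V3 V4 V3 V4 V3 V3 V3 V4 V3 V5 V3 V3 V3 V3
   V3 V4 V3 V3 V3 V3 V3 V4 V3 V4 V3 V3 V3 V3 V3 V4 V3 V4 V5 V3 V3 V3 V3 V3 V3 V3 V5 V3 V3 V3 V3 V3 V3 V3 V3
   V3 V3 V3 V3) n"
definition "g1_22 n = branch g1_220 g1_221 g1_222 g1_223 V3 V3 V3 n"
definition "g1_230 n = lookup (row63 V3 V4 V3 V3 V3 V3 V4 V3 V4 V3 V4 V3 V5 V3 V4 V3 V3 V3 V3 V3 V5 V5 V3 V3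
   V4 V4 V3 V3 V3 V4 V3 V3 V3 V3 V3 V4 V3 V4 V4 V3 V3 V3 V3 V3 V3 V4 V5 V4 V5 V4 V3 V3 V3 V3 V3 V3 V3 V3 V3
   V3 V3 V3 V3) n"
definition "g1_231 n = lookup (row63 V3 V4 V4 V3 V3 V4 V3 V3 V3 V3 V4 V3 V5 V3 V3 V3 V3 V4 V3 V3 V3 V3 V3 V3
   V3 V5 V4 V3 V4 V4 V3 V3 V3 V4 V3 V3 V3 V4 V3 V3 V3 V3 V3 V3 V4 V4 V3 V3 V3 V4 V3 V3 V3 V3 V3 V3 V3 V3 V3
   V3 V3 V3 V3) n"
definition "g1_232 n = lookup (row63 V4 V5 V3 V3 V3 V4 V3 V3 V3 V4 V4 V3 V4 V3 V4 V4 V3 V3 V3 V3 V4 V4 V3 V3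
   V4 V3 V3 V3 V4 V3 V3 V3 V4 V3 V3 V4 V3 V3 V4 V4 V3 V5 V3 V3 V4 V3 V3 V3 V4 V3 V3 V3 V3 V3 V3 V3 V3 V3 V3
   V3 V3 V3 V3) n"
definition "g1_233 n = lookup (row63 V3 V5 V3 V3 V3 V3 V4 V3 V4 V4 V3 V3 V3 V4 V3 V3 V3 V3 V3 V3 V3 V3 V3 V5
   V3 V3 V3 V3 V3 V3 V3 V3 V4 V3 V5 V4 V4 V4 V3 V4 V3 V5 V4 V3 V3 V5 V3 V3 V3 V3 V4 V3 V3 V3 V3 V3 V3 V3 V3
   V3 V3 V3 V3) n"
definition "g1_23 n = branch g1_230 g1_231 g1_232 g1_233 V3 V3 V3 n"
definition "g1_2 n = branch g1_20 g1_21 g1_22 g1_23 V3 V3 V2 n"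
definition "g1_300 n = lookup (row63 V3 V3 V5 V5 V3 V3 V3 V3 V3 V4 V3 V4 V3 V3 V3 V4 V3 V3 V3 V3 V5 V3 V4 V3
   V3 V4 V3 V3 V3 V4 V3 V3 V3 V3 V4 V3 V3 V3 V3 V5 V5 V3 V4 V4 V3 V4 V5 V4 V3 V4 V3 V4 V3 V3 V3 V3 V3 V3 V3
   V3 V3 V3 V3) n"
definition "g1_301 n = lookup (row63 V3 V3 V3 V3 V3 V3 V4 V3 V3 V4 V5 V3 V4 V3 V4 V3 V3 V5 V3 V3 V3 V4 V3 V3
   V3 V3 V4 V3 V3 V3 V3 V3 V3 V4 V3 V3 V3 V3 V4 V3 V3 V3 V3 V4 V3 V3 V3 V3 V5 V3 V4 V3 V3 V3 V3 V3 V3 V3 V3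
   V3 V3 V3 V3) n"
definition "g1_302 n = lookup (row63 V3 V3 V4 V4 V3 V4 V3 V4 V3 V3 V3 V4 V6 V3 V4 V5 V3 V4 V3 V3 V3 V4 V3 V4
   V3 V4 V3 V3 V3 V4 V3 V3 V3 V5 V4 V3 V4 V3 V4 V3 V3 V5 V3 V3 V3 V4 V3 V3 V4 V4 V3 V4 V3 V3 V3 V3 V3 V3 V3
   V3 V3 V3 V3) n"
definition "g1_303 n = lookup (row63 V3 V3 V3 V3 V3 V3 V5 V4 V4 V3 V4 V4 V4 V5 V4 V3 V3 V4 V3 V5 V3 V4 V3 V3
   V3 V4 V3 V3 V3 V4 V3 V4 V3 V3 V3 V3 V3 V4 V4 V3 V4 V5 V3 V3 V3 V4 V4 V3 V4 V4 V3 V3 V3 V3 V3 V3 V3 V3 V3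
   V3 V3 V3 V3) n"
definition "g1_30 n = branch g1_300 g1_301 g1_302 g1_303 V4 V3 V3 n"
definition "g1_310 n = lookup (row63 V3 V4 V4 V4 V3 V4 V3 V3 V3 V4 V3 V3 V3 V3 V3 V3 V3 V3 V3 V3 V4 V3 V3 V3
   V3 V4 V3 V3 V4 V4 V3 V5 V4 V4 V3 V3 V4 V5 V3 V3 V4 V3 V3 V3 V4 V4 V4 V3 V4 V4 V3 V3 V3 V3 V3 V3 V3 V3 V3
   V3 V3 V3 V3) n"
definition "g1_311 n = lookup (row63 V4 V3 V4 V3 V3 V3 V3 V3 V4 V3 V4 V3 V5 V3 V3 V3 V4 V3 V3 V3 V3 V4 V3 V3
   V4 V3 V3 V3 V4 V3 V4 V4 V4 V4 V3 V4 V3 V3 V4 V3 V3 V3 V5 V3 V4 V3 V5 V3 V4 V3 V4 V3 V3 V3 V3 V3 V3 V3 V3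
   V3 V3 V3 V3) n"
definition "g1_312 n = lookup (row63 V3 V3 V3 V3 V3 V3 V3 V3 V4 V3 V3 V3 V4 V3 V3 V5 V4 V3 V3 V4 V4 V4 V3 V3
   V4 V3 V4 V3 V3 V4 V3 V3 V4 V3 V3 V4 V3 V4 V4 V5 V3 V4 V4 V3 V3 V4 V4 V3 V4 V3 V3 V4 V3 V3 V3 V3 V3 V3 V3
   V3 V3 V3 V3) n"
definition "g1_313 n = lookup (row63 V4 V5 V3 V3 V3 V3 V4 V3 V4 V3 V3 V3 V3 V4 V3 V3 V3 V3 V3 V4 V3 V3 V3 V3
   V4 V3 V3 V5 V4 V4 V3 V3 V3 V3 V3 V3 V3 V4 V3 V3 V3 V4 V3 V4 V4 V4 V3 V5 V4 V3 V3 V3 V3 V3 V3 V3 V3 V3 V3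
   V3 V3 V3 V3) n"
definition "g1_31 n = branch g1_310 g1_311 g1_312 g1_313 V3 V3 V3 n"
definition "g1_320 n = lookup (row63 V4 V4 V4 V3 V3 V4 V3 V3 V3 V3 V3 V3 V3 V4 V3 V3 V3 V4 V4 V3 V5 V3 V3 V4
   V3 V3 V3 V5 V4 V3 V3 V4 V4 V3 V3 V3 V3 V4 V3 V3 V3 V4 V3 V3 V4 V3 V5 V3 V4 V3 V3 V3 V3 V3 V3 V3 V3 V3 V3
   V3 V3 V3 V3) n"
definition "g1_321 n = lookup (row63 V4 V3 V3 V3 V4 V3 V3 V3 V4 V3 V3 V3 V3 V4 V3 V4 V4 V3 V3 V4 V3 V3 V4 V5
   V4 V3 V3 V3 V4 V3 V3 V4 V4 V3 V5 V4 V3 V3 V3 V3 V3 V4 V4 V4 V4 V3 V4 V4 V3 V3 V3 V3 V3 V3 V3 V3 V3 V3 V3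
   V3 V3 V3 V3) n"
definition "g1_322 n = lookup (row63 V3 V4 V3 V3 V4 V3 V3 V3 V3 V4 V3 V3 V5 V3 V3 V3 V4 V3 V4 V4 V4 V3 V4 V3
   V4 V3 V4 V3 V3 V3 V4 V3 V4 V3 V3 V4 V3 V3 V3 V4 V3 V5 V4 V4 V3 V3 V4 V4 V3 V3 V3 V3 V3 V3 V3 V3 V3 V3 V3
   V3 V3 V3 V3) n"
definition "g1_323 n = lookup (row63 V4 V6 V3 V3 V4 V3 V3 V3 V3 V3 V3 V3 V3 V3 V3 V3 V3 V5 V4 V5 V3 V3 V3 V4
   V3 V3 V3 V4 V3 V3 V4 V4 V3 V3 V4 V3 V3 V3 V3 V3 V3 V5 V3 V4 V3 V5 V3 V4 V3 V3 V3 V3 V3 V3 V3 V3 V3 V3 V3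
   V3 V3 V3 V3) n"
definition "g1_32 n = branch g1_320 g1_321 g1_322 g1_323 V3 V5 V3 n"
definition "g1_330 n = lookup (row63 V3 V3 V3 V3 V3 V3 V3 V3 V3 V5 V3 V3 V3 V4 V3 V3 V3 V3 V4 V3 V4 V3 V4 V3
   V3 V3 V4 V4 V3 V3 V3 V3 V3 V3 V3 V3 V3 V3 V3 V3 V3 V4 V3 V4 V3 V3 V4 V4 V3 V3 V3 V3 V3 V3 V3 V3 V3 V3 V3
   V3 V3 V3 V3) n"
definition "g1_331 n = lookup (row63 V3 V3 V5 V5 V4 V4 V3 V4 V3 V3 V3 V4 V5 V4 V4 V4 V3 V4 V3 V3 V3 V3 V4 V4
   V3 V5 V3 V3 V3 V3 V5 V3 V3 V5 V4 V3 V4 V3 V3 V4 V3 V4 V3 V4 V3 V3 V3 V4 V3 V3 V3 V3 V3 V3 V3 V3 V3 V3 V3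
   V3 V3 V3 V3) n"
definition "g1_332 n = lookup (row63 V3 V5 V3 V3 V4 V3 V3 V4 V3 V4 V3 V4 V4 V3 V4 V3 V3 V4 V4 V6 V3 V5 V4 V3
   V3 V4 V3 V3 V3 V3 V4 V4 V3 V3 V3 V3 V3 V3 V5 V4 V4 V4 V3 V3 V3 V3 V3 V4 V3 V4 V3 V3 V3 V3 V3 V3 V3 V3 V3
   V3 V3 V3 V3) n"
definition "g1_333 n = lookup (row63 V3 V4 V3 V4 V3 V3 V3 V3 V3 V3 V4 V3 V4 V3 V4 V3 V3 V4 V4 V4 V3 V4 V3 V4
   V3 V3 V3 V3 V3 V3 V4 V3 V3 V5 V4 V3 V3 V3 V4 V3 V3 V4 V4 V3 V3 V4 V4 V3 V3 V3 V4 V3 V3 V3 V3 V3 V3 V3 V3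
   V3 V3 V3 V3) n"
definition "g1_33 n = branch g1_330 g1_331 g1_332 g1_333 V3 V4 V3 n"
definition "g1_3 n = branch g1_30 g1_31 g1_32 g1_33 V2 V2 V2 n"
definition "g1 n = branch g1_0 g1_1 g1_2 g1_3 U V2 V4 n"
definition "g3_0 n = lookup (row3 V3 V3 V2) n"
definition "g3_1 n = lookup (row3 V2 V2 V3) n"
definition "g3_2 n = lookup (row3 V3 V3 V3) n"
definition "g3_3 n = lookup (row3 V2 V2 V2) n"
definition "g3 n = branch g3_0 g3_1 g3_2 g3_3 U V2 V4 n"
definition "g5_000 n = lookup (row63 V3 V4 V3 V5 V4 V5 V4 V4 V3 V3 V5 V5 V5 V4 V4 V4 V5 V4 V4 V5 V4 V4 V5 V3
   V3 V5 V4 V4 V5 V4 V5 V4 V5 V5 V4 V3 V5 V3 V5 V5 V5 V5 V3 V3 V3 V4 V3 V4 V5 V5 V5 V5 V6 V5 U U U U U U U U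
   U) n"
definition "g5_001 n = lookup (row63 V5 V3 V4 V4 V5 V3 V3 V4 V3 V5 V5 V4 V3 V4 V5 V5 V3 V4 V4 V3 V3 V3 V5 V5
   V3 V5 V4 V3 V4 V5 V5 V5 V3 V4 V5 V3 V5 V3 V5 V5 V4 V5 V5 V5 V4 V5 V3 V4 V3 V4 V5 V5 V6 V4 U U U U U U U U
   U) n"
definition "g5_002 n = lookup (row63 V3 V5 V5 V4 V5 V4 V6 V4 V4 V3 V4 V4 V3 V5 V5 V5 V4 V5 V5 V5 V3 V4 V5 V4
   V4 V5 V3 V4 V3 V5 V5 V3 V4 V5 V3 V4 V5 V5 V5 V4 V5 V5 V5 V4 V3 V5 V5 V4 V4 V5 V4 V5 V5 U U U U U U U U U
   U) n"
definition "g5_003 n = lookup (row63 V3 V3 V5 V5 V5 V4 V5 V4 V4 V3 V5 V4 V4 V5 V4 V5 V4 V5 V5 V5 V6 V5 V5 V3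
   V3 V5 V5 V4 V5 V5 V4 V4 V3 V4 V3 V3 V3 V4 V5 V5 V4 V4 V3 V4 V5 V5 V3 V4 V3 V5 V6 V4 V5 U U U U U U U U U
   U) n"
definition "g5_00 n = branch g5_000 g5_001 g5_002 g5_003 V4 V5 V3 n"
definition "g5_010 n = lookup (row63 V5 V5 V3 V4 V3 V4 V5 V5 V5 V4 V4 V4 V3 V5 V5 V5 V4 V5 V5 V3 V3 V5 V4 V5
   V5 V4 V5 V6 V6 V5 V4 V3 V4 V5 V3 V5 V5 V5 V4 V3 V4 V3 V3 V4 V3 V5 V3 V5 V4 V4 V4 V4 V4 V4 U U U U U U U U
   U) n"
definition "g5_011 n = lookup (row63 V4 V4 V5 V5 V3 V5 V4 V5 V5 V3 V4 V5 V3 V3 V4 V3 V3 V5 V3 V5 V3 V5 V3 V4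
   V5 V4 V5 V5 V5 V4 V4 V4 V3 V5 V3 V5 V3 V4 V4 V3 V5 V4 V3 V4 V5 V4 V3 V5 V3 V5 V4 V4 V5 U U U U U U U U U
   U) n"
definition "g5_012 n = lookup (row63 V5 V3 V4 V3 V4 V5 V5 V5 V5 V5 V5 V5 V3 V3 V4 V4 V5 V4 V3 V4 V5 V5 V4 V3
   V5 V4 V4 V5 V4 V4 V4 V5 V5 V4 V3 V5 V3 V5 V4 V5 V3 V4 V4 V5 V4 V4 V4 V5 V5 V4 V6 V4 V4 U U U U U U U U U
   U) n"
definition "g5_013 n = lookup (row63 V5 V3 V4 V3 V3 V5 V4 V5 V5 V5 V4 V5 V5 V4 V5 V4 V5 V4 V4 V3 V4 V4 V3 V5
   V4 V4 V4 V3 V5 V4 V5 V3 V4 V5 V5 V4 V5 V5 V4 V4 V3 V4 V5 V5 V5 V4 V5 V3 V4 V4 V5 V6 V4 U U U U U U U U U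
   U) n"
definition "g5_01 n = branch g5_010 g5_011 g5_012 g5_013 V3 V3 V3 n"
definition "g5_020 n = lookup (row63 V5 V4 V4 V3 V5 V5 V4 V3 V4 V5 V5 V3 V5 V4 V3 V3 V5 V4 V4 V4 V3 V6 V5 V5
   V4 V5 V3 V5 V4 V4 V5 V5 V5 V4 V3 V4 V3 V4 V5 V3 V3 V5 V5 V5 V4 V4 V4 V3 V5 V5 V5 V5 V5 V6 U U U U U U U U
   U) n"
definition "g5_021 n = lookup (row63 V5 V5 V4 V3 V5 V4 V5 V3 V4 V4 V3 V3 V3 V3 V5 V3 V4 V4 V5 V5 V4 V4 V3 V3
   V4 V5 V4 V4 V4 V5 V5 V5 V4 V4 V5 V4 V5 V5 V5 V5 V3 V5 V5 V3 V4 V5 V5 V4 V4 V3 V3 V5 V4 U U U U U U U U U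
   U) n"
definition "g5_022 n = lookup (row63 V4 V3 V5 V3 V5 V3 V4 V4 V4 V4 V3 V4 V3 V5 V3 V5 V4 V5 V5 V5 V4 V4 V5 V4
   V4 V5 V5 V4 V5 V5 V3 V4 V4 V3 V4 V4 V5 V4 V5 V4 V5 V3 V5 V4 V5 V5 V5 V4 V4 V5 V5 V3 V6 U U U U U U U U U
   U) n"
definition "g5_023 n = lookup (row63 V4 V3 V5 V5 V5 V4 V3 V4 V4 V4 V5 V3 V4 V3 V4 V5 V4 V3 V5 V3 V5 V5 V4 V5
   V5 V3 V6 V5 V4 V5 V4 V3 V5 V3 V5 V5 V4 V4 V5 V5 V5 V3 V4 V4 V4 V5 V4 V5 V5 V5 V4 V4 V5 U U U U U U U U U
   U) n"
definition "g5_02 n = branch g5_020 g5_021 g5_022 g5_023 V5 V5 V4 n"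
definition "g5_030 n = lookup (row63 V4 V5 V5 V5 V4 V4 V3 V5 V5 V4 V3 V5 V3 V5 V5 V4 V4 V5 V5 V5 V4 V4 V4 V4
   V5 V3 V5 V4 V5 V3 V4 V4 V4 V5 V4 V5 V4 V3 V3 V4 V5 V4 V4 V4 V5 V3 V4 V3 V4 V3 V4 V4 V4 V5 U U U U U U U U
   U) n"
definition "g5_031 n = lookup (row63 V4 V3 V3 V5 V4 V5 V4 V5 V5 V5 V3 V5 V3 V4 V4 V4 V5 V3 V4 V4 V5 V5 V4 V5
   V5 V3 V5 V5 V5 V3 V4 V4 V5 V3 V4 V5 V4 V3 V4 V5 V4 V4 V4 V5 V5 V3 V4 V5 V5 V5 V5 V4 V6 U U U U U U U U U
   U) n"
definition "g5_032 n = lookup (row63 V5 V3 V4 V4 V4 V5 V6 V5 V5 V5 V5 V5 V3 V4 V3 V3 V5 V4 V4 V4 V3 V3 V4 V5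
   V5 V4 V4 V5 V3 V4 V5 V5 V5 V5 V5 V5 V4 V5 V3 V3 V5 V3 V4 V5 V3 V4 V4 V5 V3 V4 V4 V5 V4 U U U U U U U U U
   U) n"
definition "g5_033 n = lookup (row63 V5 V3 V4 V5 V4 V5 V3 V5 V3 V3 V4 V4 V5 V3 V5 V4 V5 V5 V4 V4 V6 V4 V5 V4
   V4 V5 V5 V4 V5 V4 V5 V4 V3 V5 V4 V3 V5 V3 V4 V3 V4 V3 V3 V5 V5 V4 V5 V4 V4 V4 V3 V5 V4 U U U U U U U U U
   U) n"
definition "g5_03 n = branch g5_030 g5_031 g5_032 g5_033 V4 V4 V5 n"
definition "g5_0 n = branch g5_00 g5_01 g5_02 g5_03 V3 V4 V2 n"
definition "g5_100 n = lookup (row63 V5 V5 V4 V4 V5 V4 V4 V5 V4 V3 V4 V3 V4 V5 V5 V5 V4 V6 V5 V5 V3 V5 V3 V5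
   V4 V5 V4 V4 V4 V5 V6 V5 V4 V4 V3 V4 V4 V5 V5 V3 V4 V5 V3 V3 V4 V5 V3 V3 V4 V3 V4 V3 V5 V6 U U U U U U U U
   U) n"
definition "g5_101 n = lookup (row63 V4 V4 V5 V5 V5 V4 V3 V4 V4 V3 V4 V4 V3 V5 V3 V4 V5 V3 V5 V5 V5 V5 V6 V4
   V4 V5 V3 V5 V5 V5 V4 V4 V4 V5 V4 V4 V5 V4 V5 V4 V5 V4 V5 V5 V5 V5 V4 V5 V4 V5 V3 V4 V5 U U U U U U U U U
   U) n"
definition "g5_102 n = lookup (row63 V4 V4 V3 V3 V4 V3 V4 V3 V6 V4 V5 V3 V3 V4 V3 V4 V5 V3 V5 V4 V5 V3 V4 V3
   V5 V3 V4 V4 V4 V5 V4 V4 V5 V3 V3 V5 V3 V4 V3 V5 V5 V3 V4 V5 V4 V5 V4 V4 V5 V3 V4 V3 V5 U U U U U U U U U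
   U) n"
definition "g5_103 n = lookup (row63 V4 V4 V6 V4 V5 V5 V4 V5 V5 V4 V3 V5 V3 V4 V3 V5 V5 V5 V4 V3 V5 V3 V5 V5
   V4 V3 V4 V5 V4 V3 V4 V3 V4 V5 V5 V4 V5 V5 V3 V4 V3 V3 V4 V4 V4 V3 V3 V5 V3 V3 V4 V4 V4 U U U U U U U U U
   U) n"
definition "g5_10 n = branch g5_100 g5_101 g5_102 g5_103 V3 V4 V5 n"
definition "g5_110 n = lookup (row63 V4 V3 V3 V3 V4 V5 V6 V6 V5 V3 V5 V5 V5 V4 V4 V5 V5 V4 V4 V4 V3 V4 V5 V4
   V5 V3 V5 V5 V5 V3 V4 V4 V5 V3 V5 V5 V3 V4 V4 V5 V3 V4 V4 V4 V3 V3 V3 V5 V5 V5 V5 V4 V6 V5 U U U U U U U U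
   U) n"
definition "g5_111 n = lookup (row63 V5 V5 V3 V4 V4 V5 V5 V5 V5 V5 V3 V5 V3 V4 V5 V5 V3 V4 V4 V4 V4 V3 V4 V5
   V5 V4 V4 V4 V3 V4 V3 V5 V3 V3 V5 V5 V4 V5 V3 V5 V4 V5 V4 V4 V3 V4 V4 V4 V3 V4 V3 V5 V4 U U U U U U U U U
   U) n"
definition "g5_112 n = lookup (row63 V5 V5 V6 V5 V5 V4 V5 V4 V3 V5 V4 V4 V3 V5 V5 V3 V3 V4 V4 V5 V3 V5 V5 V4
   V3 V5 V5 V5 V5 V3 V4 V5 V3 V4 V4 V3 V4 V3 V5 V4 V4 V3 V5 V4 V5 V3 V5 V5 V3 V5 V5 V3 V4 U U U U U U U U U
   U) n"
definition "g5_113 n = lookup (row63 V5 V4 V4 V5 V4 V4 V3 V5 V3 V5 V5 V5 V4 V3 V4 V4 V6 V5 V5 V3 V4 V5 V4 V4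
   V3 V5 V5 V4 V3 V5 V5 V4 V5 V4 V4 V5 V4 V3 V5 V5 V4 V3 V5 V5 V3 V5 V5 V4 V3 V4 V5 V5 V6 U U U U U U U U U
   U) n"
definition "g5_11 n = branch g5_110 g5_111 g5_112 g5_113 V5 V5 V4 n"
definition "g5_120 n = lookup (row63 V3 V5 V3 V5 V5 V3 V5 V4 V4 V4 V4 V4 V4 V5 V5 V4 V6 V3 V5 V5 V3 V5 V4 V3
   V4 V5 V4 V4 V3 V5 V5 V3 V3 V5 V4 V4 V5 V3 V5 V4 V5 V5 V5 V5 V3 V5 V3 V4 V3 V5 V6 V5 V5 V4 U U U U U U U U
   U) n"
definition "g5_121 n = lookup (row63 V3 V4 V5 V5 V5 V4 V4 V4 V3 V4 V5 V4 V4 V3 V4 V3 V3 V4 V5 V3 V5 V4 V3 V4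
   V3 V5 V5 V5 V5 V5 V5 V3 V3 V5 V4 V3 V5 V4 V4 V4 V5 V3 V3 V5 V5 V5 V3 V5 V5 V5 V4 V6 V5 U U U U U U U U U
   U) n"
definition "g5_122 n = lookup (row63 V4 V3 V4 V4 V3 V5 V4 V5 V5 V3 V5 V5 V4 V4 V4 V5 V5 V5 V5 V3 V3 V5 V3 V5
   V5 V4 V3 V6 V4 V4 V5 V4 V5 V5 V5 V5 V5 V5 V5 V3 V5 V3 V3 V3 V4 V4 V3 V3 V5 V4 V4 V4 V6 U U U U U U U U U
   U) n"
definition "g5_123 n = lookup (row63 V3 V3 V5 V4 V3 V6 V5 V4 V5 V4 V4 V4 V6 V5 V5 V5 V4 V4 V3 V3 V5 V4 V5 V3
   V5 V4 V4 V3 V5 V4 V3 V3 V4 V5 V3 V4 V5 V5 V4 V4 V5 V3 V4 V3 V5 V3 V4 V3 V4 V5 V4 V6 V5 U U U U U U U U U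
   U) n"
definition "g5_12 n = branch g5_120 g5_121 g5_122 g5_123 V4 V4 V5 n"
definition "g5_130 n = lookup (row63 V5 V5 V4 V4 V4 V5 V4 V5 V5 V3 V5 V5 V5 V3 V4 V5 V4 V5 V3 V4 V3 V4 V5 V5
   V5 V4 V5 V3 V4 V4 V6 V5 V5 V4 V5 V5 V4 V5 V4 V5 V4 V3 V4 V3 V4 V4 V3 V3 V5 V4 V4 V6 V4 V5 U U U U U U U U
   U) n"
definition "g5_131 n = lookup (row63 V5 V5 V4 V4 V3 V5 V5 V5 V4 V5 V4 V5 V4 V3 V5 V3 V4 V5 V4 V5 V4 V5 V3 V3
   V4 V4 V5 V6 V5 V4 V3 V5 V4 V4 V3 V4 V3 V6 V5 V3 V4 V5 V5 V3 V5 V4 V5 V3 V4 V4 V5 V4 V4 U U U U U U U U U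
   U) n"
definition "g5_132 n = lookup (row63 V5 V3 V5 V5 V5 V4 V5 V3 V4 V3 V4 V3 V3 V5 V3 V4 V4 V3 V3 V5 V4 V4 V5 V4
   V5 V5 V5 V4 V5 V5 V3 V3 V5 V4 V4 V5 V4 V4 V4 V3 V3 V3 V5 V5 V5 V5 V5 V5 V4 V5 V5 V5 V5 U U U U U U U U U
   U) n"
definition "g5_133 n = lookup (row63 V4 V3 V6 V3 V5 V5 V4 V5 V4 V5 V5 V5 V3 V4 V3 V6 V5 V3 V5 V3 V4 V5 V4 V3
   V4 V5 V5 V5 V4 V5 V5 V5 V5 V4 V3 V5 V4 V4 V5 V5 V4 V3 V5 V5 V4 V3 V5 V5 V5 V6 V5 V4 V4 U U U U U U U U U
   U) n"
definition "g5_13 n = branch g5_130 g5_131 g5_132 g5_133 V5 V3 V4 n"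
definition "g5_1 n = branch g5_10 g5_11 g5_12 g5_13 V2 V4 V2 n"
definition "g5_200 n = lookup (row63 V3 V4 V3 V4 V5 V4 V4 V4 V3 V5 V4 V4 V5 V4 V4 V4 V5 V4 V5 V3 V4 V5 V4 V3
   V3 V5 V5 V6 V4 V5 V5 V3 V5 V5 V4 V3 V5 V5 V4 V4 V4 V3 V3 V5 V3 V5 V3 V5 V4 V5 V4 V4 V4 V5 U U U U U U U U
   U) n"
definition "g5_201 n = lookup (row63 V4 V5 V4 V5 V3 V3 V5 V5 V5 V3 V5 V5 V3 V4 V4 V5 V3 V4 V5 V3 V3 V3 V4 V4
   V5 V4 V4 V3 V4 V4 V5 V4 V3 V5 V5 V5 V5 V5 V5 V5 V4 V5 V3 V5 V4 V4 V3 V4 V3 V4 V4 V4 V5 U U U U U U U U U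
   U) n"
definition "g5_202 n = lookup (row63 V3 V5 V4 V4 V5 V4 V4 V4 V4 V3 V4 V4 V3 V5 V4 V5 V4 V4 V3 V4 V3 V5 V5 V3
   V4 V4 V5 V5 V5 V5 V5 V3 V4 V4 V3 V4 V3 V5 V5 V5 V5 V5 V4 V5 V5 V5 V4 V4 V4 V4 V5 V4 V6 U U U U U U U U U
   U) n"
definition "g5_203 n = lookup (row63 V5 V3 V4 V5 V3 V4 V5 V4 V4 V5 V4 V4 V4 V5 V4 V5 V4 V4 V5 V4 V4 V4 V3 V3
   V5 V4 V4 V3 V5 V5 V5 V3 V5 V5 V3 V5 V3 V5 V4 V4 V3 V4 V3 V5 V5 V5 V3 V3 V5 V4 V6 V5 V5 U U U U U U U U U
   U) n"
definition "g5_20 n = branch g5_200 g5_201 g5_202 g5_203 V3 V3 V3 n"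
definition "g5_210 n = lookup (row63 V5 V5 V5 V5 V3 V5 V5 V5 V4 V4 V5 V5 V3 V5 V5 V3 V4 V5 V4 V5 V3 V6 V5 V5
   V4 V4 V3 V5 V5 V4 V4 V3 V4 V4 V3 V4 V3 V5 V5 V3 V5 V5 V3 V4 V5 V4 V4 V4 V5 V4 V5 V5 V5 V6 U U U U U U U U
   U) n"
definition "g5_211 n = lookup (row63 V5 V4 V5 V3 V5 V4 V4 V3 V5 V5 V4 V3 V3 V3 V5 V3 V5 V5 V3 V5 V5 V4 V3 V3
   V5 V5 V5 V4 V5 V5 V4 V5 V5 V4 V3 V5 V3 V4 V4 V3 V3 V4 V3 V3 V5 V5 V3 V5 V5 V5 V3 V5 V6 U U U U U U U U U
   U) n"
definition "g5_212 n = lookup (row63 V4 V3 V5 V3 V4 V5 V5 V5 V5 V5 V5 V5 V3 V3 V5 V4 V5 V5 V5 V5 V4 V4 V4 V5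
   V5 V5 V5 V4 V4 V4 V3 V4 V5 V5 V5 V5 V5 V4 V4 V4 V3 V3 V5 V4 V4 V4 V5 V5 V5 V5 V6 V3 V4 U U U U U U U U U
   U) n"
definition "g5_213 n = lookup (row63 V5 V3 V5 V3 V5 V5 V4 V5 V5 V4 V5 V3 V5 V4 V5 V4 V5 V3 V4 V3 V5 V5 V5 V5
   V4 V5 V6 V3 V4 V4 V4 V3 V4 V3 V5 V4 V4 V4 V5 V5 V3 V3 V4 V4 V4 V4 V4 V3 V4 V5 V4 V6 V4 U U U U U U U U U
   U) n"
definition "g5_21 n = branch g5_210 g5_211 g5_212 g5_213 V3 V5 V5 n"
definition "g5_220 n = lookup (row63 V4 V4 V4 V3 V4 V4 V4 V3 V5 V5 V3 V3 V5 V4 V3 V5 V5 V4 V5 V4 V3 V4 V4 V4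
   V5 V5 V5 V4 V4 V5 V5 V4 V5 V5 V5 V5 V5 V4 V3 V5 V3 V5 V4 V5 V4 V5 V4 V3 V4 V3 V4 V4 V6 V4 U U U U U U U U
   U) n"
definition "g5_221 n = lookup (row63 V4 V5 V3 V5 V5 V5 V5 V5 V4 V4 V3 V5 V3 V5 V4 V5 V4 V3 V4 V4 V4 V5 V5 V3
   V4 V3 V4 V5 V4 V3 V5 V4 V4 V3 V5 V4 V5 V5 V5 V5 V5 V5 V4 V3 V4 V3 V4 V4 V4 V3 V3 V4 V4 U U U U U U U U U
   U) n"
definition "g5_222 n = lookup (row63 V5 V3 V4 V5 V5 V3 V6 V4 V4 V4 V3 V4 V3 V5 V3 V5 V4 V4 V5 V4 V3 V3 V5 V4
   V4 V4 V4 V5 V5 V5 V3 V5 V4 V3 V4 V4 V4 V5 V3 V5 V5 V3 V4 V5 V5 V5 V4 V4 V4 V4 V4 V3 V5 U U U U U U U U U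
   U) n"
definition "g5_223 n = lookup (row63 V4 V3 V4 V5 V4 V4 V3 V4 V4 V5 V4 V5 V4 V3 V4 V5 V4 V3 V5 V3 V6 V4 V4 V4
   V5 V3 V5 V4 V5 V5 V5 V5 V5 V5 V4 V5 V5 V5 V4 V3 V4 V3 V3 V5 V5 V5 V5 V4 V5 V4 V3 V4 V5 U U U U U U U U U
   U) n"
definition "g5_22 n = branch g5_220 g5_221 g5_222 g5_223 V4 V5 V4 n"
definition "g5_230 n = lookup (row63 V5 V3 V5 V4 V5 V5 V3 V4 V3 V4 V5 V4 V3 V5 V5 V4 V4 V5 V4 V5 V3 V3 V5 V5
   V3 V3 V5 V5 V5 V3 V4 V5 V4 V4 V4 V3 V4 V3 V5 V4 V5 V4 V5 V4 V5 V3 V3 V5 V3 V5 V5 V5 V4 V7 U U U U U U U U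
   U) n"
definition "g5_231 n = lookup (row63 V5 V3 V3 V5 V4 V5 V6 V5 V5 V5 V5 V5 V3 V4 V5 V4 V5 V3 V5 V5 V5 V4 V4 V4
   V5 V3 V3 V4 V3 V5 V4 V5 V5 V3 V4 V5 V4 V3 V4 V4 V4 V4 V5 V4 V3 V5 V5 V5 V5 V5 V4 V5 V5 U U U U U U U U U
   U) n"
definition "g5_232 n = lookup (row63 V3 V3 V5 V4 V4 V5 V4 V5 V5 V3 V5 V5 V5 V4 V5 V3 V5 V5 V4 V5 V3 V3 V4 V5
   V3 V5 V5 V4 V3 V4 V4 V4 V3 V4 V5 V3 V5 V4 V3 V3 V4 V4 V5 V4 V3 V4 V5 V5 V3 V5 V5 V4 V4 U U U U U U U U U
   U) n"
definition "g5_233 n = lookup (row63 V5 V3 V5 V4 V5 V5 V5 V5 V3 V3 V5 V4 V5 V5 V5 V4 V5 V4 V4 V4 V4 V5 V5 V3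
   V4 V4 V4 V5 V4 V4 V4 V4 V3 V5 V3 V3 V3 V3 V5 V5 V5 V4 V3 V4 V4 V3 V4 V5 V4 V5 V3 V5 V4 U U U U U U U U U
   U) n"
definition "g5_23 n = branch g5_230 g5_231 g5_232 g5_233 V5 V4 V5 n"
definition "g5_2 n = branch g5_20 g5_21 g5_22 g5_23 V4 V4 V3 n"
definition "g5_300 n = lookup (row63 V4 V5 V3 V3 V5 V5 V6 V4 V5 V3 V4 V5 V5 V4 V4 V5 V5 V6 V4 V4 V3 V5 V5 V4
   V4 V3 V4 V5 V5 V3 V6 V4 V5 V5 V3 V4 V5 V5 V5 V3 V3 V5 V5 V5 V4 V3 V3 V5 V5 V3 V4 V5 V6 V5 U U U U U U U U
   U) n"
definition "g5_301 n = lookup (row63 V5 V5 V5 V4 V5 V4 V3 V4 V5 V3 V3 V4 V3 V5 V3 V5 V4 V3 V5 V4 V4 V3 V5 V5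
   V4 V5 V5 V4 V5 V5 V5 V5 V4 V3 V5 V4 V4 V5 V3 V5 V4 V4 V5 V5 V5 V5 V4 V5 V3 V4 V3 V4 V5 U U U U U U U U U
   U) n"
definition "g5_302 n = lookup (row63 V4 V5 V3 V3 V4 V5 V5 V5 V5 V5 V4 V5 V3 V4 V5 V3 V5 V5 V5 V5 V4 V3 V4 V5
   V5 V3 V5 V5 V5 V3 V5 V4 V5 V4 V5 V5 V5 V5 V3 V4 V4 V3 V5 V4 V5 V3 V5 V4 V3 V3 V4 V3 V6 U U U U U U U U U
   U) n"
definition "g5_303 n = lookup (row63 V4 V4 V4 V5 V4 V4 V3 V5 V3 V4 V3 V5 V5 V3 V5 V4 V4 V5 V4 V3 V5 V3 V4 V5
   V5 V5 V5 V4 V5 V3 V4 V5 V5 V5 V5 V5 V5 V3 V3 V4 V5 V3 V4 V5 V5 V3 V3 V4 V3 V6 V4 V4 V4 U U U U U U U U U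
   U) n"
definition "g5_30 n = branch g5_300 g5_301 g5_302 g5_303 V3 V5 V4 n"
definition "g5_310 n = lookup (row63 V5 V3 V3 V3 V4 V3 V5 V5 V4 V5 V5 V5 V4 V5 V5 V4 V6 V5 V5 V5 V3 V4 V6 V5
   V5 V5 V5 V4 V3 V5 V5 V3 V3 V3 V4 V5 V3 V3 V4 V4 V3 V4 V4 V4 V3 V5 V3 V4 V3 V5 V5 V4 V4 V4 U U U U U U U U
   U) n"
definition "g5_311 n = lookup (row63 V3 V4 V3 V5 V4 V5 V4 V5 V3 V4 V3 V5 V3 V4 V4 V4 V3 V5 V4 V5 V5 V5 V4 V4
   V3 V4 V4 V5 V3 V4 V3 V3 V3 V5 V4 V3 V5 V4 V5 V4 V5 V5 V3 V4 V3 V4 V3 V4 V3 V5 V5 V6 V4 U U U U U U U U U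
   U) n"
definition "g5_312 n = lookup (row63 V5 V4 V4 V4 V5 V5 V4 V4 V3 V4 V5 V4 V3 V5 V5 V4 V3 V4 V4 V3 V3 V5 V5 V4
   V3 V4 V3 V4 V4 V5 V4 V5 V3 V4 V4 V3 V4 V3 V5 V3 V5 V3 V3 V5 V4 V5 V3 V5 V5 V4 V5 V5 V4 U U U U U U U U U
   U) n"
definition "g5_313 n = lookup (row63 V3 V4 V5 V4 V5 V6 V3 V4 V5 V5 V4 V4 V4 V3 V4 V5 V6 V4 V5 V3 V4 V4 V5 V4
   V3 V5 V4 V3 V3 V6 V5 V4 V4 V4 V4 V4 V4 V5 V4 V5 V4 V3 V5 V3 V3 V5 V4 V3 V5 V4 V5 V5 V5 U U U U U U U U U
   U) n"
definition "g5_31 n = branch g5_310 g5_311 g5_312 g5_313 V4 V4 V5 n"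
definition "g5_320 n = lookup (row63 V3 V5 V5 V4 V5 V5 V4 V4 V5 V4 V4 V4 V5 V3 V4 V5 V4 V3 V3 V4 V3 V5 V4 V3
   V4 V5 V4 V3 V5 V5 V4 V3 V5 V4 V5 V4 V4 V3 V5 V5 V4 V3 V5 V5 V5 V5 V3 V5 V5 V4 V6 V6 V5 V5 U U U U U U U U
   U) n"
definition "g5_321 n = lookup (row63 V5 V5 V4 V4 V3 V4 V5 V4 V5 V5 V4 V4 V4 V3 V5 V3 V5 V4 V5 V3 V4 V4 V3 V3
   V5 V5 V5 V4 V5 V5 V4 V5 V5 V4 V3 V5 V4 V5 V4 V5 V4 V3 V3 V3 V5 V5 V3 V3 V4 V4 V4 V5 V5 U U U U U U U U U
   U) n"
definition "g5_322 n = lookup (row63 V4 V3 V5 V5 V3 V4 V5 V5 V4 V3 V4 V5 V3 V4 V4 V4 V6 V5 V3 V5 V5 V4 V3 V5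
   V5 V5 V5 V6 V5 V4 V3 V4 V5 V5 V5 V5 V5 V4 V4 V3 V4 V3 V5 V3 V5 V4 V5 V3 V5 V5 V4 V4 V5 U U U U U U U U U
   U) n"
definition "g5_323 n = lookup (row63 V5 V3 V6 V5 V3 V5 V4 V5 V5 V4 V5 V5 V5 V4 V5 V6 V5 V3 V3 V3 V5 V5 V4 V3
   V4 V4 V5 V3 V4 V5 V3 V3 V5 V5 V3 V5 V5 V5 V5 V4 V5 V3 V4 V5 V4 V3 V5 V3 V4 V5 V4 V4 V6 U U U U U U U U U
   U) n"
definition "g5_32 n = branch g5_320 g5_321 g5_322 g5_323 V5 V3 V4 n"
definition "g5_330 n = lookup (row63 V4 V4 V4 V5 V4 V5 V5 V5 V4 V3 V5 V5 V4 V5 V5 V4 V5 V4 V5 V5 V3 V4 V5 V4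
   V5 V4 V3 V3 V4 V4 V6 V4 V5 V5 V4 V5 V5 V4 V4 V4 V5 V5 V4 V3 V4 V4 V3 V3 V4 V5 V4 V5 V4 V4 U U U U U U U U
   U) n"
definition "g5_331 n = lookup (row63 V5 V4 V3 V3 V5 V3 V4 V3 V4 V4 V5 V3 V4 V5 V3 V5 V4 V3 V4 V4 V5 V5 V5 V3
   V4 V3 V4 V6 V4 V4 V3 V5 V4 V3 V3 V4 V3 V4 V5 V3 V5 V5 V4 V5 V4 V4 V4 V5 V5 V5 V5 V4 V4 U U U U U U U U U
   U) n"
definition "g5_332 n = lookup (row63 V5 V3 V6 V4 V5 V5 V4 V3 V5 V5 V5 V3 V3 V5 V3 V5 V5 V3 V5 V3 V4 V3 V5 V4
   V4 V3 V4 V5 V4 V5 V5 V3 V4 V4 V4 V4 V4 V5 V3 V5 V3 V3 V5 V4 V4 V5 V5 V5 V4 V3 V5 V6 V6 U U U U U U U U U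
   U) n"
definition "g5_333 n = lookup (row63 V4 V3 V4 V3 V4 V4 V5 V4 V4 V5 V3 V4 V3 V5 V3 V4 V4 V3 V5 V3 V4 V3 V5 V5
   V5 V6 V4 V4 V5 V4 V5 V4 V4 V3 V5 V4 V4 V4 V3 V5 V4 V3 V3 V5 V5 V3 V3 V4 V5 V6 V3 V5 V4 U U U U U U U U U
   U) n"
definition "g5_33 n = branch g5_330 g5_331 g5_332 g5_333 V4 V3 V5 n"
definition "g5_3 n = branch g5_30 g5_31 g5_32 g5_33 V4 V4 V3 n"
definition "g5 n = branch g5_0 g5_1 g5_2 g5_3 V3 V3 V2 n"

section \<open>Positions and the search for mismatches\<close>

text \<open>Numerals are written in binary with the least significant digit first.\<close>

abbreviation (input) "Z n \<equiv> num.Bit0 n"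
abbreviation (input) "I n \<equiv> num.Bit1 n"

abbreviation (input) "n1 \<equiv> num.One"
abbreviation (input) "n2 \<equiv> Z num.One"
abbreviation (input) "n3 \<equiv> I num.One"
abbreviation (input) "n4 \<equiv> Z (Z num.One)"
abbreviation (input) "n5 \<equiv> I (Z num.One)"
abbreviation (input) "n6 \<equiv> Z (I num.One)"
abbreviation (input) "n7 \<equiv> I (I num.One)"
abbreviation (input) "n8 \<equiv> Z (Z (Z num.One))"
abbreviation (input) "n10 \<equiv> Z (I (Z num.One))"
abbreviation (input) "n11 \<equiv> I (I (Z num.One))"
abbreviation (input) "n12 \<equiv> Z (Z (I num.One))"
abbreviation (input) "n13 \<equiv> I (Z (I num.One))"
abbreviation (input) "n14 \<equiv> Z (I (I num.One))"
abbreviation (input) "n15 \<equiv> I (I (I num.One))"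
abbreviation (input) "n16 \<equiv> Z (Z (Z (Z num.One)))"
abbreviation (input) "n17 \<equiv> I (Z (Z (Z num.One)))"
abbreviation (input) "n18 \<equiv> Z (I (Z (Z num.One)))"
abbreviation (input) "n19 \<equiv> I (I (Z (Z num.One)))"
abbreviation (input) "n20 \<equiv> Z (Z (I (Z num.One)))"
abbreviation (input) "n22 \<equiv> Z (I (I (Z num.One)))"
abbreviation (input) "n23 \<equiv> I (I (I (Z num.One)))"
abbreviation (input) "n24 \<equiv> Z (Z (Z (I num.One)))"
abbreviation (input) "n25 \<equiv> I (Z (Z (I num.One)))"
abbreviation (input) "n26 \<equiv> Z (I (Z (I num.One)))"
abbreviation (input) "n30 \<equiv> Z (I (I (I num.One)))"
abbreviation (input) "n31 \<equiv> I (I (I (I num.One)))"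
abbreviation (input) "n35 \<equiv> I (I (Z (Z (Z num.One))))"
abbreviation (input) "n37 \<equiv> I (Z (I (Z (Z num.One))))"
abbreviation (input) "n40 \<equiv> Z (Z (Z (I (Z num.One))))"
abbreviation (input) "n41 \<equiv> I (Z (Z (I (Z num.One))))"
abbreviation (input) "n46 \<equiv> Z (I (I (I (Z num.One))))"
abbreviation (input) "n47 \<equiv> I (I (I (I (Z num.One))))"
abbreviation (input) "n48 \<equiv> Z (Z (Z (Z (I num.One))))"
abbreviation (input) "n49 \<equiv> I (Z (Z (Z (I num.One))))"
abbreviation (input) "n50 \<equiv> Z (I (Z (Z (I num.One))))"
abbreviation (input) "n56 \<equiv> Z (Z (Z (I (I num.One))))"
abbreviation (input) "n57 \<equiv> I (Z (Z (I (I num.One))))"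
abbreviation (input) "n60 \<equiv> Z (Z (I (I (I num.One))))"
abbreviation (input) "n61 \<equiv> I (Z (I (I (I num.One))))"
abbreviation (input) "n68 \<equiv> Z (Z (I (Z (Z (Z num.One)))))"
abbreviation (input) "n70 \<equiv> Z (I (I (Z (Z (Z num.One)))))"
abbreviation (input) "n75 \<equiv> I (I (Z (I (Z (Z num.One)))))"
abbreviation (input) "n90 \<equiv> Z (I (Z (I (I (Z num.One)))))"
abbreviation (input) "n94 \<equiv> Z (I (I (I (I (Z num.One)))))"
abbreviation (input) "n97 \<equiv> I (Z (Z (Z (Z (I num.One)))))"
abbreviation (input) "n111 \<equiv> I (I (I (I (Z (I num.One)))))"
abbreviation (input) "n120 \<equiv> Z (Z (Z (I (I (I num.One)))))"
abbreviation (input) "n158 \<equiv> Z (I (I (I (I (Z (Z num.One))))))"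
abbreviation (input) "n170 \<equiv> Z (I (Z (I (Z (I (Z num.One))))))"
abbreviation (input) "n200 \<equiv> Z (Z (Z (I (Z (Z (I num.One))))))"
abbreviation (input) "n201 \<equiv> I (Z (Z (I (Z (Z (I num.One))))))"
abbreviation (input) "n282 \<equiv> Z (I (Z (I (I (Z (Z (Z num.One)))))))"
abbreviation (input) "n320 \<equiv> Z (Z (Z (Z (Z (Z (I (Z num.One)))))))"
abbreviation (input) "n843 \<equiv> I (I (Z (I (Z (Z (I (Z (I num.One))))))))"
abbreviation (input) "n1117 \<equiv> I (Z (I (I (I (Z (I (Z (Z (Z num.One)))))))))"
abbreviation (input) "n1128 \<equiv> Z (Z (Z (I (Z (I (I (Z (Z (Z num.One)))))))))"
abbreviation (input) "n1129 \<equiv> I (Z (Z (I (Z (I (I (Z (Z (Z num.One)))))))))"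
abbreviation (input) "n1131 \<equiv> I (I (Z (I (Z (I (I (Z (Z (Z num.One)))))))))"
abbreviation (input) "n1136 \<equiv> Z (Z (Z (Z (I (I (I (Z (Z (Z num.One)))))))))"
abbreviation (input) "n1687 \<equiv> I (I (I (Z (I (Z (Z (I (Z (I num.One)))))))))"
abbreviation (input) "n3361 \<equiv> I (Z (Z (Z (Z (I (Z (Z (I (Z (I num.One))))))))))"
abbreviation (input) "n3372 \<equiv> Z (Z (I (I (Z (I (Z (Z (I (Z (I num.One))))))))))"
abbreviation (input) "n3373 \<equiv> I (Z (I (I (Z (I (Z (Z (I (Z (I num.One))))))))))"
abbreviation (input) "n3473 \<equiv> I (Z (Z (Z (I (Z (Z (I (I (Z (I num.One))))))))))"

lemma nat_of_num_Bit [simp]: "nat_of_num (num.Bit0 n) = 2 * nat_of_num n"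
  "nat_of_num (num.Bit1 n) = 2 * nat_of_num n + 1"
  by simp_all

declare nat_of_num.simps(2,3) [simp del]

fun sval :: "symb \<Rightarrow> nat" where
  "sval V0 = 0" | "sval V1 = 1" | "sval V2 = 2" | "sval V3 = 3" | "sval V4 = 4" | "sval V5 = 5"
| "sval V6 = 6" | "sval V7 = 7" | "sval V8 = 8" | "sval U = 0"

fun differ :: "symb \<Rightarrow> symb \<Rightarrow> bool" where
  "differ U b = False" | "differ a U = False" | "differ a b = (a \<noteq> b)"

lemma differ_iff: "differ a b \<longleftrightarrow> a \<noteq> U \<and> b \<noteq> U \<and> a \<noteq> b"
  by (cases "(a, b)" rule: differ.cases) auto

lemma sval_inj: "a \<noteq> U \<Longrightarrow> b \<noteq> U \<Longrightarrow> sval a = sval b \<longleftrightarrow> a = b"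
  by (cases a; cases b) auto

fun num_pred :: "num \<Rightarrow> num" where
  "num_pred num.One = num.One"
| "num_pred (num.Bit0 num.One) = num.One"
| "num_pred (num.Bit0 (num.Bit0 n)) = num.Bit1 (num_pred (num.Bit0 n))"
| "num_pred (num.Bit0 (num.Bit1 n)) = num.Bit1 (num.Bit0 n)"
| "num_pred (num.Bit1 n) = num.Bit0 n"

lemma nat_of_num_num_pred: "nat_of_num (num_pred n) = (if n = num.One then 1 else nat_of_num n - 1)"
proof (induction n rule: num_pred.induct)
  case (3 n)
  have "nat_of_num n > 0" by (rule nat_of_num_pos)
  with 3 show ?case by simp
qed auto

datatype col = C1 | C3 | C5
type_synonym pos = "col \<times> num"

fun col_ix :: "col \<Rightarrow> nat" where "col_ix C1 = 0" | "col_ix C3 = 1" | "col_ix C5 = 2"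

text \<open>Only odd indices have positions: \<open>pos_ix p\<close> is the number \<open>y\<close>
  for which the letter has index \<open>2 * y + 1\<close>, that is \<open>6 * q + 1\<close>,
  \<open>6 * q + 3\<close> or \<open>6 * q + 5\<close> in block \<open>q\<close>. A shift by
  \<open>4 * m\<close> indices is thus a shift by \<open>2 * m\<close> of
  \<open>pos_ix\<close>.\<close>

definition pos_ix :: "pos \<Rightarrow> nat" where "pos_ix p = 3 * nat_of_num (snd p) + col_ix (fst p)"

fun prev :: "pos \<Rightarrow> pos" where
  "prev (C1, num.One) = (C1, num.One)"
| "prev (C1, q) = (C5, num_pred q)"
| "prev (C3, q) = (C1, q)"
| "prev (C5, q) = (C3, q)"

text \<open>For a period divisible by 6 a shift preserves columns, and column 3 of \<open>h\<close>
  is constant from block 16 on, so stepping from column 5 to column 1 skips no mismatch there.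
  Soundness of a search is unaffected by skipped candidates.\<close>

fun prev_free :: "pos \<Rightarrow> pos" where
  "prev_free (C5, q) = (C1, q)"
| "prev_free p = prev p"

lemma pos_ix_prev: "pos_ix (prev p) = (if p = (C1, num.One) then pos_ix p else pos_ix p - 1)"
proof (cases p rule: prev.cases)
  case ("2_1" v)
  have "nat_of_num v > 0" by (rule nat_of_num_pos)
  then show ?thesis using "2_1" nat_of_num_num_pred[of "num.Bit0 v"] by (simp add: pos_ix_def)
next
  case ("2_2" v)
  then show ?thesis using nat_of_num_pos[of v] by (simp add: pos_ix_def)
qed (auto simp: pos_ix_def)

lemma pos_ix_prev_free: "pos_ix (prev_free p) \<le> pos_ix p"
  by (cases p rule: prev_free.cases) (auto simp: pos_ix_prev, auto simp: pos_ix_def)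

fun next1 :: "pos \<Rightarrow> pos" where
  "next1 (C1, q) = (C3, q)" | "next1 (C3, q) = (C5, q)" | "next1 (C5, q) = (C1, q + num.One)"

fun next2 :: "pos \<Rightarrow> pos" where
  "next2 (C1, q) = (C5, q)" | "next2 (C3, q) = (C1, q + num.One)" | "next2 (C5, q) = (C3, q + num.One)"

lemma pos_ix_next1: "pos_ix (next1 p) = pos_ix p + 1" and pos_ix_next2: "pos_ix (next2 p) = pos_ix p + 2"
  by (cases p rule: next1.cases; simp add: pos_ix_def nat_of_num_add)+

lemma pos_ix_add: "pos_ix (c, q + n) = pos_ix (c, q) + 3 * nat_of_num n"
  by (simp add: pos_ix_def nat_of_num_add)

text \<open>
  A constructor stands for a period \<open>m\<close>: \<open>S1\<close> for \<open>1\<close>, \<open>S2\<close> for \<open>2\<close>, \<open>S4\<close> for \<open>4\<close>, and \<open>A j n\<close>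
  for \<open>6 n + 2 j\<close>. On letters in odd positions it compares a window of length \<open>wlen\<close> with the one that
  lies \<open>2 m\<close> such letters further.
\<close>

datatype period = S1 | S2 | S4 | A0 num | A1 num | A2 num

fun plen :: "period \<Rightarrow> nat" where
  "plen S1 = 1" | "plen S2 = 2" | "plen S4 = 4" | "plen (A0 n) = 6 * nat_of_num n"
| "plen (A1 n) = 6 * nat_of_num n + 2" | "plen (A2 n) = 6 * nat_of_num n + 4"

fun wlen :: "period \<Rightarrow> nat" where
  "wlen S1 = 1" | "wlen S2 = 1" | "wlen S4 = 2" | "wlen (A0 n) = 3 * nat_of_num n"
| "wlen (A1 n) = 3 * nat_of_num n + 1" | "wlen (A2 n) = 3 * nat_of_num n + 2"

lemma wlen_pos: "wlen t > 0" and plen_pos: "plen t > 0"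
  using nat_of_num_pos by (cases t; simp)+

lemma wlen_plen: "t \<noteq> S1 \<Longrightarrow> plen t = 2 * wlen t"
  by (cases t) auto

fun wlen_num :: "period \<Rightarrow> num" where
  "wlen_num S1 = num.One" | "wlen_num S2 = num.One" | "wlen_num S4 = num.Bit0 num.One"
| "wlen_num (A0 n) = n + num.Bit0 n" | "wlen_num (A1 n) = n + num.Bit1 n"
| "wlen_num (A2 n) = n + num.Bit0 (n + num.One)"

lemma wlen_num: "nat_of_num (wlen_num t) = wlen t"
  by (cases t) (auto simp: nat_of_num_add)

fun advance :: "period \<Rightarrow> pos \<Rightarrow> pos" where
  "advance S1 p = next1 p" | "advance S2 p = next1 p" | "advance S4 p = next2 p"
| "advance (A0 n) (c, q) = (c, q + n)"
| "advance (A1 n) (c, q) = next1 (c, q + n)"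
| "advance (A2 n) (c, q) = next2 (c, q + n)"

lemma pos_ix_advance: "pos_ix (advance t p) = pos_ix p + wlen t"
  by (cases "(t, p)" rule: advance.cases) (simp_all add: pos_ix_next1 pos_ix_next2 pos_ix_add)

text \<open>The last two equations express \<open>2 * (6 * n + 2) = 3 * (4 * n + 1) + 1\<close> and
  \<open>2 * (6 * n + 4) = 3 * (4 * n + 2) + 2\<close>.\<close>

fun far :: "period \<Rightarrow> pos \<Rightarrow> pos" where
  "far S1 p = next2 p"
| "far S2 (c, q) = next1 (c, q + num.One)"
| "far S4 (c, q) = next2 (c, q + num.Bit0 num.One)"
| "far (A0 n) (c, q) = (c, q + num.Bit0 (num.Bit0 n))"
| "far (A1 n) (c, q) = next1 (c, q + num.Bit1 (num.Bit0 n))"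
| "far (A2 n) (c, q) = next2 (c, q + num.Bit0 (num.Bit1 n))"

lemma pos_ix_far: "pos_ix (far t p) = pos_ix p + 2 * plen t"
  by (cases "(t, p)" rule: far.cases) (simp_all add: pos_ix_next1 pos_ix_next2 pos_ix_add)

text \<open>
  Searches backwards from \<open>q\<close> for a position satisfying \<open>M\<close>, then continues the search from \<open>j\<close> of
  that position. The position \<open>p\<close> only serves to stop unsuccessful searches.
\<close>

partial_function (option) search ::
  "('p \<Rightarrow> bool) \<Rightarrow> ('p \<Rightarrow> 'p) \<Rightarrow> ('p \<Rightarrow> 'p option) \<Rightarrow> 'p \<Rightarrow> 'p \<Rightarrow> unit option" where
  "search M b j p q =
     (if p = q then None
      else if M q then (case j q of None \<Rightarrow> Some () | Some r \<Rightarrow> search M b j q r)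
      else search M b j p (b q))"
declare search.simps [code]

text \<open>The invariant is that the current position lies below \<open>y + w\<close>. A step back
  preserves it, and so does a jump from a mismatch below \<open>y\<close>, being at most
  \<open>w\<close> long. The search succeeds only at a mismatch from which no jump is made; this one
  lies at \<open>B\<close> or later, hence in the window.\<close>

lemma search_sound:
  assumes "\<And>q r. j q = Some r \<Longrightarrow> pos_pos' r \<le> pos_pos' q + (w::nat)"
    and "\<And>q. j q = None \<Longrightarrow> B \<le> pos_pos' q" and "\<And>q. pos_pos' (b q) \<le> (pos_pos' q :: nat)" and "w > 0"
    and "search M b j p q = Some u" "pos_pos' q < y + w" "y \<le> B"
  shows "\<exists>t. M t \<and> y \<le> pos_pos' t \<and> pos_pos' t < y + w"
proof -
  define P where "P = (\<lambda>((((M', b'), j'), p :: 'a), q) (u :: unit). M' = M \<and> b' = b \<and> j' = j \<longrightarrow>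
    pos_pos' q < y + w \<longrightarrow> (\<exists>t. M t \<and> y \<le> pos_pos' t \<and> pos_pos' t < y + w))"
  have "P ((((M, b), j), p), q) u"
  \<comment> \<open>Induction over successful computations: a result \<open>Some\<close> already
    certifies that the search ended.\<close>
  proof (rule search.raw_induct[OF _ assms(5)])
    fix g M' b' j' p' q' u'
    assume IH: "\<And>M b j p q u. g M b j p q = Some u \<Longrightarrow> P ((((M, b), j), p), q) u"
      and eq: "(if p' = q' then None else if M' q' then case j' q' of None \<Rightarrow> Some () | Some r \<Rightarrow> g M' b' j' q' r
        else g M' b' j' p' (b' q')) = Some u'"
    show "P ((((M', b'), j'), p'), q') u'"
      unfolding P_def
    proof (clarsimp)
      assume *: "M' = M" "b' = b" "j' = j" "pos_pos' q' < y + w"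
      show "\<exists>t. M t \<and> y \<le> pos_pos' t \<and> pos_pos' t < y + w"
      proof (cases "M q'")
        case M: True
        then show ?thesis
        proof (cases "y \<le> pos_pos' q'")
          case True
          with M * show ?thesis by blast
        next
          case False
          then obtain r where r: "j q' = Some r" using assms(2)[of q'] assms(7) by (cases "j q'") auto
          with eq M * have "g M b j q' r = Some u'" by (auto split: if_splits)
          from IH[OF this] assms(1)[OF r] False show ?thesis by (auto simp: P_def)
        qed
      next
        case False
        with eq * have "g M b j p' (b q') = Some u'" by (auto split: if_splits)
        from IH[OF this] assms(3)[of q'] * show ?thesis by (auto simp: P_def)
      qed
    qed
  qed
  with assms(6) show ?thesis by (simp add: P_def)
qed

text \<open>\<open>None\<close> signals that the range to be covered is exhausted. The cap at
  \<open>(C5, Q)\<close> keeps the search inside the range of the tables; it is sound because a jump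
  may always be shortened.\<close>

definition jump :: "num \<Rightarrow> (pos \<Rightarrow> pos) \<Rightarrow> pos \<Rightarrow> pos option" where
  "jump Q g p =
    (if snd p < Q then (let r = g p in if Q < snd r then Some (C5, Q) else Some r) else None)"

lemma jump_Some:
  assumes "jump Q g p = Some r"
  shows "pos_ix r \<le> pos_ix (g p)"
  using assms unfolding jump_def Let_def pos_ix_def less_num_def
  by (cases "fst (g p)") (auto split: if_splits)

lemma jump_None:
  assumes "jump Q g p = None"
  shows "3 * nat_of_num Q \<le> pos_ix p"
  using assms by (auto simp: jump_def Let_def pos_ix_def less_num_def split: if_splits)

definition mismatch :: "(pos \<Rightarrow> symb) \<Rightarrow> period \<Rightarrow> pos \<Rightarrow> bool" where
  "mismatch D t p = differ (D p) (D (far t p))"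

definition gap_free :: "(pos \<Rightarrow> symb) \<Rightarrow> (pos \<Rightarrow> pos) \<Rightarrow> num \<Rightarrow> pos \<Rightarrow> pos \<Rightarrow> period \<Rightarrow> bool" where
  "gap_free D b Q p q t = (search (mismatch D t) b (jump Q (advance t)) p q = Some ())"

lemma gap_free_sound:
  assumes "gap_free D b Q p q t" "\<And>q. pos_ix (b q) \<le> pos_ix q" "pos_ix q < y + wlen t" "y \<le> 3 * nat_of_num Q"
  shows "\<exists>s. mismatch D t s \<and> y \<le> pos_ix s \<and> pos_ix s < y + wlen t"
  by (rule search_sound[OF _ _ _ wlen_pos assms(1)[unfolded gap_free_def], where B = "3 * nat_of_num Q"])
    (use assms jump_None jump_Some in \<open>auto simp flip: pos_ix_advance\<close>)

partial_function (option) all_between :: "(num \<Rightarrow> bool) \<Rightarrow> num \<Rightarrow> num \<Rightarrow> unit option" where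
  "all_between P a b = (if P a then (if a = b then Some () else all_between P (a + num.One) b) else None)"
declare all_between.simps [code]

lemma all_between_sound:
  assumes "all_between P a b = Some u" "a \<le> n" "n \<le> b"
  shows "P n"
proof -
  define R where "R = (\<lambda>((P', a), b) (u :: unit). P' = P \<and> a \<le> n \<and> n \<le> b \<longrightarrow> P n)"
  have "R ((P, a), b) u"
  proof (rule all_between.raw_induct[OF _ assms(1)])
    fix g P' a' b' u'
    assume IH: "\<And>P a b u. g P a b = Some u \<Longrightarrow> R ((P, a), b) u"
      and eq: "(if P' a' then if a' = b' then Some () else g P' (a' + num.One) b' else None) = Some u'"
    show "R ((P', a'), b') u'"
      unfolding R_def
    proof clarsimp
      assume *: "P' = P" "a' \<le> n" "n \<le> b'"
      show "P n"
      proof (cases "n = a'")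
        case True
        with eq * show ?thesis by (auto split: if_splits)
      next
        case False
        then have "a' \<noteq> b'" using * by auto
        with eq * have "g P (a' + num.One) b' = Some u'" by (auto split: if_splits)
        moreover have "nat_of_num a' \<noteq> nat_of_num n" using False by (simp add: num_eq_iff)
        then have "a' + num.One \<le> n" using * by (simp add: less_eq_num_def nat_of_num_add)
        ultimately show ?thesis using IH * by (auto simp: R_def)
      qed
    qed
  qed
  with assms(2,3) show ?thesis by (simp add: R_def)
qed

section \<open>Executable certificates\<close>

fun wsym :: "pos \<Rightarrow> symb" where
  "wsym (C1, q) = (if q < n1129 then w1 q else V1)"
| "wsym (C3, q) = (if q < n320 then w3 q else V0)"
| "wsym (C5, q) = (if q < n1687 then w5 q else U)"

fun gsym :: "pos \<Rightarrow> symb" where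
  "gsym (C1, q) = (if q < n3373 then g1 q else V3)"
| "gsym (C3, q) = (if q < n16 then g3 q else V2)"
| "gsym (C5, q) = (if q < n3473 then g5 q else U)"

text \<open>Block \<open>x + 1117\<close> of the least word ends in the letter of \<open>h\<close>
  with index \<open>x\<close>. Hence \<open>w5\<close> doubles as a table of \<open>h\<close> at
  consecutive indices, even ones included, up to index 569.\<close>

definition gscal :: "num \<Rightarrow> symb" where
  "gscal x = (if x < n11 then U else w5 (x + n1117))"

definition same :: "symb \<Rightarrow> symb \<Rightarrow> bool" where
  "same a b = (if a = U then False else a = b)"

text \<open>
  Conditionals replace conjunctions, since the simplifier evaluates both arguments of a conjunction and
  would unfold the recursion without end.
\<close>

function agree :: "('p \<Rightarrow> symb) \<Rightarrow> ('p \<Rightarrow> 'p) \<Rightarrow> ('p \<Rightarrow> bool) \<Rightarrow> 'p \<Rightarrow> 'p \<Rightarrow> num \<Rightarrow> bool" where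
  "agree D b g p s k =
     (if k = num.One then True
      else let p' = b p; s' = b s in
        if same (D p') (D s') then if g s' then agree D b g p' s' (num_pred k) else False else False)"
  by pat_completeness auto
termination
proof (relation "measure (\<lambda>(D, b, g, p, s, k). nat_of_num k)", goal_cases)
  case (2 D b g p s k p' s')
  then show ?case using nat_of_num_pos[of k]
    by (auto simp: nat_of_num_num_pred num_eq_iff)
qed auto

text \<open>\<open>u\<close> merely proposes the letter one shift before \<open>y\<close>, and the
  test \<open>h s = y\<close> certifies the proposal. The guard \<open>g\<close> confines the
  earlier occurrence to a region where it may be used.\<close>

definition repeats :: "('p \<Rightarrow> symb) \<Rightarrow> ('p \<Rightarrow> 'p) \<Rightarrow> ('p \<Rightarrow> bool) \<Rightarrow> ('p \<Rightarrow> 'p) \<Rightarrow> ('p \<Rightarrow> 'p) \<Rightarrow> num \<Rightarrow>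
    'p \<Rightarrow> symb \<Rightarrow> bool" where
  "repeats D b g h u k y c =
     (let s = u y in
      if h s = y then if D s = c then if g s then agree D b g y s k else False else False else False)"

text \<open>Only meaningful if \<open>b < a\<close>. Every use is validated by an addition.\<close>

fun num_minus :: "num \<Rightarrow> num \<Rightarrow> num" where
  "num_minus num.One b = num.One"
| "num_minus a num.One = num_pred a"
| "num_minus (num.Bit0 a) (num.Bit0 b) = num.Bit0 (num_minus a b)"
| "num_minus (num.Bit1 a) (num.Bit1 b) = num.Bit0 (num_minus a b)"
| "num_minus (num.Bit1 a) (num.Bit0 b) = (if a = b then num.One else num.Bit1 (num_minus a b))"
| "num_minus (num.Bit0 a) (num.Bit1 b) = num_pred (num.Bit0 (num_minus a b))"

fun pos_minus :: "num \<Rightarrow> pos \<Rightarrow> pos" where "pos_minus n (c, q) = (c, num_minus q n)"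

fun unfar :: "period \<Rightarrow> pos \<Rightarrow> pos" where
  "unfar S1 p = prev (prev p)"
| "unfar S2 p = pos_minus num.One (prev p)"
| "unfar S4 p = pos_minus (num.Bit0 num.One) (prev (prev p))"
| "unfar (A0 n) p = pos_minus (num.Bit0 (num.Bit0 n)) p"
| "unfar (A1 n) p = pos_minus (num.Bit1 (num.Bit0 n)) (prev p)"
| "unfar (A2 n) p = pos_minus (num.Bit0 (num.Bit1 n)) (prev (prev p))"

fun below :: "symb \<Rightarrow> symb list" where
  "below V0 = []" | "below V1 = [V0]" | "below V2 = [V1, V0]" | "below V3 = [V2, V1, V0]"
| "below V4 = [V3, V2, V1, V0]" | "below V5 = [V4, V3, V2, V1, V0]" | "below V6 = [V5, V4, V3, V2, V1, V0]"
| "below V7 = [V6, V5, V4, V3, V2, V1, V0]" | "below V8 = [V7, V6, V5, V4, V3, V2, V1, V0]" | "below U = []"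

text \<open>The letters 0 and 1 do not occur in \<open>h\<close>; as smaller letters at the end of a
  block of the least word they are excluded by columns 3 and 1, in
  \<open>W_lower_last\<close>.\<close>

fun below2 :: "symb \<Rightarrow> symb list" where
  "below2 V3 = [V2]" | "below2 V4 = [V3, V2]" | "below2 V5 = [V4, V3, V2]" | "below2 V6 = [V5, V4, V3, V2]"
| "below2 V7 = [V6, V5, V4, V3, V2]" | "below2 V8 = [V7, V6, V5, V4, V3, V2]" | "below2 x = []"

text \<open>The letter 2 is excluded by column 3 of \<open>h\<close> itself, in
  \<open>G_lower\<close>.\<close>

fun below3 :: "symb \<Rightarrow> symb list" where
  "below3 V4 = [V3]" | "below3 V5 = [V4, V3]" | "below3 V6 = [V5, V4, V3]"
| "below3 V7 = [V6, V5, V4, V3]" | "below3 V8 = [V7, V6, V5, V4, V3]" | "below3 x = []"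

fun some_in :: "('b \<Rightarrow> bool) \<Rightarrow> 'b list \<Rightarrow> bool" where
  "some_in P [] = False" | "some_in P (x # xs) = (if P x then True else some_in P xs)"

fun each_in :: "('b \<Rightarrow> bool) \<Rightarrow> 'b list \<Rightarrow> bool" where
  "each_in P [] = True" | "each_in P (x # xs) = (if P x then each_in P xs else False)"

text \<open>The lists only propose periods. Each power is checked letter by letter, so soundness
  does not depend on where they come from.\<close>

definition periods_W :: "period list" where "periods_W = [S1, S2, A0 n1, A0 n2, A0 n3, A0 n4, A0 n5, A0
      n6, A0 n10, A0 n16, A2 n16, A0 n20, A0 n23, A0 n24, A0 n35, A2 n40, A0 n41, A0 n61, A2 n158]"
definition periods_G :: "period list" where "periods_G = [S1, S2, A0 n1, A0 n2, A0 n4, A0 n3, A0 n5, A0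
      n6, A0 n7, A0 n11, A0 n14, A0 n19, A0 n20, A0 n22, A0 n23, A0 n24, A0 n25, A0 n26, A0 n30, A0 n31,
      A0 n37, A0 n46, A0 n47, A0 n48, A0 n49, A0 n50, A0 n56, A0 n57, A0 n60, A0 n61, A0 n68, A0 n70, A0
      n75, A0 n170]"

definition okW where
   "okW B y = each_in (\<lambda>c. some_in (\<lambda>t. repeats wsym prev (\<lambda>s. True) (far t) (unfar t) (wlen_num t) y c)
      periods_W) (B (wsym y))"
text \<open>Block 17 begins at index 102, past the irregular even indices below 98. There the even
  letters repeat by themselves and the comparison of odd letters decides.\<close>

definition okG where
   "okG y = each_in (\<lambda>c. some_in (\<lambda>t. repeats gsym prev (\<lambda>s. n17 \<le> snd s) (far t) (unfar t) (wlen_num t)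
      y c) periods_G) (below3 (gsym y))"
text \<open>Near its beginning \<open>h\<close> is irregular at even indices too, so every index is
  compared here. The guard 12 keeps the virtual letter at index 11 out of the power.\<close>

definition okS where
   "okS x = each_in (\<lambda>c. some_in (\<lambda>m. repeats gscal num_pred (\<lambda>s. n12 \<le> s) (\<lambda>s. s + num.Bit0 (num.Bit0
      m)) (\<lambda>s. num_minus s (num.Bit0 (num.Bit0 m))) m x c)
     [n1, n2, n3, n5, n6, n12, n24]) (below2 (gscal x))"

definition "okW_block q = each_in (\<lambda>c. okW below (c, q)) [C1, C3, C5]"
definition "okG_block q = each_in (\<lambda>c. okG (c, q)) [C1, C5]"

definition "jump_scal n m x = (if x < n then Some (x + m) else (None :: num option))"
text \<open>The chain begins at \<open>10 + m\<close>, the last index of the window that starts at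
  11, and covers all starts up to 97.\<close>

definition "gap_free_scal m = (search (\<lambda>x. differ (gscal x) (gscal (x + num.Bit0 (num.Bit0 m))))
      num_pred (jump_scal n97 m) n10 (n10 + m) = Some ())"

text \<open>\<open>r\<close> imitates the effect of the shift on the column only. Once the shifted
  window lies in the tail, the column determines the letter wherever \<open>T\<close> is specified,
  so a single chain with windows of \<open>3 * n\<close> positions serves all longer periods of the
  same residue modulo 6.\<close>

definition gap_free_tail :: "(pos \<Rightarrow> symb) \<Rightarrow> (col \<Rightarrow> symb) \<Rightarrow> (pos \<Rightarrow> pos) \<Rightarrow> num \<Rightarrow> num \<Rightarrow> bool" where
   "gap_free_tail D T r Q n = (search (\<lambda>p. differ (D p) (T (fst (r p)))) prev (jump Q (advance (A0 n)))
      (C3, num.One) (C3, n + num.One) = Some ())"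
fun tail_W where "tail_W C1 = V1" | "tail_W C3 = V0" | "tail_W C5 = U"
fun tail_G where "tail_G C1 = V3" | "tail_G C3 = V2" | "tail_G C5 = U"

text \<open>In the chains for all starts from 10 or 11 on, the search begins inside the window at
  \<open>y = 5\<close>, the value of \<open>i div 2\<close> for these starts. The last position of
  this window is \<open>3 * n + 4\<close> for the period \<open>6 * n\<close>. The chains
  \<open>gaps_Gs\<close> begin instead at \<open>y = 49\<close>, for starts from 98 on.\<close>

definition "gaps_W0 n = gap_free wsym prev n1128 (C3, num.One) (C3, n + num.One) (A0 n)"
definition "gaps_W1 n = gap_free wsym prev n1128 (C3, num.One) (C5, n + num.One) (A1 n)"
definition "gaps_W2 n = gap_free wsym prev n1128 (C3, num.One) (C5, n + num.One) (A2 n)"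
definition "gaps_Ws t = gap_free wsym prev n1128 (C3, num.One) (C5, num.One) t"
definition "gaps_G n = gap_free gsym prev_free n3372 (C1, num.One) (C3, n + num.One) (A0 n)"
definition "gaps_Gs t = gap_free gsym prev n3372 (C1, n16) (C3, n16) t"

fun pos_num :: "pos \<Rightarrow> num" where
   "pos_num (C1, q) = q + num.Bit0 q" | "pos_num (C3, q) = q + num.Bit1 q" | "pos_num (C5, q) = q +
      num.Bit0 (q + num.One)"

fun ge2 where "ge2 V0 = False" | "ge2 V1 = False" | "ge2 U = False" | "ge2 x = True"
fun ge3 where "ge3 V0 = False" | "ge3 V1 = False" | "ge3 V2 = False" | "ge3 U = False" | "ge3 x = True"

fun add2 :: "symb \<Rightarrow> symb" where
  "add2 V0 = V2" | "add2 V1 = V3" | "add2 V2 = V4" | "add2 V3 = V5" | "add2 V4 = V6"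
| "add2 V5 = V7" | "add2 V6 = V8" | "add2 x = U"

text \<open>Some letters of \<open>h\<close> are stored twice. The three \<open>lit\<close> checks
  reconcile \<open>gscal\<close> with the column tables at odd indices, with the pattern of period 8
  at even indices from 98 on, and with the entries of \<open>g5\<close> that reach into the tail,
  where block \<open>x + 3361\<close> ends in letter \<open>x\<close> plus 2.\<close>

definition "lit_odd q = each_in (\<lambda>c. gscal (num.Bit1 (pos_num (c, q))) = gsym (c, q)) [C1, C3, C5]"
definition "lit_even b = (let n = num.Bit0 (num.Bit0 (num.Bit0 b)) in
  each_in (\<lambda>(k, v). gscal (n + k) = v) [(n2, V3), (n4, V3), (n6, V2), (n8, V2)])"
definition "lit_tail x = (let a = add2 (gscal x) in if a = U then False else g5 (x + n3361) = a)"
definition "cols_ge2 q = each_in (\<lambda>c. ge2 (gsym (c, q))) [C1, C3, C5]"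
definition "cols_ge3 q = each_in (\<lambda>c. ge3 (gsym (c, q))) [C1, C5]"

section \<open>Evaluation of the certificates\<close>

lemma lit_odd_all_between: "all_between lit_odd n2 n94 = Some ()" by code_simp
lemma lit_even_all_between: "all_between lit_even n12 n70 = Some ()" by code_simp
lemma lit_tail_all_between: "all_between lit_tail n12 n111 = Some ()" by code_simp
lemma cols_ge2_all_between: "all_between cols_ge2 n2 n15 = Some ()" by code_simp
lemma cols_ge3_all_between: "all_between cols_ge3 n16 n3372 = Some ()" by code_simp
lemma gscal_ge2_all_between: "all_between (\<lambda>x. ge2 (gscal x)) n11 n97 = Some ()" by code_simp
text \<open>The virtual letter 3 at index 11 makes the last block before each tail conform to it:
  block 1128 of the least word ends in \<open>3\<close>, block 3372 of \<open>h\<close> in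
  \<open>5 = 3 + 2\<close>.\<close>

lemma junctions:
  "wsym (C1, num.One) = U" "gsym (C1, num.One) = U" "gsym (C5, num.One) = V3" "wsym (C5, num.One) = V0"
  "gscal n11 = V3" "wsym (C5, n1128) = V3" "gsym (C5, n3372) = V5"
  by code_simp+

section \<open>Chains of mismatches in the least word\<close>

text \<open>282 is the least \<open>n\<close> with \<open>3 * 1129 <= 5 + 12 * n\<close>: from this
  period on, every shifted window lies in the tail and \<open>gaps_Wt\<close> takes over.\<close>

lemma gaps_W0_all_between: "all_between gaps_W0 n1 n282 = Some ()" by code_simp
lemma gaps_W1_all_between: "all_between gaps_W1 n1 n282 = Some ()" by code_simp
lemma gaps_W2_all_between: "all_between gaps_W2 n1 n282 = Some ()" by code_simp
lemma gaps_Ws: "gaps_Ws S1" "gaps_Ws S2" "gaps_Ws S4" by code_simp+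
lemma gaps_Wt: "gap_free_tail wsym tail_W (\<lambda>x. x) n1128 n282" "gap_free_tail wsym tail_W next1 n1128
      n282" "gap_free_tail wsym tail_W next2 n1128 n282"
  by code_simp+

section \<open>Chains of mismatches in \<open>h\<close>\<close>

text \<open>A power of period at most 90 that starts at 97 or earlier ends at
  \<open>97 + 5 * 90 - 1 = 546\<close> or earlier, within the range of \<open>gscal\<close>. Windows
  of longer periods reach past index 97 into the regular part.\<close>

lemma gap_free_scal_all_between: "all_between gap_free_scal n1 n90 = Some ()" by code_simp
lemma gaps_Gs1: "gaps_Gs S1" by code_simp
lemma gaps_Gs2: "gaps_Gs S2" by code_simp
text \<open>Period 6 is searched for starts from 98 on; earlier starts fall to
  \<open>gap_free_scal_all_between\<close>, which also compares even letters.\<close>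

lemma gaps_G1: "gap_free gsym prev_free n3372 (C1, n16) (C1, n17) (A0 num.One)" by code_simp
lemma gaps_G_run1: "all_between gaps_G n2 n30 = Some ()" by code_simp
lemma gaps_G_run2: "all_between gaps_G n31 n200 = Some ()" by code_simp
lemma gaps_G_run3: "all_between gaps_G n201 n843 = Some ()" by code_simp
text \<open>843 is the least \<open>n\<close> with \<open>3 * 3373 <= 5 + 12 * n\<close>. Only
  periods divisible by 6 reach this point, so the column is unchanged by the shift.\<close>

lemma gaps_Gt: "gap_free_tail gsym tail_G (\<lambda>x. x) n3372 n843" by code_simp

section \<open>Powers completed by smaller letters\<close>

lemma okW_all_between: "all_between okW_block n2 n1128 = Some ()" by code_simp
lemma okW_special: "okW below (C5, n1129)" "okW below (C5, n1131)" "okW below (C5, n1136)" by code_simp+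
lemma okS_all_between: "all_between okS n13 n13 = Some ()" "all_between okS n15 n18 = Some ()"
      "all_between okS n20 n120 = Some ()"
  by code_simp+
lemma okG_all_between: "all_between okG_block n20 n3372 = Some ()" by code_simp

section \<open>The two words\<close>

lemma odd_mod_6: "odd x \<Longrightarrow> x mod 6 = 1 \<or> x mod 6 = 3 \<or> x mod 6 = 5" for x :: nat
proof -
  assume "odd x"
  then have "odd (x mod 6)" by (simp add: dvd_mod_iff)
  moreover have "x mod 6 < 6" by simp
  then have "x mod 6 \<in> {0, 1, 2, 3, 4, 5}" by auto
  ultimately show ?thesis by auto
qed

lemma even_mod_8: "even x \<Longrightarrow> x mod 8 = 0 \<or> x mod 8 = 2 \<or> x mod 8 = 4 \<or> x mod 8 = 6" for x :: nat
proof -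
  assume "even x"
  then have "even (x mod 8)" by (simp add: dvd_mod_iff)
  moreover have "x mod 8 < 8" by simp
  then have "x mod 8 \<in> {0, 1, 2, 3, 4, 5, 6, 7}" by auto
  ultimately show ?thesis by auto
qed

lemma even_mod_6: "even x \<Longrightarrow> x mod 6 = 0 \<or> x mod 6 = 2 \<or> x mod 6 = 4" for x :: nat
proof -
  assume "even x"
  then have "even (x mod 6)" by (simp add: dvd_mod_iff)
  moreover have "x mod 6 < 6" by simp
  then have "x mod 6 \<in> {0, 1, 2, 3, 4, 5}" by auto
  ultimately show ?thesis by auto
qed

lemma six_dvdI: "even m \<Longrightarrow> 3 dvd m \<Longrightarrow> 6 dvd m" for m :: nat
  by (auto simp: dvd_def) presburger

lemma three_dvd_mult: "3 dvd 4 * m \<Longrightarrow> 3 dvd m" for m :: nat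
  by presburger

lemma half_bounds: "2 * (i div 2) \<le> i" "i \<le> 2 * (i div 2) + 1" for i :: nat
  by simp_all

lemma shift_mod_3: "m mod 6 = (2 * d) mod 6 \<Longrightarrow> (y + 2 * m) mod 3 = (y + d) mod 3" for m :: nat
proof -
  assume "m mod 6 = (2 * d) mod 6"
  then have "m mod 6 mod 3 = (2 * d) mod 6 mod 3" by simp
  then have "m mod 3 = (2 * d) mod 3" by (simp add: mod_mod_cancel)
  then have "(y + 2 * m) mod 3 = (y + 2 * (2 * d)) mod 3" by (intro mod_add_cong mod_mult_cong) simp_all
  also have "y + 2 * (2 * d) = (y + d) + 3 * d" by simp
  also have "\<dots> mod 3 = (y + d) mod 3" by (rule mod_mult_self2)
  finally show ?thesis .
qed

definition power_at :: "(nat \<Rightarrow> 'a) \<Rightarrow> nat \<Rightarrow> nat \<Rightarrow> bool" where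
  "power_at f i m \<longleftrightarrow> 1 \<le> m \<and> (\<forall>j<m. f (i + j) = f (i + 4 * m + j))"

text \<open>Writing \<open>c\<close> at index \<open>x\<close> would complete a power of period
  \<open>m\<close> that starts at \<open>l\<close> or later. The letter \<open>f x\<close> itself
  does not enter, so the notion applies to letters other than the actual one.\<close>

definition forced :: "(nat \<Rightarrow> nat) \<Rightarrow> nat \<Rightarrow> nat \<Rightarrow> nat \<Rightarrow> bool" where
  "forced f l x c \<longleftrightarrow> (\<exists>m\<ge>1. l + 5 * m \<le> x + 1 \<and> f (x - 4 * m) = c \<and>
     (\<forall>j\<ge>1. j < m \<longrightarrow> f (x - j) = f (x - 4 * m - j)))"

lemma forced_mono: "forced f l x c \<Longrightarrow> l' \<le> l \<Longrightarrow> forced f l' x c"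
  unfolding forced_def using add_le_mono1 le_trans by blast

definition pos_of :: "nat \<Rightarrow> pos" where
  "pos_of y = (if y mod 3 = 0 then C1 else if y mod 3 = 1 then C3 else C5, num_of_nat (y div 3))"

lemma pos_ix_pos_of: "3 \<le> y \<Longrightarrow> pos_ix (pos_of y) = y"
proof -
  assume "3 \<le> y"
  then have "nat_of_num (num_of_nat (y div 3)) = y div 3" by (intro num_of_nat_inverse) auto
  moreover have "y mod 3 = 0 \<or> y mod 3 = 1 \<or> y mod 3 = 2" by linarith
  moreover have "y = 3 * (y div 3) + y mod 3" by simp
  ultimately show ?thesis unfolding pos_of_def pos_ix_def by (elim disjE) simp_all
qed

lemma col_ix_less: "col_ix c < 3" by (cases c) simp_all
lemma pos_ix_div: "pos_ix r div 3 = nat_of_num (snd r)" and pos_ix_mod: "pos_ix r mod 3 = col_ix (fst r)"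
  unfolding pos_ix_def using col_ix_less[of "fst r"] by (simp_all del: col_ix.simps)

lemma pos_ix_inj: "pos_ix p = pos_ix q \<longleftrightarrow> p = q"
proof
  assume eq: "pos_ix p = pos_ix q"
  have "snd p = snd q" using eq pos_ix_div[of p] pos_ix_div[of q] by (simp add: num_eq_iff)
  moreover have "col_ix (fst p) = col_ix (fst q)" using eq pos_ix_mod[of p] pos_ix_mod[of q] by simp
  then have "fst p = fst q" by (cases "fst p"; cases "fst q") simp_all
  ultimately show "p = q" by (simp add: prod_eq_iff)
qed simp

lemma pos_of_pos_ix: "pos_of (pos_ix p) = p"
proof -
  have "3 \<le> pos_ix p" using nat_of_num_pos[of "snd p"] by (simp add: pos_ix_def)
  then show ?thesis using pos_ix_pos_of pos_ix_inj by blast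
qed

lemma pos_num: "nat_of_num (pos_num p) = pos_ix p"
  by (cases p rule: pos_num.cases) (simp_all add: pos_ix_def nat_of_num_add)

text \<open>Index \<open>x\<close> belongs to the letter \<open>x - 12\<close> of \<open>s\<close>,
  whose subscript is \<open>x + 6\<close> modulo 8. In images under \<open>phi\<close> the even
  subscripts 0 and 2 carry the letter 0, with last entry 3, and 4 and 6 carry 1, with last entry 2;
  this is the rule at even indices. In the odd columns of the tail, column 1 always carries 1, with
  last entry 3, and column 3 always 0, with last entry 2.\<close>

function gword :: "nat \<Rightarrow> nat" where
  "gword x = (if even x then
       (if x < 98 then sval (gscal (num_of_nat x)) else if (x + 6) mod 8 < 4 then 3 else 2)
     else let y = x div 2 in
       if y < 10119 then sval (gsym (pos_of y))
       else if y mod 3 = 0 then 3 else if y mod 3 = 1 then 2 else gword (y div 3 - 3361) + 2)"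
  by auto
termination
proof (relation "measure id", goal_cases)
  case (2 x y)
  have "0 < x" using \<open>odd x\<close> by (cases x) simp_all
  have "y div 3 - 3361 \<le> y div 3" by (rule diff_le_self)
  also have "y div 3 \<le> y" by (rule div_le_dividend)
  also have "y < x" unfolding \<open>y = x div 2\<close> using \<open>0 < x\<close> by (rule div_less_dividend[rotated]) simp
  finally show ?case by (simp only: in_measure id_apply)
qed simp
declare gword.simps [simp del]

definition wword :: "nat \<Rightarrow> nat" where
  "wword x = (if even x then (if (x + 6) mod 8 < 4 then 0 else 1)
     else let y = x div 2 in
       if y < 3387 then sval (wsym (pos_of y))
       else if y mod 3 = 0 then 1 else if y mod 3 = 1 then 0 else gword (y div 3 - 1117))"

lemma gword_odd: "gword (2 * y + 1) = (if y < 10119 then sval (gsym (pos_of y))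
    else if y mod 3 = 0 then 3 else if y mod 3 = 1 then 2 else gword (y div 3 - 3361) + 2)"
  by (subst gword.simps) simp

lemma gword_even: "even x \<Longrightarrow> 98 \<le> x \<Longrightarrow> gword x = (if (x + 6) mod 8 < 4 then 3 else 2)"
  by (subst gword.simps) simp

lemma wword_odd: "wword (2 * y + 1) = (if y < 3387 then sval (wsym (pos_of y))
    else if y mod 3 = 0 then 1 else if y mod 3 = 1 then 0 else gword (y div 3 - 1117))"
  by (simp add: wword_def)

lemma wword_even: "even x \<Longrightarrow> wword x = (if (x + 6) mod 8 < 4 then 0 else 1)"
  by (simp add: wword_def)

lemma each_in_iff: "each_in P xs \<longleftrightarrow> (\<forall>x\<in>set xs. P x)" by (induction xs) auto
lemma some_in_iff: "some_in P xs \<longleftrightarrow> (\<exists>x\<in>set xs. P x)" by (induction xs) auto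

lemma all_between_nat:
  assumes "all_between P a b = Some u" "nat_of_num a \<le> n" "n \<le> nat_of_num b"
  shows "P (num_of_nat n)"
proof (rule all_between_sound[OF assms(1)])
  have "n > 0" using assms(2) nat_of_num_pos[of a] by linarith
  then show "a \<le> num_of_nat n" "num_of_nat n \<le> b"
    using assms by (simp_all add: less_eq_num_def num_of_nat_inverse)
qed

lemma gscal_gword_even:
  assumes "98 \<le> x" "x \<le> 568" "even x"
  shows "gscal (num_of_nat x) = (if (x + 6) mod 8 < 4 then V3 else V2)"
proof -
  define b where "b = (x - 2) div 8"
  define k where "k = x - 8 * b"
  have b: "12 \<le> b" "b \<le> 70" using assms by (auto simp: b_def)
  define e where "e = (x - 2) mod 8"
  have "x - 2 = 8 * b + e" by (simp add: b_def e_def)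
  then have "x = 8 * b + (e + 2)" using assms(1) by simp
  moreover have "e = 0 \<or> e = 2 \<or> e = 4 \<or> e = 6" unfolding e_def by (rule even_mod_8) (use assms in simp)
  ultimately have "x = 8 * b + 2 \<or> x = 8 * b + 4 \<or> x = 8 * b + 6 \<or> x = 8 * b + 8" by auto
  then have k: "k \<in> {2, 4, 6, 8}" "x = 8 * b + k" by (auto simp: k_def)
  define n where "n = num.Bit0 (num.Bit0 (num.Bit0 (num_of_nat b)))"
  have n: "nat_of_num n = 8 * b" using b by (simp add: n_def num_of_nat_inverse)
  have "lit_even (num_of_nat b)" by (rule all_between_nat[OF lit_even_all_between]) (use b in auto)
  then have K: "gscal (n + n2) = V3" "gscal (n + n4) = V3" "gscal (n + n6) = V2" "gscal (n + n8) = V2"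
    by (auto simp: lit_even_def each_in_iff n_def Let_def)
  have *: "num_of_nat x = n + j" if "nat_of_num j = k" for j
    using that k n by (metis nat_of_num_add nat_of_num_inverse)
  from k(1) consider "k = 2" | "k = 4" | "k = 6" | "k = 8" by blast
  then show ?thesis
  proof cases
    case 1 then show ?thesis using *[of "n2"] K k(2) by simp
  next
    case 2 
    then have "(x + 6) mod 8 = 2" using k(2) by presburger
    then show ?thesis using 2 *[of "n4"] K k(2) by simp
  next
    case 3
    then have "(x + 6) mod 8 = 4" using k(2) by presburger
    then show ?thesis using 3 *[of "n6"] K k(2) by simp
  next
    case 4
    then have "(x + 6) mod 8 = 6" using k(2) by presburger
    then show ?thesis using 4 *[of "n8"] K k(2) by simp
  qed
qed

lemma gscal_gword:
  assumes "11 \<le> x" "x \<le> 569"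
  shows "sval (gscal (num_of_nat x)) = gword x"
proof (cases "even x")
  case True
  show ?thesis
  proof (cases "x < 98")
    case True
    with \<open>even x\<close> show ?thesis by (subst gword.simps) simp
  next
    case False
    moreover have "x \<le> 568" using \<open>even x\<close> assms by presburger
    ultimately show ?thesis using gscal_gword_even[of x] gword_even[of x] \<open>even x\<close> by simp
  qed
next
  case False
  define y where "y = x div 2"
  have x: "x = 2 * y + 1" using False by (simp add: y_def)
  with assms have y: "5 \<le> y" "y \<le> 284" by auto
  obtain c q where p: "pos_of y = (c, q)" by fastforce
  have ip: "pos_ix (c, q) = y" using pos_ix_pos_of[of y] p y by simp
  have n: "num_of_nat x = num.Bit1 (pos_num (c, q))"
    using pos_num[of "(c, q)"] ip x by (metis nat_of_num.simps(3) nat_of_num_inverse Suc_eq_plus1 mult_2)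
  have "gscal (num_of_nat x) = gsym (c, q)"
  \<comment> \<open>Index 11, the virtual letter, lies in block 1, where
    \<open>lit_odd_all_between\<close> does not apply.\<close>
  proof (cases "y = 5")
    case True
    then have "pos_ix (c, q) = pos_ix (C5, num.One)" using ip by (simp add: pos_ix_def)
    then have "(c, q) = (C5, num.One)" using pos_ix_inj by blast
    then show ?thesis using junctions(3,5) n by simp
  next
    case False
    have "col_ix c \<le> 2" by (cases c) auto
    then have "2 \<le> nat_of_num q" "nat_of_num q \<le> 94" using ip y False by (auto simp: pos_ix_def)
    then have "lit_odd (num_of_nat (nat_of_num q))" by (intro all_between_nat[OF lit_odd_all_between]) auto
    then have "lit_odd q" by (simp add: nat_of_num_inverse)
    then show ?thesis unfolding n lit_odd_def each_in_iff by (cases c) auto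
  qed
  then show ?thesis using gword_odd[of y] x y p by simp
qed

section \<open>Words with a periodic tail\<close>

declare gsym.simps [simp del] wsym.simps [simp del]

lemma ge2: "ge2 v \<Longrightarrow> 2 \<le> sval v" and ge3: "ge3 v \<Longrightarrow> 3 \<le> sval v"
  by (cases v; simp)+

lemma gsym_ge3:
  assumes "16 \<le> nat_of_num q" "nat_of_num q \<le> 3372" "c \<noteq> C3"
  shows "3 \<le> sval (gsym (c, q))"
proof -
  have "cols_ge3 (num_of_nat (nat_of_num q))" by (rule all_between_nat[OF cols_ge3_all_between]) (use assms in simp_all)
  with assms(3) show ?thesis by (cases c) (auto simp: cols_ge3_def each_in_iff nat_of_num_inverse intro: ge3)
qed

lemma gsym_C3: "16 \<le> nat_of_num q \<Longrightarrow> gsym (C3, q) = V2"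
  by (simp add: less_num_def gsym.simps)

lemma gsym_ge2:
  assumes "5 \<le> pos_ix (c, q)" "nat_of_num q \<le> 3372"
  shows "2 \<le> sval (gsym (c, q))"
proof -
  consider "nat_of_num q = 1" | "2 \<le> nat_of_num q" "nat_of_num q < 16" | "16 \<le> nat_of_num q"
    using nat_of_num_pos[of q] by linarith
  then show ?thesis
  proof cases
    case 1
    then have "q = num.One" by (simp add: num_eq_iff)
    moreover have "c = C5" using assms(1) 1 by (cases c) (simp_all add: pos_ix_def)
    ultimately show ?thesis using junctions(3) by simp
  next
    case 2
    have "cols_ge2 (num_of_nat (nat_of_num q))" by (rule all_between_nat[OF cols_ge2_all_between]) (use 2 in simp_all)
    then show ?thesis by (cases c) (auto simp: cols_ge2_def each_in_iff nat_of_num_inverse intro: ge2)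
  next
    case 3
    show ?thesis
    proof (cases "c = C3")
      case True
      with gsym_C3[OF 3] show ?thesis by simp
    next
      case False
      from gsym_ge3[OF 3 assms(2) this] show ?thesis by simp
    qed
  qed
qed

lemma gword_odd_data:
  assumes "3 \<le> y" "y < 10119"
  obtains c q where "gword (2 * y + 1) = sval (gsym (c, q))" "pos_ix (c, q) = y" "nat_of_num q \<le> 3372" "pos_of y = (c, q)"
proof -
  obtain c q where p: "pos_of y = (c, q)" by fastforce
  have ip: "pos_ix (c, q) = y" using pos_ix_pos_of[OF assms(1)] p by simp
  moreover have "nat_of_num q \<le> 3372" using ip assms(2) by (simp add: pos_ix_def)
  moreover have "gword (2 * y + 1) = sval (gsym (c, q))" using gword_odd[of y] assms(2) p by simp
  ultimately show ?thesis using that p by blast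
qed

text \<open>In both tails this separates the last column from the constant ones: 1 and 0 are below 2
  in the least word, 3 and 2 are below \<open>2 + 2\<close> in \<open>h\<close>.\<close>

lemma gword_ge2:
  assumes "11 \<le> x"
  shows "2 \<le> gword x"
  using assms
proof (induction x rule: less_induct)
  case (less x)
  show ?case
  proof (cases "even x")
    case True
    show ?thesis
    proof (cases "x < 98")
      case x: True
      have "ge2 (gscal (num_of_nat x))" by (rule all_between_nat[OF gscal_ge2_all_between]) (use x less.prems in simp_all)
      with True x show ?thesis by (subst gword.simps) (simp add: ge2)
    next
      case False
      with True gword_even[of x] show ?thesis by simp
    qed
  next
    case False
    then obtain y where x: "x = 2 * y + 1" by (auto elim: oddE)
    show ?thesis
    proof (cases "y < 10119")
      case True
      have "3 \<le> y" using x less.prems by simp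
      then obtain c q where "gword x = sval (gsym (c, q))" "pos_ix (c, q) = y" "nat_of_num q \<le> 3372"
        using gword_odd_data[of y] True x by metis
      with gsym_ge2[of c q] x less.prems show ?thesis by simp
    next
      case False
      have "y div 3 - 3361 < x" using x by linarith
      moreover have "11 \<le> y div 3 - 3361" using False by linarith
      ultimately have "2 \<le> gword (y div 3 - 3361)" by (rule less.IH)
      with False gword_odd[of y] x show ?thesis by simp
    qed
  qed
qed

text \<open>Both words fit this form. From \<open>E\<close> on the even letters follow their
  pattern, the tail begins with block \<open>Q\<close>, and block \<open>q\<close> of it ends in
  letter \<open>q - s\<close> of \<open>h\<close> increased by \<open>a\<close>. Since
  \<open>t3\<close> and \<open>t5\<close> hold from block \<open>Q - 1\<close> on, all odd indices
  above \<open>6 * Q - 4\<close> behave as in the tail.\<close>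

locale tailed =
  fixes f :: "nat \<Rightarrow> nat" and D :: "pos \<Rightarrow> symb" and T :: "col \<Rightarrow> symb" and E Q s a :: nat
  assumes data: "D p \<noteq> U \<Longrightarrow> f (2 * pos_ix p + 1) = sval (D p)"
    and D_first: "D (C1, num.One) = U"
    and per: "even x \<Longrightarrow> E \<le> x \<Longrightarrow> f (x + 8) = f x"
    and flip: "even x \<Longrightarrow> E \<le> x \<Longrightarrow> f (x + 4) \<noteq> f x"
    and t1: "Q \<le> q \<Longrightarrow> f (6 * q + 1) = sval (T C1)"
    and t3: "Q \<le> q + 1 \<Longrightarrow> f (6 * q + 3) = sval (T C3)"
    and t5: "Q \<le> q + 1 \<Longrightarrow> f (6 * q + 5) = gword (q - s) + a"
    and T: "sval (T C1) \<noteq> sval (T C3)" "sval (T C1) < 2 + a" "sval (T C3) < 2 + a" "T C5 = U"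
    and Qs: "s + 12 \<le> Q" "E \<le> 6 * Q - 4"
begin

lemma per_mult: "even x \<Longrightarrow> E \<le> x \<Longrightarrow> f (x + 8 * j) = f x"
proof (induction j)
  case (Suc j)
  have "f (x + 8 * j + 8) = f (x + 8 * j)" by (rule per) (use Suc.prems in auto)
  with Suc show ?case by (simp add: add_ac)
qed simp

lemma even_shift_odd:
  assumes "even x" "E \<le> x" "odd m"
  shows "f (x + 4 * m) \<noteq> f x"
proof -
  obtain j where j: "m = 2 * j + 1" using assms(3) by (auto elim: oddE)
  have "f (x + 4 * m) = f ((x + 4) + 8 * j)" by (simp add: j algebra_simps)
  also have "\<dots> = f (x + 4)" by (rule per_mult) (use assms in auto)
  also have "\<dots> \<noteq> f x" by (rule flip) (use assms in auto)
  finally show ?thesis .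
qed

lemma even_shift_even:
  assumes "even x" "E \<le> x" "even m"
  shows "f (x + 4 * m) = f x"
proof -
  obtain j where j: "m = 2 * j" using assms(3) by auto
  show ?thesis using per_mult[OF assms(1,2), of j] by (simp add: j)
qed

text \<open>For odd \<open>m\<close> the shift \<open>4 * m\<close> is 4 modulo 8 and changes every
  even letter, and a window of two letters contains an even index.\<close>

lemma no_power_at_odd:
  assumes "odd m" "E \<le> i" "even i \<or> 1 < m"
  shows "\<not> power_at f i m"
proof
  assume power_at: "power_at f i m"
  show False
  proof (cases "even i")
    case True
    have "f (i + 0) = f (i + 4 * m + 0)" using power_at assms(1) unfolding power_at_def by blast
    with even_shift_odd[OF True assms(2,1)] show False by simp
  next
    case False
    with assms have "1 < m" by blast
    then have "f (i + 1) = f (i + 4 * m + 1)" using power_at unfolding power_at_def by blast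
    with even_shift_odd[of "i + 1" m] False assms show False by (simp add: add_ac)
  qed
qed

lemma tail_class5: "Q \<le> q + 1 \<Longrightarrow> f (6 * q + 5) \<ge> 2 + a"
proof -
  assume "Q \<le> q + 1"
  then have "f (6 * q + 5) = gword (q - s) + a" by (rule t5)
  moreover have "2 \<le> gword (q - s)" by (rule gword_ge2) (use \<open>Q \<le> q + 1\<close> Qs in linarith)
  ultimately show ?thesis by simp
qed

lemma tail_distinct:
  assumes "odd x" "odd y" "6 * Q - 4 \<le> x" "6 * Q - 4 \<le> y" "x mod 6 \<noteq> y mod 6"
  shows "f x \<noteq> f y"
proof -
  have *: "(x mod 6 = 1 \<and> f x = sval (T C1)) \<or> (x mod 6 = 3 \<and> f x = sval (T C3)) \<or> (x mod 6 = 5 \<and> 2 + a \<le> f x)"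
    if "odd x" "6 * Q - 4 \<le> x" for x
  proof -
    define q where "q = x div 6"
    have x: "x = 6 * q + x mod 6" by (simp add: q_def)
    have "x mod 6 = 1 \<or> x mod 6 = 3 \<or> x mod 6 = 5" using that(1) by (rule odd_mod_6)
    then consider "x mod 6 = 1" | "x mod 6 = 3" | "x mod 6 = 5" by blast
    then show ?thesis
    proof cases
      case 1
      then have xq: "x = 6 * q + 1" using x by simp
      then have "Q \<le> q" using that(2) by linarith
      with 1 xq t1[of q] show ?thesis by simp
    next
      case 2
      then have xq: "x = 6 * q + 3" using x by simp
      then have "Q \<le> q + 1" using that(2) by linarith
      with 2 xq t3[of q] show ?thesis by simp
    next
      case 3
      then have xq: "x = 6 * q + 5" using x by simp
      then have "Q \<le> q + 1" using that(2) by linarith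
      with 3 xq tail_class5[of q] show ?thesis by simp
    qed
  qed
  show ?thesis using *[OF assms(1,3)] *[OF assms(2,4)] assms(5) T by auto
qed

lemma descend:
  assumes "power_at f i m" "6 * Q - 4 \<le> i"
  shows "\<exists>n\<ge>1. m = 6 * n \<and> power_at gword (i div 6 - s) n"
proof -
  have m: "1 \<le> m" using assms(1) by (simp add: power_at_def)
  have i: "E \<le> i" using assms(2) Qs by linarith
  have eq: "f (i + j) = f (i + 4 * m + j)" if "j < m" for j using assms(1) that by (simp add: power_at_def)
  have "even i \<or> 1 < m \<Longrightarrow> even m" using no_power_at_odd[OF _ i] assms(1) by blast
  have "3 dvd m"
  proof (rule ccontr)
    assume n3: "\<not> 3 dvd m"
    \<comment> \<open>\<open>i + j\<close> is the first odd index of the window. It exists because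
      an even \<open>i\<close> rules out \<open>m = 1\<close>.\<close>
    define j where "j = (if odd i then 0 else 1 :: nat)"
    have "m \<noteq> 1" if "even i" using that \<open>even i \<or> 1 < m \<Longrightarrow> even m\<close> by auto
    then have j: "j < m" "odd (i + j)" using m by (auto simp: j_def)
    have "(i + j) mod 6 \<noteq> (i + 4 * m + j) mod 6"
    proof
      assume "(i + j) mod 6 = (i + 4 * m + j) mod 6"
      then have "6 dvd (i + 4 * m + j) - (i + j)" by (intro mod_eq_dvd_iff_nat[THEN iffD1]) simp_all
      then have "6 dvd 4 * m" by simp
      then have "3 dvd 4 * m" by (rule dvd_trans[rotated]) simp
      with n3 three_dvd_mult show False by blast
    qed
    moreover have "odd (i + 4 * m + j)" using j(2) by simp
    ultimately have "f (i + j) \<noteq> f (i + 4 * m + j)"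
      by (intro tail_distinct) (use j assms(2) in auto)
    with eq[OF j(1)] show False by blast
  qed
  moreover have "even m"
  proof -
    have "1 < m" using \<open>3 dvd m\<close> m by (cases "m = 1") auto
    with \<open>even i \<or> 1 < m \<Longrightarrow> even m\<close> show ?thesis by blast
  qed
  ultimately have "6 dvd m" by (intro six_dvdI)
  then obtain n where n: "m = 6 * n" by (auto elim: dvdE)
  \<comment> \<open>For a start in block \<open>Q - 1\<close> the smaller power begins at
    \<open>Q - 1 - s\<close>, which is 11 for both words, the index of the virtual letter.\<close>
  define q where "q = i div 6"
  have q: "Q \<le> q + 1" using assms(2) Qs unfolding q_def by linarith
  have "gword (q - s + j) = gword (q - s + 4 * n + j)" if "j < n" for j
  proof -
    define e where "e = i mod 6"
    have e: "i = 6 * q + e" "e \<le> 5" unfolding q_def e_def by simp_all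
    \<comment> \<open>Adding \<open>5 - e\<close> moves from column \<open>e\<close> of a block to
      its last column.\<close>
    have *: "i + (6 * j + (5 - e)) = 6 * (q + j) + 5"
      "i + 4 * m + (6 * j + (5 - e)) = 6 * (q + 4 * n + j) + 5"
      using e(2) unfolding n e(1) by simp_all
    have "6 * j + (5 - e) < m" using that n by linarith
    from eq[OF this] have "f (6 * (q + j) + 5) = f (6 * (q + 4 * n + j) + 5)" unfolding * .
    moreover have "f (6 * (q + j) + 5) = gword (q + j - s) + a"
      "f (6 * (q + 4 * n + j) + 5) = gword (q + 4 * n + j - s) + a" by (rule t5, use q in simp)+
    ultimately have "gword (q + j - s) = gword (q + 4 * n + j - s)" by simp
    moreover have "q + j - s = q - s + j" "q + 4 * n + j - s = q - s + 4 * n + j" using q Qs by linarith+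
    ultimately show ?thesis by simp
  qed
  then have "power_at gword (q - s) n" using m n by (simp add: power_at_def)
  then show ?thesis using n m unfolding q_def by auto
qed

text \<open>A window of even length \<open>m\<close> contains exactly \<open>m div 2\<close> odd
  indices, starting with \<open>2 * (i div 2) + 1\<close> for either parity of \<open>i\<close>. For
  \<open>m = 1\<close> the single index has to be odd.\<close>

lemma odd_window:
  assumes "power_at f i m" "t \<noteq> S1 \<or> odd i" "m = plen t" "j < wlen t"
  shows "f (2 * (i div 2 + j) + 1) = f (2 * (i div 2 + j + 2 * m) + 1)"
proof -
  define k where "k = 2 * (i div 2 + j) + 1 - i"
  have k: "2 * (i div 2 + j) + 1 = i + k" "k < m"
  proof -
    show "2 * (i div 2 + j) + 1 = i + k" using half_bounds(2)[of i] unfolding k_def by simp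
    show "k < m"
    proof (cases "t = S1")
      case True
      then have "2 * (i div 2) + 1 = i" using assms(2) by simp
      with True assms(3,4) show ?thesis unfolding k_def by simp
    next
      case False
      then show ?thesis using assms(3,4) wlen_plen[of t] half_bounds(1)[of i] unfolding k_def by simp
    qed
  qed
  moreover have "2 * (y + j) + 1 = i + k \<Longrightarrow> 2 * (y + j + 2 * m) + 1 = i + 4 * m + k" for y by simp
  from this[OF k(1)] have "2 * (i div 2 + j + 2 * m) + 1 = i + 4 * m + k" .
  ultimately show ?thesis using assms(1) unfolding power_at_def by metis
qed

lemma mismatch_neq: "mismatch D t p \<Longrightarrow> f (2 * pos_ix p + 1) \<noteq> f (2 * (pos_ix p + 2 * plen t) + 1)"
  using data[of p] data[of "far t p"] sval_inj by (auto simp: mismatch_def differ_iff pos_ix_far)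

lemma gap_free_no_power_at:
  assumes "gap_free D b Q' p q t" "\<And>q. pos_ix (b q) \<le> pos_ix q" "pos_ix q < i div 2 + wlen t"
    "i div 2 \<le> 3 * nat_of_num Q'" "t \<noteq> S1 \<or> odd i" "m = plen t"
  shows "\<not> power_at f i m"
proof
  assume power_at: "power_at f i m"
  obtain r where r: "mismatch D t r" "i div 2 \<le> pos_ix r" "pos_ix r < i div 2 + wlen t"
    using gap_free_sound[OF assms(1-4)] by blast
  with odd_window[OF power_at assms(5,6), of "pos_ix r - i div 2"] mismatch_neq[OF r(1)] assms(6) show False by simp
qed

lemma tail_T:
  assumes "Q \<le> nat_of_num (snd p)" "T (fst p) \<noteq> U"
  shows "f (2 * pos_ix p + 1) = sval (T (fst p))"
proof (cases "fst p")
  case C1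
  have *: "2 * pos_ix p + 1 = 6 * nat_of_num (snd p) + 1" using C1 by (simp add: pos_ix_def)
  show ?thesis unfolding * C1 by (rule t1) (rule assms(1))
next
  case C3
  have *: "2 * pos_ix p + 1 = 6 * nat_of_num (snd p) + 3" using C3 by (simp add: pos_ix_def)
  show ?thesis unfolding * C3 by (rule t3) (use assms(1) in simp)
qed (use T assms in simp)

text \<open>For long periods the shifted window lies in the tail, of which only the letters given by \<open>T\<close> are needed.\<close>

lemma gap_free_tail_no_power_at:
  assumes "gap_free_tail D T r Q' n" "\<And>p. pos_ix (r p) = pos_ix p + d" "m mod 6 = (2 * d) mod 6" "6 * nat_of_num n \<le> m"
    "5 \<le> i div 2" "i div 2 \<le> 3 * nat_of_num Q'" "3 * Q \<le> 5 + 12 * nat_of_num n" "d < 3"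
  shows "\<not> power_at f i m"
proof
  assume power_at: "power_at f i m"
  define y where "y = i div 2"
  have "\<exists>p. differ (D p) (T (fst (r p))) \<and> y \<le> pos_ix p \<and> pos_ix p < y + 3 * nat_of_num n"
  proof (rule search_sound[OF _ _ _ _ assms(1)[unfolded gap_free_tail_def], where B = "3 * nat_of_num Q'"])
    show "pos_ix r' \<le> pos_ix q + 3 * nat_of_num n" if "jump Q' (advance (A0 n)) q = Some r'" for q r'
      using jump_Some[OF that] by (simp add: pos_ix_advance)
    show "0 < 3 * nat_of_num n" using nat_of_num_pos[of n] by simp
    show "pos_ix (C3, n + num.One) < y + 3 * nat_of_num n"
      using assms(5) by (simp add: pos_ix_def nat_of_num_add y_def)
  qed (use jump_None pos_ix_prev assms(6) in \<open>auto simp: y_def\<close>)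
  then obtain p where p: "differ (D p) (T (fst (r p)))" "y \<le> pos_ix p" "pos_ix p < y + 3 * nat_of_num n" by blast
  define z where "z = pos_of (pos_ix p + 2 * m)"
  have z: "pos_ix z = pos_ix p + 2 * m" unfolding z_def by (rule pos_ix_pos_of) (use p assms(5) y_def in linarith)
  have "pos_ix z mod 3 = pos_ix (r p) mod 3" unfolding z assms(2) using assms(3) by (rule shift_mod_3)
  then have fst: "fst z = fst (r p)" unfolding pos_ix_mod by (cases "fst z"; cases "fst (r p)") simp_all
  have "3 * Q \<le> pos_ix z" using z p(2) assms(4,5,7) y_def by linarith
  then have "Q \<le> pos_ix z div 3" by linarith
  then have "f (2 * pos_ix z + 1) = sval (T (fst z))"
    by (intro tail_T) (use p(1) fst in \<open>auto simp: pos_ix_div differ_iff\<close>)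
  moreover have "f (2 * pos_ix p + 1) = sval (D p)" by (rule data) (use p(1) in \<open>simp add: differ_iff\<close>)
  ultimately have ne: "f (2 * pos_ix p + 1) \<noteq> f (2 * (pos_ix p + 2 * m) + 1)"
    using p(1) sval_inj fst z by (auto simp: differ_iff)
  define k where "k = 2 * pos_ix p + 1 - i"
  have "2 * y \<le> i" "i \<le> 2 * y + 1" unfolding y_def by (rule half_bounds)+
  then have k: "2 * pos_ix p + 1 = i + k" "k < m" using p assms(4) unfolding k_def by simp_all
  then have "f (i + k) = f (i + 4 * m + k)" using power_at by (simp add: power_at_def)
  moreover have "2 * (pos_ix p + 2 * m) + 1 = i + 4 * m + k" using k(1) by (simp add: algebra_simps)
  ultimately show False using ne k(1) by metis
qed

end

section \<open>Agreement of the two words with their tables and tails\<close>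

lemma add2: "add2 v \<noteq> U \<Longrightarrow> sval (add2 v) = sval v + 2 \<and> v \<noteq> U"
  by (cases v) simp_all

lemma num_of_nat_plus:
  assumes "nat_of_num q = n + nat_of_num k" "0 < n"
  shows "num_of_nat n + k = q"
  using assms by (simp add: num_eq_iff nat_of_num_add num_of_nat_inverse)

lemma col_cases_pos_ix:
  obtains "c = C1" "pos_ix (c, q) mod 3 = 0" | "c = C3" "pos_ix (c, q) mod 3 = 1" | "c = C5" "pos_ix (c, q) mod 3 = 2"
  by (cases c) (simp_all add: pos_ix_mod)

text \<open>The tables overlap the recursion: blocks 3373 to 3472 of \<open>g5\<close> lie in the
  tail and are matched with it by \<open>lit_tail_all_between\<close>.\<close>

lemma gsym_data:
  assumes "gsym p \<noteq> U"
  shows "gword (2 * pos_ix p + 1) = sval (gsym p)"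
proof (cases "pos_ix p < 10119")
  case True
  then show ?thesis by (simp only: gword_odd pos_of_pos_ix if_True)
next
  case False
  obtain c q where p: "p = (c, q)" by fastforce
  have iq: "pos_ix p div 3 = nat_of_num q" by (simp add: pos_ix_div p)
  then have q: "3373 \<le> nat_of_num q" using False by linarith
  have G: "gword (2 * pos_ix p + 1) = (if pos_ix p mod 3 = 0 then 3 else if pos_ix p mod 3 = 1 then 2 else gword (nat_of_num q - 3361) + 2)"
    using False by (simp only: gword_odd if_False iq)
  show ?thesis
  proof (cases c q rule: col_cases_pos_ix)
    case 1
    with G p q show ?thesis by (simp add: less_num_def gsym.simps wsym.simps)
  next
    case 2
    with G p q show ?thesis by (simp add: less_num_def gsym.simps wsym.simps)
  next
    case 3
    have lit: "nat_of_num q < 3473" using assms 3 p by (auto simp: less_num_def gsym.simps wsym.simps split: if_splits)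
    define x where "x = nat_of_num q - 3361"
    have x: "12 \<le> x" "x \<le> 111" using q lit by (auto simp: x_def)
    have "lit_tail (num_of_nat x)" by (rule all_between_nat[OF lit_tail_all_between]) (use x in simp_all)
    moreover have "num_of_nat x + n3361 = q" by (rule num_of_nat_plus) (use q x x_def in simp_all)
    ultimately have k: "add2 (gscal (num_of_nat x)) \<noteq> U" "g5 q = add2 (gscal (num_of_nat x))"
      by (simp_all add: lit_tail_def Let_def split: if_splits)
    have "gsym p = g5 q" using 3 p lit by (simp add: less_num_def gsym.simps wsym.simps)
    then have "sval (gsym p) = gword x + 2" using k add2[OF k(1)] gscal_gword[of x] x by simp
    then show ?thesis using G 3 p x_def by simp
  qed
qed

lemma wsym_data:
  assumes "wsym p \<noteq> U"
  shows "wword (2 * pos_ix p + 1) = sval (wsym p)"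
proof (cases "pos_ix p < 3387")
  case True
  then show ?thesis by (simp only: wword_odd pos_of_pos_ix if_True)
next
  case False
  obtain c q where p: "p = (c, q)" by fastforce
  have iq: "pos_ix p div 3 = nat_of_num q" by (simp add: pos_ix_div p)
  then have q: "1129 \<le> nat_of_num q" using False by linarith
  have G: "wword (2 * pos_ix p + 1) = (if pos_ix p mod 3 = 0 then 1 else if pos_ix p mod 3 = 1 then 0 else gword (nat_of_num q - 1117))"
    using False by (simp only: wword_odd if_False iq)
  show ?thesis
  proof (cases c q rule: col_cases_pos_ix)
    case 1
    with G p q show ?thesis by (simp add: less_num_def gsym.simps wsym.simps)
  next
    case 2
    with G p q show ?thesis by (simp add: less_num_def gsym.simps wsym.simps)
  next
    case 3
    have lit: "nat_of_num q < 1687" using assms 3 p by (auto simp: less_num_def gsym.simps wsym.simps split: if_splits)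
    define x where "x = nat_of_num q - 1117"
    have x: "12 \<le> x" "x \<le> 569" using q lit by (auto simp: x_def)
    have *: "num_of_nat x + n1117 = q" by (rule num_of_nat_plus) (use q x x_def in simp_all)
    have "\<not> num_of_nat x < n11" using x by (simp add: less_num_def num_of_nat_inverse)
    then have "gscal (num_of_nat x) = w5 q" by (simp add: gscal_def *)
    moreover have "wsym p = w5 q" using 3 p lit by (simp add: less_num_def gsym.simps wsym.simps)
    ultimately have "sval (wsym p) = gword x" using gscal_gword[of x] x by simp
    then show ?thesis using G 3 p x_def by simp
  qed
qed

lemma junction_letters: "gword 11 = 3" "gword 20237 = 5" "gword 20235 = 2" "wword 6773 = 3" "wword 6771 = 0"
proof -
  have pos_ix: "2 * pos_ix (C5, num.One) + 1 = 11" "2 * pos_ix (C5, n3372) + 1 = 20237" "2 * pos_ix (C3, n3372) + 1 = 20235"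
    "2 * pos_ix (C5, n1128) + 1 = 6773" "2 * pos_ix (C3, n1128) + 1 = 6771"
    by (simp_all add: pos_ix_def)
  have C3: "gsym (C3, n3372) = V2" "wsym (C3, n1128) = V0" by (simp_all add: gsym.simps wsym.simps)
  note G = gsym_data[of "(C5, num.One)"] gsym_data[of "(C5, n3372)"] gsym_data[of "(C3, n3372)"]
  note W = wsym_data[of "(C5, n1128)"] wsym_data[of "(C3, n1128)"]
  show "gword 11 = 3" "gword 20237 = 5" "gword 20235 = 2" "wword 6773 = 3" "wword 6771 = 0"
    using G W unfolding pos_ix C3 junctions by (simp_all only: sval.simps symb.distinct if_True not_False_eq_True simp_thms)
qed

lemma gword_col:
  assumes "3373 \<le> q"
  shows "gword (6 * q + 1) = 3" "gword (6 * q + 3) = 2" "gword (6 * q + 5) = gword (q - 3361) + 2"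
proof -
  have "6 * q + 1 = 2 * (3 * q) + 1" "6 * q + 3 = 2 * (3 * q + 1) + 1" "6 * q + 5 = 2 * (3 * q + 2) + 1" by simp_all
  moreover have "(3 * q + 1) mod 3 = 1" "(3 * q + 2) mod 3 = 2" "(3 * q + 2) div 3 = q" by presburger+
  moreover have "\<not> 3 * q < 10119" "\<not> 3 * q + 1 < 10119" "\<not> 3 * q + 2 < 10119" using assms by simp_all
  ultimately show "gword (6 * q + 1) = 3" "gword (6 * q + 3) = 2" "gword (6 * q + 5) = gword (q - 3361) + 2"
    by (simp_all only: gword_odd) simp_all
qed

lemma wword_col:
  assumes "1129 \<le> q"
  shows "wword (6 * q + 1) = 1" "wword (6 * q + 3) = 0" "wword (6 * q + 5) = gword (q - 1117)"
proof -
  have "6 * q + 1 = 2 * (3 * q) + 1" "6 * q + 3 = 2 * (3 * q + 1) + 1" "6 * q + 5 = 2 * (3 * q + 2) + 1" by simp_all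
  moreover have "(3 * q + 1) mod 3 = 1" "(3 * q + 2) mod 3 = 2" "(3 * q + 2) div 3 = q" by presburger+
  moreover have "\<not> 3 * q < 3387" "\<not> 3 * q + 1 < 3387" "\<not> 3 * q + 2 < 3387" using assms by simp_all
  ultimately show "wword (6 * q + 1) = 1" "wword (6 * q + 3) = 0" "wword (6 * q + 5) = gword (q - 1117)"
    by (simp_all only: wword_odd) simp_all
qed

lemma pattern_per: "(x + 8 + 6) mod 8 = (x + 6 :: nat) mod 8" by presburger
lemma pattern_flip: "even x \<Longrightarrow> (x + 4 + 6) mod 8 < 4 \<longleftrightarrow> \<not> (x + 6 :: nat) mod 8 < 4" by presburger

interpretation G: tailed gword gsym tail_G 98 3373 3361 2
proof
  fix q :: nat
  assume "3373 \<le> q + 1"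
  then have "q = 3372 \<or> 3373 \<le> q" by linarith
  then show "gword (6 * q + 5) = gword (q - 3361) + 2" "gword (6 * q + 3) = sval (tail_G C3)" using junction_letters gword_col(2,3)[of q] by auto
next
  fix x :: nat assume "even x" "98 \<le> x"
  then show "gword (x + 8) = gword x" "gword (x + 4) \<noteq> gword x"
    using pattern_flip[of x] pattern_per[of x] by (simp_all add: gword_even del: add_2_eq_Suc')
qed (use gsym_data junctions gword_col in \<open>simp_all del: gsym.simps\<close>)

interpretation W: tailed wword wsym tail_W 10 1129 1117 0
proof
  fix q :: nat
  assume "1129 \<le> q + 1"
  then have "q = 1128 \<or> 1129 \<le> q" by linarith
  then show "wword (6 * q + 5) = gword (q - 1117) + 0" "wword (6 * q + 3) = sval (tail_W C3)" using junction_letters wword_col(2,3)[of q] by auto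
next
  fix x :: nat assume "even x" "10 \<le> x"
  then show "wword (x + 8) = wword x" "wword (x + 4) \<noteq> wword x"
    using pattern_flip[of x] pattern_per[of x] by (simp_all add: wword_even del: add_2_eq_Suc')
qed (use wsym_data junctions wword_col in \<open>simp_all del: wsym.simps\<close>)

section \<open>Absence of powers\<close>

lemma all_between_num: "all_between P a b = Some u \<Longrightarrow> nat_of_num a \<le> nat_of_num n \<Longrightarrow> nat_of_num n \<le> nat_of_num b \<Longrightarrow> P n"
  using all_between_nat[of P a b u "nat_of_num n"] by (simp add: nat_of_num_inverse)

lemma power_at_eq:
  assumes "power_at f i m" "i \<le> x" "x < i + m"
  shows "f x = f (x + 4 * m)"
proof -
  have "f (i + (x - i)) = f (i + 4 * m + (x - i))"
    using assms(1,3) assms(2) unfolding power_at_def by (metis add_less_cancel_left le_add_diff_inverse)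
  moreover have "i + 4 * m + (x - i) = x + 4 * m" using assms(2) by simp
  ultimately show ?thesis using assms(2) by simp
qed

lemma even_period_cases:
  assumes "even (m :: nat)" "2 \<le> m"
  obtains "m = 2" | "m = 4" | n where "1 \<le> nat_of_num n" "m = 6 * nat_of_num n"
  | n where "1 \<le> nat_of_num n" "m = 6 * nat_of_num n + 2"
  | n where "1 \<le> nat_of_num n" "m = 6 * nat_of_num n + 4"
proof -
  define k where "k = m div 6"
  have "m = 6 * k \<or> m = 6 * k + 2 \<or> m = 6 * k + 4" 
    using even_mod_6[OF assms(1)] unfolding k_def by (metis add.right_neutral mult_div_mod_eq)
  moreover have "nat_of_num (num_of_nat k) = k" if "1 \<le> k" using that by (simp add: num_of_nat_inverse)
  moreover have "k = 0 \<Longrightarrow> m = 2 \<or> m = 4" using assms(2) calculation(1) by auto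
  ultimately show ?thesis using that by (metis One_nat_def Suc_leI neq0_conv)
qed

lemma prev_le: "pos_ix (prev q) \<le> pos_ix q" by (simp add: pos_ix_prev)

text \<open>The bound is \<open>6 * 1129 - 5\<close>: from the next start on
  \<open>W.descend\<close> applies.\<close>

lemma W_head:
  assumes "10 \<le> i" "i \<le> 6769"
  shows "\<not> power_at wword i m"
proof
  assume power_at: "power_at wword i m"
  have B: "i div 2 \<le> 3 * nat_of_num n1128" using assms(2) by simp
  have lo: "5 \<le> i div 2" using assms(1) by simp
  have m: "1 \<le> m" using power_at by (simp add: power_at_def)
  show False
  proof (cases "even m")
    case False
    then have "\<not> (even i \<or> 1 < m)" using W.no_power_at_odd[of m i] power_at assms(1) by blast
    then have odd: "odd i" "m = 1" using m by linarith+
    have "\<not> power_at wword i m"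
      by (rule W.gap_free_no_power_at[OF gaps_Ws(1)[unfolded gaps_Ws_def] prev_le _ B])
        (use odd lo in \<open>simp_all add: pos_ix_def\<close>)
    with power_at show False by contradiction
  next
    case True
    then have "2 \<le> m" using m by (cases "m = 1") simp_all
    with True show False
    proof (cases rule: even_period_cases)
      case 1
      have "\<not> power_at wword i m"
        by (rule W.gap_free_no_power_at[OF gaps_Ws(2)[unfolded gaps_Ws_def] prev_le _ B]) (use 1 lo in \<open>simp_all add: pos_ix_def\<close>)
      with power_at show False by contradiction
    next
      case 2
      have "\<not> power_at wword i m"
        by (rule W.gap_free_no_power_at[OF gaps_Ws(3)[unfolded gaps_Ws_def] prev_le _ B]) (use 2 lo in \<open>simp_all add: pos_ix_def\<close>)
      with power_at show False by contradiction
    next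
      case (3 n)
      show False
      proof (cases "nat_of_num n \<le> 282")
        case True
        have c: "gaps_W0 n" by (rule all_between_num[OF gaps_W0_all_between]) (use True 3 in simp_all)
        have "\<not> power_at wword i m"
          by (rule W.gap_free_no_power_at[OF c[unfolded gaps_W0_def] prev_le _ B]) (use 3 lo in \<open>simp_all add: pos_ix_def nat_of_num_add\<close>)
        with power_at show False by contradiction
      next
        case False
        have "\<not> power_at wword i m"
          by (rule W.gap_free_tail_no_power_at[OF gaps_Wt(1), where d = 0]) (use 3 lo B False in simp_all)
        with power_at show False by contradiction
      qed
    next
      case (4 n)
      show False
      proof (cases "nat_of_num n \<le> 282")
        case True
        have c: "gaps_W1 n" by (rule all_between_num[OF gaps_W1_all_between]) (use True 4 in simp_all)
        have "\<not> power_at wword i m"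
          by (rule W.gap_free_no_power_at[OF c[unfolded gaps_W1_def] prev_le _ B]) (use 4 lo in \<open>simp_all add: pos_ix_def nat_of_num_add\<close>)
        with power_at show False by contradiction
      next
        case False
        have md: "m mod 6 = 2 * 1 mod 6" using 4(2) by presburger
        have "\<not> power_at wword i m"
          by (rule W.gap_free_tail_no_power_at[OF gaps_Wt(2) _ md]) (use 4 lo B False in \<open>simp_all add: pos_ix_next1\<close>)
        with power_at show False by contradiction
      qed
    next
      case (5 n)
      show False
      proof (cases "nat_of_num n \<le> 282")
        case True
        have c: "gaps_W2 n" by (rule all_between_num[OF gaps_W2_all_between]) (use True 5 in simp_all)
        have "\<not> power_at wword i m"
          by (rule W.gap_free_no_power_at[OF c[unfolded gaps_W2_def] prev_le _ B]) (use 5 lo in \<open>simp_all add: pos_ix_def nat_of_num_add\<close>)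
        with power_at show False by contradiction
      next
        case False
        have md: "m mod 6 = 2 * 2 mod 6" using 5(2) by presburger
        have "\<not> power_at wword i m"
          by (rule W.gap_free_tail_no_power_at[OF gaps_Wt(3) _ md]) (use 5 lo B False in \<open>simp_all add: pos_ix_next2\<close>)
        with power_at show False by contradiction
      qed
    qed
  qed
qed

text \<open>These starts precede the pattern of even letters, so the mismatches are sought among all
  indices and not only the odd ones.\<close>

lemma G_small:
  assumes "11 \<le> i" "i \<le> 97" "m \<le> 90"
  shows "\<not> power_at gword i m"
proof
  assume power_at: "power_at gword i m"
  define n where "n = num_of_nat m"
  have n: "nat_of_num n = m" using power_at by (simp add: n_def power_at_def num_of_nat_inverse)
  have "gap_free_scal n" by (rule all_between_num[OF gap_free_scal_all_between]) (use n assms power_at in \<open>simp_all add: power_at_def\<close>)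
  note c = this[unfolded gap_free_scal_def]
  have "\<exists>t. differ (gscal t) (gscal (t + num.Bit0 (num.Bit0 n))) \<and> i \<le> nat_of_num t \<and> nat_of_num t < i + m"
  proof (rule search_sound[OF _ _ _ _ c, where B = 97])
    show "nat_of_num (n10 + n) < i + m" using assms(1) n by (simp add: nat_of_num_add)
    show "0 < m" using power_at by (simp add: power_at_def)
  qed (use assms n in \<open>auto simp: jump_scal_def nat_of_num_add less_num_def nat_of_num_num_pred split: if_splits\<close>)
  then obtain t where t: "differ (gscal t) (gscal (t + num.Bit0 (num.Bit0 n)))" "i \<le> nat_of_num t" "nat_of_num t < i + m"
    by blast
  have "sval (gscal u) = gword (nat_of_num u)" if "i \<le> nat_of_num u" "nat_of_num u < i + 5 * m" for u
    using gscal_gword[of "nat_of_num u"] that assms by (simp add: nat_of_num_inverse)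
  from this[of t] this[of "t + num.Bit0 (num.Bit0 n)"] have "gword (nat_of_num t) \<noteq> gword (nat_of_num t + 4 * m)"
    using t n sval_inj[of "gscal t" "gscal (t + num.Bit0 (num.Bit0 n))"] by (auto simp: differ_iff nat_of_num_add)
  with power_at_eq[OF power_at t(2,3)] show False by contradiction
qed

text \<open>The letter 2 marks column 3 long before the tail. This excludes periods not divisible by
  3 without a search for each of them.\<close>

lemma gword_class:
  assumes "48 \<le> t"
  shows "if t mod 3 = 1 then gword (2 * t + 1) = 2 else 3 \<le> gword (2 * t + 1)"
proof (cases "t < 10119")
  case True
  have "3 \<le> t" using assms by simp
  then obtain c q where g: "gword (2 * t + 1) = sval (gsym (c, q))" "pos_ix (c, q) = t" "nat_of_num q \<le> 3372"
    using gword_odd_data[of t] True by metis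
  have q: "16 \<le> nat_of_num q" using pos_ix_div[of "(c, q)"] g(2) assms by simp
  have c: "t mod 3 = col_ix c" using pos_ix_mod[of "(c, q)"] g(2) by simp
  show ?thesis
  proof (cases "c = C3")
    case True
    then show ?thesis using g(1) gsym_C3[OF q] c by simp
  next
    case False
    moreover from False have "col_ix c \<noteq> 1" by (cases c) simp_all
    ultimately show ?thesis using g(1) gsym_ge3[OF q g(3)] c by simp
  qed
next
  case False
  have "11 \<le> t div 3 - 3361" using False by linarith
  then show ?thesis using gword_odd[of t] gword_ge2[of "t div 3 - 3361"] False by simp
qed

lemma G_not3:
  assumes "even m" "\<not> 3 dvd m" "i \<le> x" "97 \<le> x" "odd x" "x + 2 < i + m"
  shows "\<not> power_at gword i m"
proof
  assume power_at: "power_at gword i m"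
  obtain t where t: "x = 2 * t + 1" using assms(5) by (auto elim: oddE)
  have t48: "48 \<le> t" using assms(4) t by simp
  \<comment> \<open>As \<open>2 * m\<close> is not divisible by 3, for two of the three residues of
    \<open>u\<close> exactly one of \<open>u\<close> and \<open>u + 2 * m\<close> lies in column 3.
    Two neighbours cannot both have the remaining residue.\<close>
  have "\<exists>u\<in>{t, t + 1}. (u mod 3 = 1) \<noteq> ((u + 2 * m) mod 3 = 1)"
    using assms(2) by (simp, presburger)
  then obtain u where u: "u \<in> {t, t + 1}" "(u mod 3 = 1) \<noteq> ((u + 2 * m) mod 3 = 1)" by blast
  have "gword (2 * u + 1) = gword (2 * u + 1 + 4 * m)" by (rule power_at_eq[OF power_at]) (use u(1) t assms in auto)
  moreover have "2 * u + 1 + 4 * m = 2 * (u + 2 * m) + 1" by simp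
  ultimately have "gword (2 * u + 1) = gword (2 * (u + 2 * m) + 1)" by simp
  moreover have "48 \<le> u" using u(1) t48 by auto
  ultimately show False using u(2) gword_class[of u] gword_class[of "u + 2 * m"] by (auto split: if_splits)
qed

text \<open>Period 6 with a start below 98 is left out because \<open>G_small\<close> covers
  it.\<close>

lemma G_6:
  assumes "11 \<le> i" "i \<le> 20233" "m = 6 * n" "2 \<le> n \<or> 98 \<le> i"
  shows "\<not> power_at gword i m"
proof
  assume power_at: "power_at gword i m"
  define k where "k = num_of_nat n"
  have "1 \<le> n" using power_at assms(3) by (cases n) (simp_all add: power_at_def)
  then have k: "nat_of_num k = n" by (simp add: k_def num_of_nat_inverse)
  have B: "i div 2 \<le> 3 * nat_of_num n3372" using assms(2) by simp
  have lo: "5 \<le> i div 2" using assms(1) by simp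
  consider "n = 1" | "2 \<le> n" "n \<le> 843" | "843 \<le> n" using \<open>1 \<le> n\<close> by linarith
  then show False
  proof cases
    case 1
    then have "98 \<le> i" using assms(4) by simp
    then have "49 \<le> i div 2" by simp
    then have "\<not> power_at gword i m"
      by (intro G.gap_free_no_power_at[OF gaps_G1 pos_ix_prev_free _ B]) (use 1 assms(3) in \<open>simp_all add: pos_ix_def\<close>)
    with power_at show False by contradiction
  next
    case 2
    have "gaps_G k"
    proof -
      consider "n \<le> 30" | "31 \<le> n" "n \<le> 200" | "201 \<le> n" by linarith
      then show ?thesis
      proof cases
        case 1
        show ?thesis by (rule all_between_num[OF gaps_G_run1]) (use 1 2 k in simp_all)
      next
        case c: 2
        show ?thesis by (rule all_between_num[OF gaps_G_run2]) (use c k in simp_all)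
      next
        case 3
        show ?thesis by (rule all_between_num[OF gaps_G_run3]) (use 2 3 k in simp_all)
      qed
    qed
    note c = this[unfolded gaps_G_def]
    have "\<not> power_at gword i m"
      by (rule G.gap_free_no_power_at[OF c pos_ix_prev_free _ B]) (use assms(3) k lo in \<open>simp_all add: pos_ix_def nat_of_num_add\<close>)
    with power_at show False by contradiction
  next
    case 3
    have "\<not> power_at gword i m"
      by (rule G.gap_free_tail_no_power_at[OF gaps_Gt, where d = 0]) (use assms(3) k lo B 3 in simp_all)
    with power_at show False by contradiction
  qed
qed

lemma G_head:
  assumes "11 \<le> i" "i \<le> 20233"
  shows "\<not> power_at gword i m"
proof
  assume power_at: "power_at gword i m"
  have m: "1 \<le> m" using power_at by (simp add: power_at_def)
  have B: "i div 2 \<le> 3 * nat_of_num n3372" using assms(2) by simp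
  show False
  proof (cases "i \<le> 97")
    case True
    \<comment> \<open>Such a window starts between 11 and 97 and contains the indices 97 to 101,
      hence the regular even index 98 and the odd indices 97 and 99 used below.\<close>
    then have m90: "90 < m" using G_small[of i m] power_at assms(1) by linarith
    show False
    proof (cases "even m")
      case False
      have "gword 98 = gword (98 + 4 * m)" by (rule power_at_eq[OF power_at]) (use True m90 assms(1) in simp_all)
      with G.even_shift_odd[of 98 m] False show False by simp
    next
      case even: True
      show False
      proof (cases "3 dvd m")
        case False
        have "\<not> power_at gword i m" by (rule G_not3[of m i 97]) (use even False True m90 assms in simp_all)
        with power_at show False by contradiction
      next
        case True
        with even have "6 dvd m" by (intro six_dvdI)
        then obtain n where n: "m = 6 * n" by (auto elim: dvdE)
        have "\<not> power_at gword i m" by (rule G_6[OF assms n]) (use m90 n in simp)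
        with power_at show False by contradiction
      qed
    qed
  next
    case False
    then have i98: "98 \<le> i" by simp
    then have i49: "49 \<le> i div 2" by simp
    show False
    proof (cases "even m")
      case odd: False
      then have "\<not> (even i \<or> 1 < m)" using G.no_power_at_odd[of m i] power_at i98 by blast
      then have m1: "odd i" "m = 1" using m by linarith+
      have "\<not> power_at gword i m"
        by (rule G.gap_free_no_power_at[OF gaps_Gs1[unfolded gaps_Gs_def] prev_le _ B]) (use m1 i49 in \<open>simp_all add: pos_ix_def\<close>)
      with power_at show False by contradiction
    next
      case even: True
      show False
      proof (cases "3 dvd m")
        case n3: False
        show False
        proof (cases "m = 2")
          case True
          have "\<not> power_at gword i m"
            by (rule G.gap_free_no_power_at[OF gaps_Gs2[unfolded gaps_Gs_def] prev_le _ B]) (use True i49 in \<open>simp_all add: pos_ix_def\<close>)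
          with power_at show False by contradiction
        next
          case False
          then have "4 \<le> m" using even m by presburger
          define x where "x = 2 * (i div 2) + 1"
          have x: "odd x" "i \<le> x" "x \<le> i + 1" unfolding x_def by simp_all
          have "\<not> power_at gword i m" by (rule G_not3[of m i x]) (use even n3 x i98 \<open>4 \<le> m\<close> in simp_all)
          with power_at show False by contradiction
        qed
      next
        case True
        with even have "6 dvd m" by (intro six_dvdI)
        then obtain n where n: "m = 6 * n" by (auto elim: dvdE)
        have "\<not> power_at gword i m" by (rule G_6[OF assms n]) (use i98 in simp)
        with power_at show False by contradiction
      qed
    qed
  qed
qed

text \<open>Admitting the virtual index 11 closes the induction: a power starting at 20234, the
  first start beyond the head, descends to one starting at \<open>3372 - 3361 = 11\<close>.\<close>

theorem G_no_power_at: "11 \<le> i \<Longrightarrow> \<not> power_at gword i m"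
proof (induction m arbitrary: i rule: less_induct)
  case (less m)
  show ?case
  proof (cases "i \<le> 20233")
    case True
    with less.prems G_head show ?thesis by blast
  next
    case False
    show ?thesis
    proof
      assume power_at: "power_at gword i m"
      obtain n where n: "1 \<le> n" "m = 6 * n" "power_at gword (i div 6 - 3361) n"
        using G.descend[OF power_at] False by auto
      have "11 \<le> i div 6 - 3361" using False by linarith
      with less.IH[of n "i div 6 - 3361"] n show False by simp
    qed
  qed
qed

theorem W_no_power_at:
  assumes "10 \<le> i"
  shows "\<not> power_at wword i m"
proof
  assume power_at: "power_at wword i m"
  show False
  proof (cases "i \<le> 6769")
    case True
    with W_head assms power_at show False by blast
  next
    case False
    obtain n where n: "power_at gword (i div 6 - 1117) n" using W.descend[OF power_at] False by auto
    have "11 \<le> i div 6 - 1117" using False by linarith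
    with n G_no_power_at show False by blast
  qed
qed

section \<open>Minimality of letters\<close>

declare agree.simps [simp del]

text \<open>Only the \<open>k - 1\<close> letters before \<open>p\<close> and \<open>s\<close> are
  compared, as the letter at \<open>p\<close> is the one to be replaced. \<open>L\<close> bounds the
  earlier occurrence from below, and \<open>M\<close> is the limit up to which the table is known to
  describe \<open>f\<close>.\<close>

lemma agree_sound:
  fixes pos_pos' :: "'p \<Rightarrow> nat"
  assumes b: "\<And>s. D s \<noteq> U \<Longrightarrow> pos_pos' (b s) + 1 = pos_pos' s"
    and f: "\<And>s. D s \<noteq> U \<Longrightarrow> pos_pos' s \<le> M \<Longrightarrow> f (pos_pos' s) = sval (D s)"
    and g: "\<And>s. D s \<noteq> U \<Longrightarrow> g s \<Longrightarrow> L \<le> pos_pos' s"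
    and "agree D b g p s k" "D p \<noteq> U" "D s \<noteq> U" "L \<le> pos_pos' s" "pos_pos' p \<le> M" "pos_pos' s \<le> M"
  shows "L + nat_of_num k \<le> pos_pos' s + 1 \<and> (\<forall>j\<ge>1. j < nat_of_num k \<longrightarrow> f (pos_pos' p - j) = f (pos_pos' s - j))"
  using assms(4-9)
proof (induction k arbitrary: p s rule: measure_induct_rule[of nat_of_num])
  case (less k)
  show ?case
  proof (cases "k = num.One")
    case True
    with less.prems show ?thesis by simp
  next
    case False
    have k: "nat_of_num (num_pred k) + 1 = nat_of_num k"
      using False nat_of_num_pos[of k] by (auto simp: nat_of_num_num_pred num_eq_iff)
    from less.prems(1) False have e: "same (D (b p)) (D (b s))" "g (b s)" "agree D b g (b p) (b s) (num_pred k)"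
      by (subst (asm) agree.simps, auto simp: Let_def split: if_splits)+
    then have D: "D (b p) \<noteq> U" "D (b s) \<noteq> U" "D (b p) = D (b s)" by (auto simp: same_def split: if_splits)
    have pos_ix: "pos_pos' (b p) + 1 = pos_pos' p" "pos_pos' (b s) + 1 = pos_pos' s" using b less.prems by auto
    have IH: "L + nat_of_num (num_pred k) \<le> pos_pos' (b s) + 1 \<and>
        (\<forall>j\<ge>1. j < nat_of_num (num_pred k) \<longrightarrow> f (pos_pos' (b p) - j) = f (pos_pos' (b s) - j))"
      by (rule less.IH) (use k e D g pos_ix less.prems in auto)
    have "f (pos_pos' p - j) = f (pos_pos' s - j)" if j: "1 \<le> j" "j < nat_of_num k" for j
    proof (cases "j = 1")
      case True
      have "f (pos_pos' (b p)) = f (pos_pos' (b s))" using f[of "b p"] f[of "b s"] D pos_ix less.prems by auto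
      moreover have "pos_pos' p - 1 = pos_pos' (b p)" "pos_pos' s - 1 = pos_pos' (b s)" using pos_ix by simp_all
      ultimately show ?thesis using True by simp
    next
      case False
      then have "1 \<le> j - 1" "j - 1 < nat_of_num (num_pred k)" using j k by simp_all
      then have "f (pos_pos' (b p) - (j - 1)) = f (pos_pos' (b s) - (j - 1))" using IH by blast
      moreover have "pos_pos' p - j = pos_pos' (b p) - (j - 1)" "pos_pos' s - j = pos_pos' (b s) - (j - 1)" using pos_ix j by auto
      ultimately show ?thesis by simp
    qed
    with IH k pos_ix show ?thesis by auto
  qed
qed

lemma each_in_some_in: "each_in (\<lambda>c. some_in (\<lambda>t. P t c) T) B \<Longrightarrow> u \<in> set B \<Longrightarrow> \<exists>t. P t u"
  by (auto simp: each_in_iff some_in_iff)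

lemma wokD:
  assumes "repeats D b g h u k y c"
  obtains s where "h s = y" "D s = c" "g s" "agree D b g y s k"
  using assms by (auto simp: repeats_def Let_def split: if_splits)

text \<open>The comparison of odd letters extends to all letters: unless \<open>t\<close> is
  \<open>S1\<close>, where nothing besides the replaced letter is involved, \<open>m\<close> is
  even, so even letters from \<open>E\<close> on are preserved by the shift.\<close>

lemma (in tailed) repeats_forced:
  assumes "repeats D prev g (far t) (unfar t) (wlen_num t) p c" "D p \<noteq> U" "c \<noteq> U"
    "\<And>s. D s \<noteq> U \<Longrightarrow> g s \<Longrightarrow> L \<le> pos_ix s" "E \<le> 2 * L"
  shows "forced f (2 * L) (2 * pos_ix p + 1) (sval c)"
proof -
  obtain s where s: "far t s = p" "D s = c" "g s" "agree D prev g p s (wlen_num t)" using assms(1) by (rule wokD)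
  have ixp: "pos_ix p = pos_ix s + 2 * plen t" using pos_ix_far[of t s] s(1) by simp
  have Ls: "L \<le> pos_ix s" using assms(3,4) s by blast
  have "L + nat_of_num (wlen_num t) \<le> pos_ix s + 1 \<and>
     (\<forall>j\<ge>1. j < nat_of_num (wlen_num t) \<longrightarrow> f (2 * (pos_ix p - j) + 1) = f (2 * (pos_ix s - j) + 1))"
  proof (rule agree_sound[where f = "\<lambda>y. f (2 * y + 1)" and g = g and M = "pos_ix p"])
    fix r assume r: "D r \<noteq> U"
    then have "r \<noteq> (C1, num.One)" using D_first by auto
    moreover have "3 \<le> pos_ix r" using nat_of_num_pos[of "snd r"] by (simp add: pos_ix_def)
    ultimately show "pos_ix (prev r) + 1 = pos_ix r" by (simp add: pos_ix_prev)
  qed (use assms s Ls ixp data in auto)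
  then have L: "L + wlen t \<le> pos_ix s + 1"
    and eq: "\<And>j. 1 \<le> j \<Longrightarrow> j < wlen t \<Longrightarrow> f (2 * (pos_ix p - j) + 1) = f (2 * (pos_ix s - j) + 1)"
    by (simp_all add: wlen_num)
  define m where "m = plen t"
  have fs: "f (2 * pos_ix s + 1) = sval c" using data[of s] s(2) assms(3) by simp
  have xs: "2 * pos_ix p + 1 - 4 * m = 2 * pos_ix s + 1" using ixp by (simp add: m_def)
  have "f (2 * pos_ix p + 1 - j) = f (2 * pos_ix s + 1 - j)" if j: "1 \<le> j" "j < m" for j
  proof -
    have "t \<noteq> S1" using j by (auto simp: m_def)
    then have m: "m = 2 * wlen t" using wlen_plen m_def by simp
    show ?thesis
    proof (cases "even j")
      case True
      then obtain i where i: "j = 2 * i" by auto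
      then have "f (2 * (pos_ix p - i) + 1) = f (2 * (pos_ix s - i) + 1)" using j m by (intro eq) auto
      moreover have "2 * (pos_ix p - i) + 1 = 2 * pos_ix p + 1 - j" "2 * (pos_ix s - i) + 1 = 2 * pos_ix s + 1 - j"
        using i j m L ixp by auto
      ultimately show ?thesis by simp
    next
      case False
      define e where "e = 2 * pos_ix s + 1 - j"
      have le: "j \<le> 2 * pos_ix s + 1" using j m L by linarith
      then have "even e" using False by (simp add: e_def)
      moreover have "E \<le> e" using assms(5) j m L unfolding e_def by linarith
      ultimately have "f (e + 4 * m) = f e" by (rule even_shift_even) (simp add: m)
      moreover have "e + 4 * m = 2 * pos_ix p + 1 - j" using le ixp unfolding e_def m_def by simp
      ultimately show ?thesis by (simp add: e_def)
    qed
  qed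
  moreover have "2 * L + 5 * m \<le> 2 * pos_ix p + 1 + 1"
  proof (cases "t = S1")
    case True
    with ixp Ls show ?thesis by (simp add: m_def)
  next
    case False
    then have "m = 2 * wlen t" using wlen_plen m_def by simp
    with L ixp show ?thesis unfolding m_def by linarith
  qed
  moreover have "1 \<le> m" using plen_pos[of t] by (simp add: m_def)
  ultimately show ?thesis unfolding forced_def using fs xs by (intro exI[of _ m]) simp
qed

lemma sval_below: "c < sval v \<Longrightarrow> \<exists>u\<in>set (below v). u \<noteq> U \<and> sval u = c"
  by (cases v) (auto simp: less_Suc_eq numeral_eq_Suc)
lemma sval_below2: "c < sval v \<Longrightarrow> 2 \<le> c \<Longrightarrow> \<exists>u\<in>set (below2 v). u \<noteq> U \<and> sval u = c"
  by (cases v) (auto simp: less_Suc_eq numeral_eq_Suc)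
lemma sval_below3: "c < sval v \<Longrightarrow> 3 \<le> c \<Longrightarrow> \<exists>u\<in>set (below3 v). u \<noteq> U \<and> sval u = c"
  by (cases v) (auto simp: less_Suc_eq numeral_eq_Suc)

lemma sval_pos: "c < sval v \<Longrightarrow> v \<noteq> U" by auto

lemma wsym_first: "wsym (C3, num.One) = U" by code_simp

lemma okW_forced:
  assumes "okW below p" "c < sval (wsym p)"
  shows "forced wword 10 (2 * pos_ix p + 1) c"
proof -
  obtain u where u: "u \<in> set (below (wsym p))" "u \<noteq> U" "sval u = c" using sval_below[OF assms(2)] by blast
  obtain t where t: "repeats wsym prev (\<lambda>s. True) (far t) (unfar t) (wlen_num t) p u"
    using each_in_some_in[OF assms(1)[unfolded okW_def] u(1)] ..
  have "forced wword (2 * 5) (2 * pos_ix p + 1) (sval u)"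
  proof (rule W.repeats_forced[OF t])
    fix s assume s: "wsym s \<noteq> U"
    obtain c q where cq: "s = (c, q)" by fastforce
    show "5 \<le> pos_ix s"
    \<comment> \<open>In block 1 the columns 1 and 3 precede index 10, the first letter of the least
      word, and hold \<open>U\<close>; column 5 is index 11.\<close>
    proof (cases "q = num.One")
      case True
      with s cq W.D_first wsym_first have "c = C5" by (cases c) auto
      with True cq show ?thesis by (simp add: pos_ix_def)
    next
      case False
      then have "2 \<le> nat_of_num q" using nat_of_num_pos[of q] by (simp add: num_eq_iff)
      with cq show ?thesis by (simp add: pos_ix_def)
    qed
  qed (use u assms(2) in auto)
  then show ?thesis using u by simp
qed

lemma okG_forced:
  assumes "okG p" "c < sval (gsym p)" "3 \<le> c"
  shows "forced gword 12 (2 * pos_ix p + 1) c"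
proof -
  obtain u where u: "u \<in> set (below3 (gsym p))" "u \<noteq> U" "sval u = c" using sval_below3[OF assms(2,3)] by blast
  obtain t where t: "repeats gsym prev (\<lambda>s. n17 \<le> snd s) (far t) (unfar t) (wlen_num t) p u"
    using each_in_some_in[OF assms(1)[unfolded okG_def] u(1)] ..
  have "forced gword (2 * 51) (2 * pos_ix p + 1) (sval u)"
  proof (rule G.repeats_forced[OF t])
    show "gsym p \<noteq> U" using assms(2) by (rule sval_pos)
    show "51 \<le> pos_ix s" if "n17 \<le> snd s" for s using that by (simp add: pos_ix_def less_eq_num_def)
  qed (use u(2) in simp_all)
  then show ?thesis using u forced_mono[of gword 102] by simp
qed

lemma okS_forced:
  assumes "okS n" "c < sval (gscal n)" "2 \<le> c" "11 \<le> nat_of_num n" "nat_of_num n \<le> 569"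
  shows "forced gword 12 (nat_of_num n) c"
proof -
  obtain u where u: "u \<in> set (below2 (gscal n))" "u \<noteq> U" "sval u = c" using sval_below2[OF assms(2,3)] by blast
  obtain k where k: "repeats gscal num_pred (\<lambda>s. n12 \<le> s) (\<lambda>s. s + num.Bit0 (num.Bit0 k))
      (\<lambda>s. num_minus s (num.Bit0 (num.Bit0 k))) k n u"
    using each_in_some_in[OF assms(1)[unfolded okS_def] u(1)] ..
  obtain s where s: "s + num.Bit0 (num.Bit0 k) = n" "gscal s = u" "n12 \<le> s" "agree gscal num_pred (\<lambda>s. n12 \<le> s) n s k"
    using k by (rule wokD)
  have gsU: "11 \<le> nat_of_num r" if "gscal r \<noteq> U" for r
    using that by (auto simp: gscal_def less_num_def split: if_splits)
  have gsG: "gword (nat_of_num r) = sval (gscal r)" if "gscal r \<noteq> U" "nat_of_num r \<le> 569" for r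
    using gscal_gword[of "nat_of_num r"] gsU[OF that(1)] that(2) by (simp add: nat_of_num_inverse)
  have sn: "nat_of_num n = nat_of_num s + 4 * nat_of_num k" using s(1) by (auto simp: nat_of_num_add)
  have s12: "12 \<le> nat_of_num s" using s(3) by (simp add: less_eq_num_def)
  have "12 + nat_of_num k \<le> nat_of_num s + 1 \<and>
     (\<forall>j\<ge>1. j < nat_of_num k \<longrightarrow> gword (nat_of_num n - j) = gword (nat_of_num s - j))"
  proof (rule agree_sound[where g = "\<lambda>s. n12 \<le> s" and M = 569])
    show "nat_of_num (num_pred r) + 1 = nat_of_num r" if "gscal r \<noteq> U" for r
      using gsU[OF that] by (auto simp: nat_of_num_num_pred)
  qed (use s u assms gsG s12 sn sval_pos in \<open>auto simp: less_eq_num_def\<close>)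
  moreover have "gword (nat_of_num s) = c" using gsG[of s] s(2) u sn assms(5) by simp
  moreover have "1 \<le> nat_of_num k" using nat_of_num_pos[of k] by simp
  ultimately show ?thesis unfolding forced_def using sn by (intro exI[of _ "nat_of_num k"]) auto
qed

section \<open>Smaller letters in each part of the two words\<close>

lemma forced_1:
  assumes "f (x - 4) = c" "l + 5 \<le> x + 1"
  shows "forced f l x c"
  unfolding forced_def by (rule exI[of _ 1]) (use assms in auto)

lemma forced_2:
  assumes "f (x - 8) = c" "f (x - 1) = f (x - 9)" "l + 10 \<le> x + 1"
  shows "forced f l x c"
proof -
  have "f (x - j) = f (x - 4 * 2 - j)" if "1 \<le> j" "j < 2" for j
  proof -
    have "j = 1" using that by simp
    with assms(2) show ?thesis by simp
  qed
  with assms show ?thesis unfolding forced_def by (intro exI[of _ 2]) simp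
qed

lemma W_lower:
  assumes "10 \<le> x" "x < 6774" "c < wword x"
  shows "forced wword 10 x c"
proof (cases "even x")
  case True
  have c: "c = 0" "\<not> (x + 6) mod 8 < 4" using assms(3) wword_even[OF True] by (auto split: if_splits)
  have "14 \<le> x"
  proof (rule ccontr)
    assume "\<not> 14 \<le> x"
    then have "x = 10 \<or> x = 12" using assms(1) True by presburger
    with c(2) show False by auto
  qed
  moreover from this have "wword x \<noteq> wword (x - 4)" using W.flip[of "x - 4"] True by simp
  then have "wword (x - 4) = 0" using wword_even[of "x - 4"] wword_even[of x] True c by (auto split: if_splits)
  ultimately show ?thesis using c by (intro forced_1) auto
next
  case False
  then obtain y where x: "x = 2 * y + 1" by (auto elim: oddE)
  have y: "5 \<le> y" "y < 3387" using assms(1,2) x by auto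
  obtain d q where p: "pos_of y = (d, q)" by fastforce
  have ip: "pos_ix (d, q) = y" using pos_ix_pos_of[of y] p y by simp
  have c: "c < sval (wsym (d, q))" using assms(3) wword_odd[of y] x y p by simp
  have q: "nat_of_num q \<le> 1128" using ip y by (simp add: pos_ix_def)
  show ?thesis
  proof (cases "q = num.One")
    case True
    have "d = C5" using ip y(1) True by (cases d) (simp_all add: pos_ix_def)
    with c junctions(4) True show ?thesis by simp
  next
    case False
    then have "2 \<le> nat_of_num q" using nat_of_num_pos[of q] by (simp add: num_eq_iff)
    then have "okW_block q" by (intro all_between_num[OF okW_all_between]) (use q in simp_all)
    then have "okW below (d, q)" by (cases d) (simp_all add: okW_block_def each_in_iff)
    from okW_forced[OF this c] ip x show ?thesis by simp
  qed
qed

text \<open>These are the letters of \<open>h\<close> with index 12, 14 and 19. Its letters from 12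
  on cannot exclude all smaller ones there: at 12 and 14 no power fits, and at 19 only period 1 fits
  while both 2 and 3 have to be excluded. The powers are therefore sought in the least word
  itself.\<close>

lemma W_special:
  assumes "k \<in> {0, 2, 7}" "c < wword (6779 + 6 * k)"
  shows "forced wword 10 (6779 + 6 * k) c"
proof -
  define q where "q = num_of_nat (1129 + k)"
  have q: "nat_of_num q = 1129 + k" by (simp add: q_def num_of_nat_inverse)
  have x: "2 * pos_ix (C5, q) + 1 = 6779 + 6 * k" by (simp add: pos_ix_def q)
  have "q \<in> {n1129, n1131, n1136}" using assms(1) q by (auto simp: num_eq_iff)
  then have ok: "okW below (C5, q)" using okW_special by auto
  have d: "wsym (C5, q) \<noteq> U"
  proof -
    define n where "n = num_of_nat (12 + k)"
    have n: "nat_of_num n = 12 + k" by (simp add: n_def num_of_nat_inverse)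
    have "\<not> n < n11" using n by (simp add: less_num_def)
    then have "gscal n = w5 (n + n1117)" unfolding gscal_def by (rule if_not_P)
    moreover have nq: "n + n1117 = q" using n q by (simp add: num_eq_iff nat_of_num_add)
    moreover have "k \<le> 7" using assms(1) by auto
    then have "q < n1687" using q by (simp add: less_num_def)
    then have "wsym (C5, q) = w5 q" unfolding wsym.simps by (rule if_P)
    ultimately have "wsym (C5, q) = gscal (num_of_nat (12 + k))" by (simp only: n_def)
    moreover have "sval (gscal (num_of_nat (12 + k))) = gword (12 + k)" by (rule gscal_gword) (use assms(1) in auto)
    moreover have "2 \<le> gword (12 + k)" by (rule gword_ge2) simp
    ultimately show ?thesis by auto
  qed
  have "c < sval (wsym (C5, q))" using assms(2) wsym_data[OF d] x by simp
  from okW_forced[OF ok this] x show ?thesis by simp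
qed

text \<open>Up to 120 the comparison runs over all indices. Later, a smaller letter 2 is found four
  indices back at an even index and in column 1, and eight indices back in column 5, in the last two
  cases in column 3 of the previous block. Larger candidates at odd indices come from
  \<open>okG_all_between\<close>.\<close>

lemma G_lower:
  assumes "12 \<le> x" "x < 20238" "x \<notin> {12, 14, 19}" "2 \<le> c" "c < gword x"
  shows "forced gword 12 x c"
proof (cases "x \<le> 120")
  case True
  define n where "n = num_of_nat x"
  have n: "nat_of_num n = x" using assms(1) by (simp add: n_def num_of_nat_inverse)
  have "x = 13 \<or> 15 \<le> x \<and> x \<le> 18 \<or> 20 \<le> x" using assms(1,3) by auto
  then have "okS n"
  proof (elim disjE)
    assume "x = 13" then show ?thesis by (intro all_between_num[OF okS_all_between(1)]) (use n in simp_all)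
  next
    assume "15 \<le> x \<and> x \<le> 18" then show ?thesis by (intro all_between_num[OF okS_all_between(2)]) (use n in simp_all)
  next
    assume "20 \<le> x" then show ?thesis by (intro all_between_num[OF okS_all_between(3)]) (use n True in simp_all)
  qed
  moreover have "c < sval (gscal n)" using gscal_gword[of x] assms True by (simp add: n_def)
  ultimately show ?thesis using okS_forced[of n c] n assms True by simp
next
  case big: False
  show ?thesis
  proof (cases "even x")
    case True
    then have c: "c = 2" "\<not> (x + 6) mod 8 \<ge> 4" using assms(4,5) gword_even[of x] big by (auto split: if_splits)
    have "gword x \<noteq> gword (x - 4)" using G.flip[of "x - 4"] True big by simp
    then have "gword (x - 4) = 2" using gword_even[of "x - 4"] gword_even[of x] True big c by (auto split: if_splits)
    then show ?thesis using c big by (intro forced_1) auto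
  next
    case False
    then obtain y where x: "x = 2 * y + 1" by (auto elim: oddE)
    have y: "60 \<le> y" "y < 10119" using big assms(2) x by auto
    have y3: "3 \<le> y" using y(1) by simp
    obtain d q where p: "gword (2 * y + 1) = sval (gsym (d, q))" "pos_ix (d, q) = y" "nat_of_num q \<le> 3372"
      using gword_odd_data[OF y3 y(2)] by blast
    have q: "20 \<le> nat_of_num q" using pos_ix_div[of "(d, q)"] p(2) y by simp
    show ?thesis
    proof (cases "d = C3")
      case True
      then show ?thesis using gsym_C3[of q] q p x assms(4,5) by simp
    next
      case d: False
      show ?thesis
      proof (cases "3 \<le> c")
        case True
        have "okG_block q" by (rule all_between_num[OF okG_all_between]) (use q p in simp_all)
        then have "okG (d, q)" using d by (cases d) (simp_all add: okG_block_def each_in_iff)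
        from okG_forced[OF this _ True] p x assms(5) show ?thesis by simp
      next
        case False
        then have c: "c = 2" using assms(4) by simp
        show ?thesis
        proof (cases d)
          case C1
          have "y - 2 = 3 * (nat_of_num q - 1) + 1" using C1 p(2) q by (simp add: pos_ix_def)
          then have "(y - 2) mod 3 = 1" by simp
          then have "gword (2 * (y - 2) + 1) = 2" using gword_class[of "y - 2"] y by simp
          moreover have "2 * (y - 2) + 1 = x - 4" using x y by simp
          ultimately show ?thesis using c x y by (intro forced_1) auto
        next
          case C5
          have "y - 4 = 3 * (nat_of_num q - 1) + 1" using C5 p(2) q by (simp add: pos_ix_def)
          then have "(y - 4) mod 3 = 1" by simp
          then have "gword (2 * (y - 4) + 1) = 2" using gword_class[of "y - 4"] y by simp
          moreover have "2 * (y - 4) + 1 = x - 8" using x y by simp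
          moreover have "gword (x - 9 + 4 * 2) = gword (x - 9)"
            by (rule G.even_shift_even) (use x y in auto)
          moreover have "x - 9 + 4 * 2 = x - 1" using x y by simp
          ultimately show ?thesis using c x y by (intro forced_2) simp_all
        qed (use d in simp)
      qed
    qed
  qed
qed

section \<open>The lexicographically least word and the theorem\<close>

lemma power_at_power54:
  assumes "power_at (snth s) i m"
  shows "\<not> power54_free s"
proof -
  define x y where "x = stake m (sdrop i s)" and "y = stake (3 * m) (sdrop (i + m) s)"
  have x': "stake m (sdrop (i + 4 * m) s) = x"
    by (rule nth_equalityI) (use assms in \<open>auto simp: x_def power_at_def sdrop_snth\<close>)
  have "sdrop i s = x @- sdrop (i + m) s" by (simp add: x_def stake_sdrop flip: sdrop_add)
  also have "sdrop (i + m) s = y @- sdrop (i + 4 * m) s"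
    using stake_sdrop[of "3 * m" "sdrop (i + m) s"] by (simp add: y_def sdrop_add add.assoc)
  also have "sdrop (i + 4 * m) s = x @- sdrop (i + 5 * m) s"
    using stake_sdrop[of m "sdrop (i + 4 * m) s"] by (simp add: x' sdrop_add add.assoc)
  finally have "s = stake i s @- ((x @ y @ x) @- sdrop (i + 5 * m) s)"
    using stake_sdrop[of i s] by simp
  then have "factor_of (x @ y @ x) s" unfolding factor_of_def by blast
  moreover have "power54 (x @ y @ x)"
    unfolding power54_def using assms by (intro exI[of _ x] exI[of _ y]) (simp add: x_def y_def power_at_def)
  ultimately show ?thesis unfolding power54_free_def by blast
qed

lemma power54_free_smap:
  assumes "\<And>i m. \<not> power_at g i m"
  shows "power54_free (smap g nats)"
  unfolding power54_free_def
proof (intro allI impI notI)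
  fix u assume "factor_of u (smap g nats)" "power54 u"
  then obtain p t x y where s: "smap g nats = p @- ((x @ y @ x) @- t)" "1 \<le> length x" "length y = 3 * length x"
    unfolding factor_of_def power54_def by blast
  have g: "g n = (p @- ((x @ y @ x) @- t)) !! n" for n
    unfolding s(1)[symmetric] by simp
  have "power_at g (length p) (length x)"
    unfolding power_at_def
  proof (intro conjI allI impI)
    fix j assume j: "j < length x"
    have "g (length p + j) = x ! j" using j unfolding g by (simp add: shift_snth)
    moreover have "g (length p + 4 * length x + j) = x ! j"
      using j s(3) unfolding g by (simp add: shift_snth nth_append)
    ultimately show "g (length p + j) = g (length p + 4 * length x + j)" by simp
  qed (rule s(2))
  with assms show False by blast
qed

text \<open>As \<open>smap g nats\<close> is power-free, minimality of \<open>w\<close> yields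
  \<open>w !! n <= g n\<close>. A strictly smaller letter is forced and would complete a power
  inside \<open>w\<close>, because \<open>w\<close> agrees with \<open>g\<close> before
  \<open>n\<close>.\<close>

lemma greedy_step:
  assumes w: "lex_least_power54_free w" and g: "power54_free (smap g nats)"
    and eq: "\<And>i. i < n \<Longrightarrow> w !! i = g i"
    and forced: "\<And>c. c < g n \<Longrightarrow> forced g 0 n c"
  shows "w !! n = g n"
proof (rule ccontr)
  assume ne: "w !! n \<noteq> g n"
  have ws: "smap g nats = w \<or> less_fun (snth w) (snth (smap g nats))"
    using w g unfolding lex_least_power54_free_def by blast
  have "w !! n \<le> g n"
  proof (rule ccontr)
    assume gt: "\<not> w !! n \<le> g n"
    then have "less_fun (snth (smap g nats)) (snth w)"
      unfolding less_fun_def by (intro exI[of _ n]) (simp add: eq)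
    with ws less_fun_asym gt show False by auto
  qed
  with ne have "w !! n < g n" by simp
  from forced[OF this] obtain m where m: "1 \<le> m" "5 * m \<le> n + 1" "g (n - 4 * m) = w !! n"
    "\<And>j. 1 \<le> j \<Longrightarrow> j < m \<Longrightarrow> g (n - j) = g (n - 4 * m - j)" unfolding forced_def by auto
  have "power_at (snth w) (n + 1 - 5 * m) m"
    unfolding power_at_def
  proof (intro conjI allI impI)
    fix j assume j: "j < m"
    \<comment> \<open>\<open>power_at\<close> counts forwards from the start of the power,
      \<open>forced\<close> backwards from its last letter.\<close>
    define i where "i = m - 1 - j"
    have pos_ix: "n + 1 - 5 * m + j = n - 4 * m - i" "n + 1 - 5 * m + 4 * m + j = n - i"
      using j m(2) by (simp_all add: i_def)
    have "w !! (n - 4 * m - i) = g (n - 4 * m - i)" by (rule eq) (use m(1,2) j in simp)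
    moreover have "w !! (n - i) = g (n - 4 * m - i)"
    proof (cases "i = 0")
      case True
      then show ?thesis using m(3) by simp
    next
      case False
      have "w !! (n - i) = g (n - i)" by (rule eq) (use False m(1,2) j i_def in simp)
      then show ?thesis using m(4)[of i] False j by (simp add: i_def)
    qed
    ultimately show "w !! (n + 1 - 5 * m + j) = w !! (n + 1 - 5 * m + 4 * m + j)" unfolding pos_ix by simp
  qed (rule m(1))
  with power_at_power54 w show False unfolding lex_least_power54_free_def by blast
qed

section \<open>The columns of the morphism\<close>

lemma phi_Cons: "phi (a # u) = phi_letter a @ phi u" by (simp add: phi_def)

lemma phi_nth: "k < length u \<Longrightarrow> r < 6 \<Longrightarrow> phi u ! (6 * k + r) = phi_letter (u ! k) ! r"
proof (induction u arbitrary: k)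
  case (Cons a u)
  show ?case
  proof (cases k)
    case 0
    with Cons.prems show ?thesis by (simp add: phi_Cons nth_append phi_letter_length)
  next
    case (Suc l)
    then have "phi (a # u) ! (6 * k + r) = phi u ! (6 * l + r)"
      by (simp add: phi_Cons nth_append phi_letter_length)
    with Suc Cons show ?thesis by simp
  qed
qed simp

lemma of_nat_8: "(of_nat (8 * q + e) :: 8) = of_nat e"
proof -
  have "(8 :: 8) = 0" by simp
  moreover have "(of_nat (8 * q + e) :: 8) = 8 * of_nat q + of_nat e" by simp
  ultimately show ?thesis by (simp only: mult_zero_left add_0)
qed

definition last_entry :: "letter \<Rightarrow> int" where "last_entry a = fst (phi_letter a ! 5)"

lemma residue_cases:
  obtains q e where "(J :: nat) = 8 * q + e" "e \<in> {0, 1, 2, 3, 4, 5, 6, 7}"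
proof
  show "J = 8 * (J div 8) + J mod 8" by simp
  have "J mod 8 < 8" by simp
  then show "J mod 8 \<in> {0, 1, 2, 3, 4, 5, 6, 7}" by auto
qed

text \<open>The image of a letter with subscript \<open>J\<close> begins with the subscript
  \<open>6 * J\<close>, so subscripts keep increasing across blocks. The claims are checked for the
  48 pairs of a subscript and a column.\<close>

lemma phi_letter_column:
  assumes "snd a = of_nat J" "r < 6"
  shows "snd (phi_letter a ! r) = of_nat (6 * J + r)"
    and "r = 1 \<Longrightarrow> fst (phi_letter a ! r) = 1 \<and> last_entry (phi_letter a ! r) = 3"
    and "r = 3 \<Longrightarrow> fst (phi_letter a ! r) = 0 \<and> last_entry (phi_letter a ! r) = 2"
    and "r = 5 \<Longrightarrow> last_entry (phi_letter a ! r) = last_entry a + 2"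
    and "even r \<Longrightarrow> fst (phi_letter a ! r) = (if (6 * J + r) mod 8 < 4 then 0 else 1)"
    and "even r \<Longrightarrow> last_entry (phi_letter a ! r) = (if (6 * J + r) mod 8 < 4 then 3 else 2)"
proof -
  obtain q e where J: "J = 8 * q + e" "e \<in> {0, 1, 2, 3, 4, 5, 6, 7}" by (rule residue_cases)
  obtain n where a: "a = (n, of_nat e)" using assms(1) of_nat_8[of q e] J(1) by (cases a) auto
  have m: "(6 * J + r) mod 8 = (6 * e + r) mod 8" unfolding J(1) by presburger
  have o: "(of_nat (6 * J + r) :: 8) = of_nat (6 * e + r)"
    using of_nat_8[of "6 * q" "6 * e + r"] J(1) by (simp add: algebra_simps)
  have r: "r \<in> {0, 1, 2, 3, 4, 5}" using assms(2) by auto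
  have *: "snd (phi_letter a ! r) = of_nat (6 * e + r)
    \<and> (r = 1 \<longrightarrow> fst (phi_letter a ! r) = 1 \<and> last_entry (phi_letter a ! r) = 3)
    \<and> (r = 3 \<longrightarrow> fst (phi_letter a ! r) = 0 \<and> last_entry (phi_letter a ! r) = 2)
    \<and> (r = 5 \<longrightarrow> last_entry (phi_letter a ! r) = last_entry a + 2)
    \<and> (even r \<longrightarrow> fst (phi_letter a ! r) = (if (6 * e + r) mod 8 < 4 then 0 else 1))
    \<and> (even r \<longrightarrow> last_entry (phi_letter a ! r) = (if (6 * e + r) mod 8 < 4 then 3 else 2))"
    using J(2) r unfolding a insert_iff empty_iff
    by (elim disjE FalseE) (simp_all add: phi_letter_simps last_entry_def)
  then show "snd (phi_letter a ! r) = of_nat (6 * J + r)"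
    "r = 1 \<Longrightarrow> fst (phi_letter a ! r) = 1 \<and> last_entry (phi_letter a ! r) = 3"
    "r = 3 \<Longrightarrow> fst (phi_letter a ! r) = 0 \<and> last_entry (phi_letter a ! r) = 2"
    "r = 5 \<Longrightarrow> last_entry (phi_letter a ! r) = last_entry a + 2"
    "even r \<Longrightarrow> fst (phi_letter a ! r) = (if (6 * J + r) mod 8 < 4 then 0 else 1)"
    "even r \<Longrightarrow> last_entry (phi_letter a ! r) = (if (6 * J + r) mod 8 < 4 then 3 else 2)"
    unfolding o m by blast+
qed

lemma W_free: "power54_free (smap (\<lambda>n. wword (n + 10)) nats)"
proof (rule power54_free_smap)
  fix i m
  show "\<not> power_at (\<lambda>n. wword (n + 10)) i m"
    using W_no_power_at[of "i + 10" m] by (auto simp: power_at_def add_ac)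
qed

lemma forced_shift:
  assumes "forced f d (n + d) c"
  shows "forced (\<lambda>n. f (n + d)) 0 n c"
proof -
  obtain m where m: "1 \<le> m" "d + 5 * m \<le> n + d + 1" "f (n + d - 4 * m) = c"
    "\<And>j. 1 \<le> j \<Longrightarrow> j < m \<Longrightarrow> f (n + d - j) = f (n + d - 4 * m - j)"
    using assms unfolding forced_def by blast
  have "n - 4 * m + d = n + d - 4 * m" using m(2) by simp
  moreover have "f (n - j + d) = f (n - 4 * m - j + d)" if "1 \<le> j" "j < m" for j
  proof -
    have "n - j + d = n + d - j" "n - 4 * m - j + d = n + d - 4 * m - j" using m(2) that by simp_all
    with m(4)[OF that] show ?thesis by simp
  qed
  ultimately show ?thesis unfolding forced_def using m by (intro exI[of _ m]) simp
qed

text \<open>A repetition among the letters \<open>gword\<close> in the last columns extends to whole blocks of \<open>wword\<close>.\<close>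

lemma forced_lift:
  assumes "forced gword 12 (k + 12) c"
  shows "forced wword 10 (6779 + 6 * k) c"
proof -
  obtain m where m: "1 \<le> m" "12 + 5 * m \<le> k + 12 + 1" "gword (k + 12 - 4 * m) = c"
    and eq: "\<And>j. 1 \<le> j \<Longrightarrow> j < m \<Longrightarrow> gword (k + 12 - j) = gword (k + 12 - 4 * m - j)"
    using assms unfolding forced_def by blast
  have last: "wword (6779 + 6 * k - 6 * i) = gword (k + 12 - i)" if "i \<le> k" for i
  proof -
    have "wword (6 * (1129 + k - i) + 5) = gword (1129 + k - i - 1117)" by (rule wword_col) (use that in simp)
    moreover have "6 * (1129 + k - i) + 5 = 6779 + 6 * k - 6 * i" "1129 + k - i - 1117 = k + 12 - i"
      using that by simp_all
    ultimately show ?thesis by simp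
  qed
  have "wword (6779 + 6 * k - j) = wword (6779 + 6 * k - 4 * (6 * m) - j)" if j: "1 \<le> j" "j < 6 * m" for j
  proof -
    define q where "q = 1129 + k - (j div 6)"
    define e where "e = j mod 6"
    have j6: "j = 6 * (j div 6) + e" "e \<le> 5" by (simp_all add: e_def)
    have dm: "j div 6 < m" using j by (simp add: less_mult_imp_div_less mult.commute)
    have x: "6779 + 6 * k - j = 6 * q + (5 - e)" "6779 + 6 * k - 4 * (6 * m) - j = 6 * (q - 4 * m) + (5 - e)"
      using j6 dm m(2) unfolding q_def by linarith+
    have q: "1129 \<le> q - 4 * m" using dm m(2) unfolding q_def by linarith
    \<comment> \<open>The index \<open>j\<close> steps back lies in column \<open>5 - e\<close>:
      even columns are preserved because \<open>6 * m\<close> is even, columns 1 and 3 are constant,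
      and only column 5 draws on the repetition in \<open>gword\<close>.\<close>
    have "odd e \<or> e = 0 \<or> e = 2 \<or> e = 4" using j6(2) by presburger
    then consider "odd e" | "e = 0" | "e = 2" | "e = 4" by blast
    then show ?thesis
    proof cases
      case 1
      define y where "y = 6 * (q - 4 * m) + (5 - e)"
      have "even y" using 1 j6(2) by (simp add: y_def)
      have "6 * q + (5 - e) = y + 4 * (6 * m)" using q unfolding y_def by linarith
      moreover have "wword (y + 4 * (6 * m)) = wword y"
        by (rule W.even_shift_even) (use \<open>even y\<close> q y_def in simp_all)
      ultimately have "wword (6 * q + (5 - e)) = wword y" by (simp only:)
      then show ?thesis unfolding x y_def .
    next
      case 2
      have d: "1 \<le> j div 6" using 2 j6 j by (cases "j div 6") simp_all
      have "wword (6779 + 6 * k - 6 * (j div 6)) = wword (6779 + 6 * k - 6 * (4 * m + j div 6))"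
        using last[of "j div 6"] last[of "4 * m + j div 6"] eq[OF d dm] dm m(2) by (simp add: diff_diff_eq)
      moreover have "6 * (j div 6) = j" using j6 2 by simp
      moreover have "6779 + 6 * k - 6 * (4 * m + j div 6) = 6779 + 6 * k - 4 * (6 * m) - j"
        using calculation(2) by simp
      ultimately show ?thesis by simp
    next
      case 3
      then show ?thesis unfolding x using q wword_col(2)[of q] wword_col(2)[of "q - 4 * m"] by simp
    next
      case 4
      then show ?thesis unfolding x using q wword_col(1)[of q] wword_col(1)[of "q - 4 * m"] by simp
    qed
  qed
  moreover have "wword (6779 + 6 * k - 4 * (6 * m)) = c" using last[of "4 * m"] m by simp
  ultimately show ?thesis unfolding forced_def using m(1,2) by (intro exI[of _ "6 * m"]) simp
qed

text \<open>Letters from 2 on are forced in \<open>h\<close> and lifted. The letter 1 stands four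
  indices back in column 1, and 0 eight indices back in column 3 of the previous block, where the
  even letter in between repeats as well.\<close>

lemma W_lower_last:
  assumes "k < 20226" "c < wword (6779 + 6 * k)"
  shows "forced wword 10 (6779 + 6 * k) c"
proof (cases "k \<in> {0, 2, 7}")
  case True
  then show ?thesis using W_special assms(2) by blast
next
  case False
  have W: "wword (6779 + 6 * k) = gword (k + 12)" using wword_col(3)[of "1129 + k"] by (simp add: algebra_simps)
  consider "2 \<le> c" | "c = 1" | "c = 0" by linarith
  then show ?thesis
  proof cases
    case 1
    have "forced gword 12 (k + 12) c" by (rule G_lower) (use False assms W 1 in auto)
    then show ?thesis by (rule forced_lift)
  next
    case 2
    have "wword (6779 + 6 * k - 4) = 1" using wword_col(1)[of "1129 + k"] by (simp add: algebra_simps)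
    with 2 show ?thesis by (intro forced_1) simp_all
  next
    case 3
    \<comment> \<open>For \<open>k = 0\<close> the previous block is the last one before the tail,
      which is why its column 3 is among the junction letters.\<close>
    have "wword (6779 + 6 * k - 8) = 0" using junction_letters(5) wword_col(2)[of "1128 + k"] by (cases k) (simp_all add: algebra_simps)
    moreover have "wword (6770 + 6 * k + 4 * 2) = wword (6770 + 6 * k)" by (rule W.even_shift_even) simp_all
    ultimately show ?thesis using 3 by (intro forced_2) simp_all
  qed
qed

section \<open>Identification of the least word\<close>

context
  fixes z assumes z: "is_z z"
begin

lemma length_z: "length z = 20226" using z by (simp add: is_z_def)

lemma snd_z: "k < 20226 \<Longrightarrow> snd (z ! k) = of_nat (k + 2)"
proof -
  assume k: "k < 20226"
  have "z \<noteq> []" using length_z by auto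
  with z k subscript_increasing_nth[of z k] show ?thesis by (simp add: is_z_def add.commute)
qed

lemma w54_z:
  assumes "k < 20226" "r < 6"
  shows "int (w54 !! (6764 + 6 * k + r)) = fst (phi_letter (z ! k) ! r)"
proof -
  have lt: "6 * k + r < 6 * 20226" using assms by linarith
  have "map tau (phi z) ! (6 * k + r) = map int (stake (6 * 20226) (sdrop 6764 w54)) ! (6 * k + r)"
    using z by (simp add: is_z_def)
  moreover have "map tau (phi z) ! (6 * k + r) = fst (phi_letter (z ! k) ! r)"
    using lt assms length_z by (simp add: phi_length phi_nth tau_def)
  moreover have "map int (stake (6 * 20226) (sdrop 6764 w54)) ! (6 * k + r) = int (w54 !! (6764 + (6 * k + r)))"
    using lt by (simp add: sdrop_snth)
  ultimately show ?thesis by (simp add: add.assoc)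
qed

text \<open>The bound is \<open>6764 + 6 * 20226\<close>, the end of the part described by
  \<open>z\<close>. From 6764 on the columns 0 to 4 are read off from \<open>is_z\<close>, as
  \<open>phi\<close> does not let them depend on the values of \<open>z\<close>; the greedy argument
  is applied to column 5.\<close>

lemma w54_wword: "n < 128120 \<Longrightarrow> w54 !! n = wword (n + 10)"
proof (induction n rule: less_induct)
  case (less n)
  have step: ?case if "\<And>c. c < wword (n + 10) \<Longrightarrow> forced wword 10 (n + 10) c"
  proof (rule greedy_step[OF w54_lex_least W_free])
    show "w54 !! i = wword (i + 10)" if "i < n" for i using less that by simp
    show "forced (\<lambda>n. wword (n + 10)) 0 n c" if "c < wword (n + 10)" for c
      by (rule forced_shift) (use \<open>\<And>c. c < wword (n + 10) \<Longrightarrow> forced wword 10 (n + 10) c\<close> that in blast)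
  qed
  show ?case
  proof (cases "n < 6764")
    case True
    then show ?thesis by (intro step W_lower) simp_all
  next
    case False
    define k r where "k = (n - 6764) div 6" and "r = (n - 6764) mod 6"
    have n: "n = 6764 + 6 * k + r" "r < 6" using False by (simp_all add: k_def r_def)
    have k: "k < 20226" using n less.prems by linarith
    have x: "n + 10 = 6774 + 6 * k + r" using n by simp
    have w: "int (w54 !! n) = fst (phi_letter (z ! k) ! r)" using w54_z[OF k n(2)] n(1) by simp
    note col = phi_letter_column[OF snd_z[OF k] n(2)]
    have "even r \<or> r = 1 \<or> r = 3 \<or> r = 5" using n(2) by presburger
    then consider "even r" | "r = 1" | "r = 3" | "r = 5" by blast
    then show ?thesis
    proof cases
      case 1
      have "(n + 10 + 6) mod 8 = (6 * (k + 2) + r) mod 8" unfolding x by presburger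
      moreover have "even (n + 10)" using 1 unfolding x by simp
      ultimately have "int (w54 !! n) = int (wword (n + 10))" using w col(5)[OF 1] wword_even[of "n + 10"] by simp
      then show ?thesis by simp
    next
      case 2
      then have "int (w54 !! n) = int (wword (n + 10))"
        using w col(2) x wword_col(1)[of "1129 + k"] by (simp add: algebra_simps)
      then show ?thesis by simp
    next
      case 3
      then have "int (w54 !! n) = int (wword (n + 10))"
        using w col(3) x wword_col(2)[of "1129 + k"] by (simp add: algebra_simps)
      then show ?thesis by simp
    next
      case 4
      then have "n + 10 = 6779 + 6 * k" using x by simp
      with W_lower_last[OF k] show ?thesis by (intro step) simp
    qed
  qed
qed

lemma last_entry_z: "k < 20226 \<Longrightarrow> last_entry (z ! k) = int (gword (k + 12))"
proof -
  assume k: "k < 20226"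
  have "last_entry (z ! k) = int (w54 !! (6764 + 6 * k + 5))" unfolding last_entry_def by (rule w54_z[symmetric]) (use k in simp_all)
  also have "w54 !! (6764 + 6 * k + 5) = wword (6764 + 6 * k + 5 + 10)" by (rule w54_wword) (use k in simp)
  also have "\<dots> = gword (k + 12)" using wword_col(3)[of "1129 + k"] by (simp add: algebra_simps)
  finally show ?thesis .
qed

end

section \<open>The infinite word \<open>s\<close>\<close>

lemma phi_concat: "phi (concat us) = concat (map phi us)"
  by (induction us) (simp_all add: phi_def)

text \<open>This is the fixed point equation for \<open>s\<close>, namely \<open>z\<close> followed
  by the image of \<open>s\<close>, read letter by letter. Since \<open>phi\<close> acts on finite
  words, it is obtained from a prefix \<open>C\<close> of \<open>s\<close> with more than
  \<open>q\<close> letters, whose image is a prefix of \<open>s_word (phi z)\<close>.\<close>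

lemma s_word_nth:
  assumes "z \<noteq> []" "r < 6"
  shows "s_word z !! (length z + (6 * q + r)) = phi_letter (s_word z !! q) ! r"
proof -
  define C where "C = concat (map (\<lambda>k. (phi ^^ k) z) [0..<Suc q])"
  have "length (concat (map (\<lambda>k. (phi ^^ k) z) [0..<n])) \<ge> n" for n
  proof (induction n)
    case (Suc n)
    have "0 < 6 ^ n * length z" using assms(1) by simp
    moreover have "length (concat (map (\<lambda>k. (phi ^^ k) z) [0..<Suc n])) =
        length (concat (map (\<lambda>k. (phi ^^ k) z) [0..<n])) + 6 ^ n * length z"
      by (simp add: phi_funpow_length)
    ultimately show ?case using Suc by linarith
  qed simp
  then have lenC: "q < length C" unfolding C_def by (metis Suc_le_lessD)
  have "s_word z = C @- s_word ((phi ^^ Suc q) z)"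
    unfolding C_def by (rule s_word_prefix[OF assms(1)])
  then have sq: "s_word z !! q = C ! q" using lenC by (simp add: shift_snth_less)
  have pz: "phi z \<noteq> []" using assms(1) phi_length[of z] by auto
  have "concat (map (\<lambda>k. (phi ^^ k) (phi z)) [0..<Suc q]) = phi C"
    unfolding C_def phi_concat by (simp only: map_map comp_def funpow_swap1)
  with s_word_prefix[OF pz, of "Suc q"] have "s_word (phi z) = phi C @- s_word ((phi ^^ Suc q) (phi z))"
    by (simp only:)
  moreover have "6 * q + r < length (phi C)" using lenC assms(2) by (simp add: phi_length)
  ultimately have "s_word (phi z) !! (6 * q + r) = phi C ! (6 * q + r)" by (simp add: shift_snth_less)
  also have "\<dots> = phi_letter (C ! q) ! r" by (rule phi_nth[OF lenC assms(2)])
  finally show ?thesis using s_word_unfold[OF assms(1)] sq by (metis add_diff_cancel_left' le_add1 shift_snth_ge)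
qed

lemma s_word_last_entry:
  assumes "is_z z"
  shows "snd (s_word z !! k) = of_nat (k + 2) \<and> last_entry (s_word z !! k) = int (gword (k + 12))"
proof (induction k rule: less_induct)
  case (less k)
  have len: "length z = 20226" and ne: "z \<noteq> []" using length_z[OF assms] by auto
  show ?case
  proof (cases "k < 20226")
    case True
    have "s_word z !! k = z ! k" using s_word_unfold[OF ne] True len by (metis shift_snth_less)
    with True snd_z[OF assms] last_entry_z[OF assms] show ?thesis by simp
  next
    case False
    define q r where "q = (k - 20226) div 6" and "r = (k - 20226) mod 6"
    have k: "k = 20226 + (6 * q + r)" "r < 6" using False by (simp_all add: q_def r_def)
    have s: "s_word z !! k = phi_letter (s_word z !! q) ! r" using s_word_nth[OF ne k(2), of q] len k(1) by simp
    have IH: "snd (s_word z !! q) = of_nat (q + 2)" "last_entry (s_word z !! q) = int (gword (q + 12))"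
      using less.IH[of q] k by simp_all
    note col = phi_letter_column[OF IH(1) k(2)]
    \<comment> \<open>Since \<open>20226 + 2 = 8 * 2527 + 12\<close>, the image of \<open>z\<close>
      begins with the subscript that follows the last one of \<open>z\<close>.\<close>
    have "k + 2 = 8 * 2527 + (6 * (q + 2) + r)" using k by simp
    then have sub: "snd (s_word z !! k) = of_nat (k + 2)" using col(1) of_nat_8 s by metis
    have x: "k + 12 = 6 * (3373 + q) + r" using k by simp
    have "last_entry (s_word z !! k) = int (gword (k + 12))"
    proof -
      have "even r \<or> r = 1 \<or> r = 3 \<or> r = 5" using k(2) by presburger
      then consider "even r" | "r = 1" | "r = 3" | "r = 5" by blast
      then show ?thesis
      proof cases
        case 1
        have "(k + 12 + 6) mod 8 = (6 * (q + 2) + r) mod 8" unfolding x by presburger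
        moreover have "even (k + 12)" using 1 unfolding x by simp
        ultimately show ?thesis using s col(6)[OF 1] gword_even[of "k + 12"] k(1) by simp
      next
        case 2
        then show ?thesis using s col(2) gword_col(1)[of "3373 + q"] unfolding x by simp
      next
        case 3
        then show ?thesis using s col(3) gword_col(2)[of "3373 + q"] unfolding x by simp
      next
        case 4
        then show ?thesis using s col(4) IH(2) gword_col(3)[of "3373 + q"] unfolding x by (simp add: add.commute)
      qed
    qed
    with sub show ?thesis by simp
  qed
qed

theorem theorem4p8:
  fixes z :: "letter list"
  assumes "is_z z"
  shows "pre_power54_free (s_word z)"
  unfolding pre_power54_free_def
proof (intro allI impI notI)
  fix u assume "factor_of u (s_word z)" "pre_power54 u"
  then obtain p t x y where s: "s_word z = p @- (u @- t)"
    and u: "phi u = x @ y @ x" "1 \<le> length x" "length y = 3 * length x"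
    unfolding factor_of_def pre_power54_def power54_def by blast
  \<comment> \<open>The lengths alone align the power with the blocks: \<open>x\<close> has length
    \<open>6 * m\<close>, so both of its occurrences consist of whole images of letters.\<close>
  have "6 * length u = 5 * length x" using arg_cong[OF u(1), of length] u(3) by (simp add: phi_length)
  moreover from this have "length u \<le> length x" by linarith
  then obtain m where "length x = length u + m" using le_iff_add by blast
  ultimately have m: "length x = 6 * m" "length u = 5 * m" by simp_all
  have last_entry: "int (gword (length p + j + 12)) = last_entry (u ! j)" if "j < 5 * m" for j
  proof -
    have "s_word z !! (length p + j) = u ! j" unfolding s using that m by (simp add: shift_snth)
    with s_word_last_entry[OF assms, of "length p + j"] show ?thesis by simp
  qed
  have "power_at gword (length p + 12) m"
    unfolding power_at_def
  proof (intro conjI allI impI)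
    show "1 \<le> m" using u(2) m(1) by simp
  next
    fix j assume j: "j < m"
    have "last_entry (u ! j) = fst (phi u ! (6 * j + 5))" unfolding last_entry_def by (subst phi_nth) (use j m in simp_all)
    also have "phi u ! (6 * j + 5) = phi u ! (6 * (4 * m + j) + 5)"
      using j m u by (simp add: nth_append)
    also have "fst \<dots> = last_entry (u ! (4 * m + j))" unfolding last_entry_def by (subst phi_nth) (use j m in simp_all)
    finally have "int (gword (length p + j + 12)) = int (gword (length p + (4 * m + j) + 12))"
      using last_entry[of j] last_entry[of "4 * m + j"] j by simp
    then show "gword (length p + 12 + j) = gword (length p + 12 + 4 * m + j)" by (simp add: add_ac)
  qed
  with G_no_power_at show False by simp
qed

end
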